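(* Let $\phi$ be an LTL formula over $P=I\uplus O$ with weight function $w_P:\mathrm{Lit}(P)\to\mathbb{Z}$, let $\nu\in\mathbb{Q}$, and let $w_\nu:\mathrm{Lit}(P)\to\mathbb{Q}$ be a weight function whose extension to letters satisfies $w_\nu(\sigma)=w_P(\sigma)-\nu$ for every $\sigma\in\Sigma_P$. Let $\mathcal{A}$ be a deterministic complete parity automaton with $L(\mathcal A)=[\![\phi]\!]$, and let $G_\phi$ be the game graph built from $\mathcal A$ (as described in the context), with $|S|$ states and $d$ priorities. Then: (1) $\phi$ is MP-realizable under finite memory for threshold $\nu$ (with weights $w_P$) if and only if $\phi$ is E-realizable with weights $w_\nu$; (2) if $\phi$ is MP-realizable under finite memory for threshold $\nu$, Player $O$ has a winning strategy whose memory size is at most $4\cdot|S|^2\cdot d\cdot W$, where $W$ is the largest absolute value of an edge weight of $G_\phi$ when $G_\phi$ is equipped with the edge weights induced by $w_\nu$.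
   Context: $P$ is a finite set of atomic propositions partitioned into inputs $I$ (Player $I$) and outputs $O$ (Player $O$); $\Sigma_P=2^P$, $\Sigma_I=2^I$, $\Sigma_O=2^O$. Game: Player $O$ chooses $o_0\in\Sigma_O$, Player $I$ responds $i_0\in\Sigma_I$, then $o_1$, $i_1$, ...; outcome $(o_0\cup i_0)(o_1\cup i_1)\cdots$. Strategies $\lambda_O:(\Sigma_O\Sigma_I)^*\to\Sigma_O$, $\lambda_I:(\Sigma_O\Sigma_I)^*\Sigma_O\to\Sigma_I$; $\lambda_O$ is finite-memory with memory size $k$ if there is a right-congruence with $k$ classes on $(\Sigma_O\Sigma_I)^*$ on whose classes $\lambda_O$ is constant. A weight function $w$ on $\mathrm{Lit}(P)=P\cup\{\neg p\}$ extends to $\Sigma_I$ by $w(i)=\sum_{p\in i}w(p)+\sum_{p\in I\setminus i}w(\neg p)$, similarly to $\Sigma_O$, and $w(o\cup i)=w(o)+w(i)$. For $u=\sigma_0\sigma_1\cdots$: $\mathsf{EL}(u(n))=\sum_{k<n}w(\sigma_k)$, $\mathsf{MP}(u)=\liminf_n\frac1n\mathsf{EL}(u(n))$, $\mathsf{Val}(u)=\mathsf{MP}(u)$ if $u\models\phi$, else $-\infty$. MP-realizable under finite memory for $\nu$: some finite-memory $\lambda_O$ has $\mathsf{Val}(\mathsf{Outcome}(\lambda_O,\lambda_I))\ge\nu$ for all $\lambda_I$. E-realizable: there exist $\lambda_O$ and $c_0\in\mathbb{N}$ such that for all $\lambda_I$, $u=\mathsf{Outcome}(\lambda_O,\lambda_I)\models\phi$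 and $c_0+\mathsf{EL}(u(n))\ge0$ for all $n$. A deterministic complete parity automaton $\mathcal A=(\Sigma_P,Q,q_0,\delta,p)$ has $\delta:Q\times\Sigma_P\to Q$ and priorities $p:Q\to\mathbb{N}$; it accepts $u$ iff the minimal priority of states visited infinitely often by its run on $u$ is even. The game graph $G_\phi$: Player-1 states $S_1=Q\times\Sigma_I$, Player-2 states $S_2=Q\times\Sigma_O$ (restricted to those reachable from the initial state), initial state $(q_0,j_0)$ for a fixed $j_0\in\Sigma_I$; for each $q\in Q$, $o\in\Sigma_O$, $i\in\Sigma_I$ with $q'=\delta(q,o\cup i)$, there are edges $((q,j),(q,o))$ for all $j\in\Sigma_I$ and $((q,o),(q',i))$; the priority of $(q,x)$ is $p(q)$; given a weight function $w$ on literals, an edge ending in $(q,o)$ has weight $w(o)$ and an edge ending in $(q,i)$ has weight $w(i)$.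
   Formalization: In (2) the bound 4|S|²dW fails for rational or zero weights (φ=true, all w_ν=1/1000 gives a bound below 1), so W is replaced by max(1, bW) for any b≥1 making every b·(edge weight) an integer; for integer edge weights with W≠0 this is the stated bound. *)

theory Defs
  imports Complex_Main "HOL-Library.Extended_Real" "HOL-Library.Liminf_Limsup"
    "HOL-Library.FuncSet" "HOL-Library.Infinite_Set"
begin

subsection \<open>LTL over infinite words\<close>

datatype (atoms: 'p) ltl =
    LTrue
  | LAtom 'p
  | LNot "'p ltl"
  | LOr "'p ltl" "'p ltl"
  | LNext "'p ltl"
  | LUntil "'p ltl" "'p ltl"

primrec sat :: "(nat \<Rightarrow> 'p set) \<Rightarrow> 'p ltl \<Rightarrow> bool"  (infix "\<Turnstile>" 55) where
  "u \<Turnstile> LTrue \<longleftrightarrow> True"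
| "u \<Turnstile> LAtom p \<longleftrightarrow> p \<in> u 0"
| "u \<Turnstile> LNot f \<longleftrightarrow> \<not> (u \<Turnstile> f)"
| "u \<Turnstile> LOr f g \<longleftrightarrow> u \<Turnstile> f \<or> u \<Turnstile> g"
| "u \<Turnstile> LNext f \<longleftrightarrow> (\<lambda>n. u (Suc n)) \<Turnstile> f"
| "u \<Turnstile> LUntil f g \<longleftrightarrow>
     (\<exists>k. (\<lambda>n. u (k + n)) \<Turnstile> g \<and> (\<forall>j<k. (\<lambda>n. u (j + n)) \<Turnstile> f))"

definition words :: "'p set \<Rightarrow> (nat \<Rightarrow> 'p set) set" where
  "words P = {u. \<forall>n. u n \<in> Pow P}"

definition ltl_language :: "'p set \<Rightarrow> 'p ltl \<Rightarrow> (nat \<Rightarrow> 'p set) set" where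
  "ltl_language P \<phi> = {u \<in> words P. u \<Turnstile> \<phi>}"


subsection \<open>Weights\<close>

datatype 'p lit = Pos 'p | Neg 'p

text \<open>\<open>set_weight w A x\<close> is the weight of \<open>x \<in> Pow A\<close>, for \<open>A\<close> the inputs or the outputs.\<close>

definition set_weight :: "('p lit \<Rightarrow> rat) \<Rightarrow> 'p set \<Rightarrow> 'p set \<Rightarrow> rat" where
  "set_weight w A x = (\<Sum>p\<in>x. w (Pos p)) + (\<Sum>p\<in>A - x. w (Neg p))"

definition letter_weight :: "'p set \<Rightarrow> 'p set \<Rightarrow> ('p lit \<Rightarrow> rat) \<Rightarrow> 'p set \<Rightarrow> rat" where
  "letter_weight Inp Out w \<sigma> =
     set_weight w Out (\<sigma> \<inter> Out) + set_weight w Inp (\<sigma> \<inter> Inp)"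

definition EL :: "'p set \<Rightarrow> 'p set \<Rightarrow> ('p lit \<Rightarrow> rat) \<Rightarrow> (nat \<Rightarrow> 'p set) \<Rightarrow> nat \<Rightarrow> rat" where
  "EL Inp Out w u n = (\<Sum>k<n. letter_weight Inp Out w (u k))"

definition MP :: "'p set \<Rightarrow> 'p set \<Rightarrow> ('p lit \<Rightarrow> rat) \<Rightarrow> (nat \<Rightarrow> 'p set) \<Rightarrow> ereal" where
  "MP Inp Out w u = liminf (\<lambda>n. ereal (real_of_rat (EL Inp Out w u n) / real n))"

definition Val ::
  "'p set \<Rightarrow> 'p set \<Rightarrow> 'p ltl \<Rightarrow> ('p lit \<Rightarrow> rat) \<Rightarrow> (nat \<Rightarrow> 'p set) \<Rightarrow> ereal" where
  "Val Inp Out \<phi> w u = (if u \<Turnstile> \<phi> then MP Inp Out w u else - \<infinity>)"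


subsection \<open>Strategies and outcomes\<close>

text \<open>A finite play is a list of rounds \<open>(o, i)\<close>; Player O moves first in each round.\<close>

type_synonym 'p round = "'p set \<times> 'p set"

definition histories :: "'p set \<Rightarrow> 'p set \<Rightarrow> 'p round list set" where
  "histories Inp Out = lists (Pow Out \<times> Pow Inp)"

definition strategies_O :: "'p set \<Rightarrow> 'p set \<Rightarrow> ('p round list \<Rightarrow> 'p set) set" where
  "strategies_O Inp Out = histories Inp Out \<rightarrow> Pow Out"

definition strategies_I :: "'p set \<Rightarrow> 'p set \<Rightarrow> ('p round list \<Rightarrow> 'p set \<Rightarrow> 'p set) set" where
  "strategies_I Inp Out = histories Inp Out \<rightarrow> (Pow Out \<rightarrow> Pow Inp)"

primrec play_prefix ::
  "('p round list \<Rightarrow> 'p set) \<Rightarrow> ('p round list \<Rightarrow> 'p set \<Rightarrow> 'p set) \<Rightarrow> nat \<Rightarrow> 'p round list" where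
  "play_prefix sO sI 0 = []"
| "play_prefix sO sI (Suc n) =
     (let h = play_prefix sO sI n in h @ [(sO h, sI h (sO h))])"

definition outcome ::
  "('p round list \<Rightarrow> 'p set) \<Rightarrow> ('p round list \<Rightarrow> 'p set \<Rightarrow> 'p set) \<Rightarrow> nat \<Rightarrow> 'p set" where
  "outcome sO sI n = (let h = play_prefix sO sI n in sO h \<union> sI h (sO h))"

definition right_congruence :: "'p set \<Rightarrow> 'p set \<Rightarrow> ('p round list \<times> 'p round list) set \<Rightarrow> bool" where
  "right_congruence Inp Out R \<longleftrightarrow>
     equiv (histories Inp Out) R \<and>
     (\<forall>(h, h') \<in> R. \<forall>r \<in> Pow Out \<times> Pow Inp. (h @ [r], h' @ [r]) \<in> R)"

definition memory_size :: "'p set \<Rightarrow> 'p set \<Rightarrow> ('p round list \<Rightarrow> 'p set) \<Rightarrow> nat \<Rightarrow> bool" where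
  "memory_size Inp Out sO k \<longleftrightarrow>
     (\<exists>R. right_congruence Inp Out R \<and>
          finite (histories Inp Out // R) \<and> card (histories Inp Out // R) = k \<and>
          (\<forall>(h, h') \<in> R. sO h = sO h'))"


subsection \<open>Realizability\<close>

definition MP_winning ::
  "'p set \<Rightarrow> 'p set \<Rightarrow> 'p ltl \<Rightarrow> ('p lit \<Rightarrow> rat) \<Rightarrow> rat \<Rightarrow> ('p round list \<Rightarrow> 'p set) \<Rightarrow> bool" where
  "MP_winning Inp Out \<phi> w \<nu> sO \<longleftrightarrow>
     sO \<in> strategies_O Inp Out \<and>
     (\<forall>sI \<in> strategies_I Inp Out.
        Val Inp Out \<phi> w (outcome sO sI) \<ge> ereal (real_of_rat \<nu>))"

definition MP_realizable_fm ::
  "'p set \<Rightarrow> 'p set \<Rightarrow> 'p ltl \<Rightarrow> ('p lit \<Rightarrow> rat) \<Rightarrow> rat \<Rightarrow> bool" where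
  "MP_realizable_fm Inp Out \<phi> w \<nu> \<longleftrightarrow>
     (\<exists>sO k. MP_winning Inp Out \<phi> w \<nu> sO \<and> memory_size Inp Out sO k)"

definition E_realizable :: "'p set \<Rightarrow> 'p set \<Rightarrow> 'p ltl \<Rightarrow> ('p lit \<Rightarrow> rat) \<Rightarrow> bool" where
  "E_realizable Inp Out \<phi> w \<longleftrightarrow>
     (\<exists>sO \<in> strategies_O Inp Out. \<exists>c\<^sub>0 :: nat. \<forall>sI \<in> strategies_I Inp Out.
        outcome sO sI \<Turnstile> \<phi> \<and>
        (\<forall>n. of_nat c\<^sub>0 + EL Inp Out w (outcome sO sI) n \<ge> 0))"


subsection \<open>Deterministic complete parity automata\<close>

record ('q, 'p) automaton =
  states :: "'q set"
  init :: 'q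
  delta :: "'q \<Rightarrow> 'p set \<Rightarrow> 'q"
  prio :: "'q \<Rightarrow> nat"

definition parity_automaton :: "'p set \<Rightarrow> ('q, 'p) automaton \<Rightarrow> bool" where
  "parity_automaton P A \<longleftrightarrow>
     finite (states A) \<and> init A \<in> states A \<and>
     (\<forall>q \<in> states A. \<forall>\<sigma> \<in> Pow P. delta A q \<sigma> \<in> states A)"

primrec run :: "('q, 'p) automaton \<Rightarrow> (nat \<Rightarrow> 'p set) \<Rightarrow> nat \<Rightarrow> 'q" where
  "run A u 0 = init A"
| "run A u (Suc n) = delta A (run A u n) (u n)"

definition accepts :: "('q, 'p) automaton \<Rightarrow> (nat \<Rightarrow> 'p set) \<Rightarrow> bool" where
  "accepts A u \<longleftrightarrow> even (Min (prio A ` {q. \<exists>\<^sub>\<infinity>n. run A u n = q}))"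

definition automaton_language :: "'p set \<Rightarrow> ('q, 'p) automaton \<Rightarrow> (nat \<Rightarrow> 'p set) set" where
  "automaton_language P A = {u \<in> words P. accepts A u}"


subsection \<open>The game graph\<close>

text \<open>
  The two constructors keep the Player-1 state \<open>(q, {})\<close> with \<open>{} \<in> Pow Inp\<close> apart from the
  Player-2 state \<open>(q, {})\<close> with \<open>{} \<in> Pow Out\<close>.
\<close>

datatype ('q, 'p) vertex = V1 'q "'p set" | V2 'q "'p set"

definition all_edges ::
  "'p set \<Rightarrow> 'p set \<Rightarrow> ('q, 'p) automaton \<Rightarrow> (('q, 'p) vertex \<times> ('q, 'p) vertex) set" where
  "all_edges Inp Out A =
     {(V1 q j, V2 q x) | q j x. q \<in> states A \<and> j \<in> Pow Inp \<and> x \<in> Pow Out} \<union>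
     {(V2 q x, V1 (delta A q (x \<union> i)) i) | q x i. q \<in> states A \<and> x \<in> Pow Out \<and> i \<in> Pow Inp}"

definition game_states ::
  "'p set \<Rightarrow> 'p set \<Rightarrow> ('q, 'p) automaton \<Rightarrow> 'p set \<Rightarrow> ('q, 'p) vertex set" where
  "game_states Inp Out A j\<^sub>0 = {v. (V1 (init A) j\<^sub>0, v) \<in> (all_edges Inp Out A)\<^sup>*}"

definition game_edges ::
  "'p set \<Rightarrow> 'p set \<Rightarrow> ('q, 'p) automaton \<Rightarrow> 'p set \<Rightarrow> (('q, 'p) vertex \<times> ('q, 'p) vertex) set" where
  "game_edges Inp Out A j\<^sub>0 =
     all_edges Inp Out A \<inter> (game_states Inp Out A j\<^sub>0 \<times> game_states Inp Out A j\<^sub>0)"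

fun vertex_prio :: "('q, 'p) automaton \<Rightarrow> ('q, 'p) vertex \<Rightarrow> nat" where
  "vertex_prio A (V1 q x) = prio A q"
| "vertex_prio A (V2 q x) = prio A q"

fun edge_weight ::
  "'p set \<Rightarrow> 'p set \<Rightarrow> ('p lit \<Rightarrow> rat) \<Rightarrow> ('q, 'p) vertex \<times> ('q, 'p) vertex \<Rightarrow> rat" where
  "edge_weight Inp Out w (v, V1 q i) = set_weight w Inp i"
| "edge_weight Inp Out w (v, V2 q x) = set_weight w Out x"

definition num_priorities :: "'p set \<Rightarrow> 'p set \<Rightarrow> ('q, 'p) automaton \<Rightarrow> 'p set \<Rightarrow> nat" where
  "num_priorities Inp Out A j\<^sub>0 = card (vertex_prio A ` game_states Inp Out A j\<^sub>0)"

text \<open>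
  Memory bounds that are linear in the maximal weight presuppose integer edge weights. For rational
  weights the maximum below has to be multiplied by a common denominator of the edge weights.
\<close>

definition max_abs_weight ::
  "'p set \<Rightarrow> 'p set \<Rightarrow> ('q, 'p) automaton \<Rightarrow> 'p set \<Rightarrow> ('p lit \<Rightarrow> rat) \<Rightarrow> rat" where
  "max_abs_weight Inp Out A j\<^sub>0 w =
     Max ((\<lambda>e. \<bar>edge_weight Inp Out w e\<bar>) ` game_edges Inp Out A j\<^sub>0)"

end

theory Submission
  imports Defs
begin

text \<open>
  Both notions of realizability are compared with one condition on the game graph: against every
  positional strategy of Player I there is a play with bounded-below energy and even parity.

  Interleaving two such plays gives another one, so an induction on the edges yields positional
  determinacy whenever the objectives of both players are closed under interleaving. Applied to
  the weights perturbed lexicographically by the priorities, it gives Player O a positional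
  strategy all of whose cycles have positive weight, or weight zero and even minimal priority.

  An induction in the style of Zielonka, which combines this strategy with attractors, shows that
  Player O still wins if the recorded energy is capped at \<open>3 \<cdot> d \<cdot> |S| \<cdot> W\<close>: at full energy one can afford
  to force the minimal even priority, and then recover the energy. The capped game is a finite
  parity game, so Player O has a positional winning strategy there, which is a strategy of the
  original game whose memory is a state together with a capped energy level.
\<close>


section \<open>Half-positional determinacy\<close>

text \<open>Against a positional opponent a strategy of Player O yields a single path of the game
  graph. Under finite memory this path is ultimately periodic, and then a mean payoff reaching the
  threshold forces the shifted energy to be bounded below; for an energy strategy this is immediate.
  So either kind of realizability gives the common condition, and the converse concerns the finite
  game alone.

  The obstacle to determinacy by interleaving is that unboundedness from below is not closed under
  it: two such plays may compensate each other. Linear decrease takes its place. It is closed under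
  interleaving, excludes bounded energy, and on ultimately periodic plays it is the exact
  complement.

  The induction on subarenas has to pay, out of one energy cap, for a subgame, an attractor and the
  recovery of the energy; the factor 3 in the cap \<open>D\<close> is what these costs add up to.
  Memory consists of a state and one of the \<open>D + 2\<close> levels from -1 to \<open>D\<close>.
  Since there are at least two states, the summand 2 only turns the factor 3 into the 4 of the
  bound.\<close>

definition infpath :: "('v \<times> 'v) set \<Rightarrow> (nat \<Rightarrow> 'v) \<Rightarrow> bool" where
  "infpath E u \<longleftrightarrow> (\<forall>n. (u n, u (Suc n)) \<in> E)"

text \<open>The vertices of an arena are \<open>Domain E\<close>. The inclusion excludes dead ends,
  so every finite path extends to an infinite one.\<close>

definition arena :: "('v \<times> 'v) set \<Rightarrow> bool" where
  "arena E \<longleftrightarrow> finite E \<and> Range E \<subseteq> Domain E"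

definition positional :: "('v \<times> 'v) set \<Rightarrow> 'v set \<Rightarrow> ('v \<Rightarrow> 'v) \<Rightarrow> bool" where
  "positional E P s \<longleftrightarrow> (\<forall>v \<in> P \<inter> Domain E. (v, s v) \<in> E)"

definition follows :: "'v set \<Rightarrow> ('v \<Rightarrow> 'v) \<Rightarrow> (nat \<Rightarrow> 'v) \<Rightarrow> bool" where
  "follows P s u \<longleftrightarrow> (\<forall>n. u n \<in> P \<longrightarrow> u (Suc n) = s (u n))"

text \<open>Legality is demanded on all non-empty lists, paths or not, so that a strategy may be fed
  a history assembled from pieces of another one.\<close>

definition hist_strategy :: "('v \<times> 'v) set \<Rightarrow> 'v set \<Rightarrow> ('v list \<Rightarrow> 'v) \<Rightarrow> bool" where
  "hist_strategy E P t \<longleftrightarrow> (\<forall>h. h \<noteq> [] \<and> last h \<in> P \<inter> Domain E \<longrightarrow> (last h, t h) \<in> E)"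

definition hist_follows :: "'v set \<Rightarrow> ('v list \<Rightarrow> 'v) \<Rightarrow> (nat \<Rightarrow> 'v) \<Rightarrow> bool" where
  "hist_follows P t u \<longleftrightarrow> (\<forall>n. u n \<in> P \<longrightarrow> u (Suc n) = t (map u [0..<Suc n]))"

definition tail_closed :: "((nat \<Rightarrow> 'v) \<Rightarrow> bool) \<Rightarrow> bool" where
  "tail_closed L \<longleftrightarrow> (\<forall>u k. L (\<lambda>n. u (n + k)) = L u)"

definition shuffle_closed :: "((nat \<Rightarrow> 'v) \<Rightarrow> bool) \<Rightarrow> bool" where
  "shuffle_closed L \<longleftrightarrow>
     (\<forall>u N. infinite N \<and> infinite (- N) \<and> L (u \<circ> enumerate N) \<and> L (u \<circ> enumerate (- N)) \<longrightarrow> L u)"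

lemma infpathD: "infpath E u \<Longrightarrow> (u n, u (Suc n)) \<in> E"
  by (simp add: infpath_def)

lemma infpath_Domain: "infpath E u \<Longrightarrow> u n \<in> Domain E"
  by (auto simp: infpath_def)

lemma infpath_shift: "infpath E u \<Longrightarrow> infpath E (\<lambda>n. u (n + k))"
  by (simp add: infpath_def)

lemma arena_succ: "arena E \<Longrightarrow> (a, b) \<in> E \<Longrightarrow> b \<in> Domain E"
  by (auto simp: arena_def)

lemma tail_closedD: "tail_closed L \<Longrightarrow> L (\<lambda>n. u (n + k)) \<longleftrightarrow> L u"
  by (simp add: tail_closed_def)

text \<open>Course-of-values recursion: the prefixes \<open>pre n\<close> are computed as lists, and
  the play is their diagonal, which exists because \<open>h\<close> is non-empty.\<close>

lemma extend_history:
  fixes f :: "'v list \<Rightarrow> 'v"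
  assumes "h \<noteq> []"
  obtains u where "\<And>i. i < length h \<Longrightarrow> u i = h ! i"
    and "\<And>n. length h \<le> Suc n \<Longrightarrow> u (Suc n) = f (map u [0..<Suc n])"
proof -
  define pre where "pre = rec_nat h (\<lambda>_ l. l @ [f l])"
  have pre_simps [simp]: "pre 0 = h" "pre (Suc n) = pre n @ [f (pre n)]" for n
    by (simp_all add: pre_def)
  have len [simp]: "length (pre n) = length h + n" for n
    by (induction n) auto
  have agree: "pre (n + m) ! i = pre n ! i" if "i < length h + n" for n m i
    using that by (induction m) (auto simp: nth_append)
  define u where "u n = pre n ! n" for n
  have u_eq: "u i = pre n ! i" if "i < length h + n" for i n
  proof (cases "i \<le> n")
    case True
    then have "pre (i + (n - i)) ! i = pre i ! i"
      using assms by (intro agree) auto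
    with True show ?thesis by (simp add: u_def)
  next
    case False
    then have "pre (n + (i - n)) ! i = pre n ! i"
      using that by (intro agree) auto
    with False show ?thesis by (simp add: u_def)
  qed
  show ?thesis
  proof
    show "u i = h ! i" if "i < length h" for i
      using u_eq[of i 0] that by simp
    show "u (Suc n) = f (map u [0..<Suc n])" if n: "length h \<le> Suc n" for n
    proof -
      define m where "m = Suc n - length h"
      have m: "Suc n = length h + m" using n by (simp add: m_def)
      have "map u [0..<Suc n] = pre m"
      proof (rule nth_equalityI)
        show "length (map u [0..<Suc n]) = length (pre m)" using m by simp
        fix i assume "i < length (map u [0..<Suc n])"
        then have i: "i < Suc n" by simp
        then have "map u [0..<Suc n] ! i = u i" by (simp del: upt_Suc)
        also have "\<dots> = pre m ! i" using i m by (intro u_eq) simp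
        finally show "map u [0..<Suc n] ! i = pre m ! i" .
      qed
      moreover have "u (Suc n) = pre (Suc m) ! Suc n"
        using m by (intro u_eq) simp
      moreover have "pre (Suc m) ! Suc n = f (pre m)"
        using m by (simp add: nth_append)
      ultimately show ?thesis by simp
    qed
  qed
qed

section \<open>Splitting a sequence along a set of positions\<close>

lemma enumerate_cofinite:
  fixes N :: "nat set"
  assumes "finite N"
  obtains k m where "\<And>j. enumerate (- N) (j + k) = j + m"
proof -
  have inf: "infinite (- N)" using assms by (simp add: Compl_eq_Diff_UNIV)
  obtain m where m: "\<forall>n\<in>N. n < m" using assms finite_nat_set_iff_bounded by blast
  then have memb: "j + m \<in> - N" for j by auto
  obtain k where k: "enumerate (- N) k = m"
    using enumerate_Ex[OF inf] memb[of 0] by auto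
  have "enumerate (- N) (j + k) = j + m" for j
  proof (induction j)
    case (Suc j)
    have "enumerate (- N) (Suc (j + k)) = (LEAST s. s \<in> - N \<and> enumerate (- N) (j + k) < s)"
      using inf by (rule enumerate_Suc''[rotated])
    also have "\<dots> = Suc j + m"
      using Suc memb[of "Suc j"] by (intro Least_equality) auto
    finally show ?case by simp
  qed (simp add: k)
  then show ?thesis by (rule that)
qed

text \<open>If one of the two position sets is finite, the other part of \<open>u\<close> eventually
  runs through a tail of \<open>u\<close>, so tail closure replaces closure under
  interleaving.\<close>

lemma shuffle_closedD:
  assumes L: "tail_closed L" "shuffle_closed L"
    and 1: "infinite N \<Longrightarrow> L (u \<circ> enumerate N)"
    and 2: "infinite (- N) \<Longrightarrow> L (u \<circ> enumerate (- N))"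
  shows "L u"
proof -
  have *: "L u" if fin: "finite M" and LM: "L (u \<circ> enumerate (- M))" for M
  proof -
    obtain k m where km: "\<And>j. enumerate (- M) (j + k) = j + m"
      using enumerate_cofinite[OF fin] by blast
    have "L (\<lambda>n. (u \<circ> enumerate (- M)) (n + k))"
      using LM by (simp only: tail_closedD[OF L(1)])
    then have "L (\<lambda>n. u (n + m))" by (simp add: km)
    then show ?thesis by (simp only: tail_closedD[OF L(1)])
  qed
  have either: "infinite N \<or> infinite (- N)"
    using finite_UnI[of N "- N"] by auto
  show ?thesis
  proof (cases "finite N \<or> finite (- N)")
    case True
    then show ?thesis using *[of N] *[of "- N"] 1 2 either by auto
  next
    case False
    then show ?thesis using L(2) 1 2 unfolding shuffle_closed_def by blast
  qed
qed

text \<open>Both sides are increasing lists with the same elements. This identifies the part of a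
  history that lies in \<open>N\<close> with a history of the subsequence, which is what a component
  strategy has to see.\<close>

lemma enumerate_prefix_filter:
  assumes "infinite N"
  shows "filter (\<lambda>k. k \<in> N) [0..<Suc (enumerate N j)] = map (enumerate N) [0..<Suc j]"
proof (rule sorted_distinct_set_unique)
  have mono: "strict_mono (enumerate N)" by (rule strict_mono_enumerate[OF assms])
  show "sorted (map (enumerate N) [0..<Suc j])"
    using mono by (auto simp: sorted_iff_nth_mono_less strict_mono_less_eq simp del: upt_Suc)
  show "distinct (map (enumerate N) [0..<Suc j])"
    using strict_mono_imp_inj_on[OF mono] by (simp add: distinct_map inj_on_def del: upt_Suc)
  show "set (filter (\<lambda>k. k \<in> N) [0..<Suc (enumerate N j)]) = set (map (enumerate N) [0..<Suc j])"
  proof -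
    have "k \<in> enumerate N ` {0..<Suc j}" if "k \<in> N" "k \<le> enumerate N j" for k
    proof -
      obtain i where "enumerate N i = k" using enumerate_Ex[OF assms \<open>k \<in> N\<close>] by auto
      with that mono show ?thesis by (auto simp: strict_mono_less_eq less_Suc_eq_le)
    qed
    moreover have "enumerate N i \<in> N" "i \<le> j \<Longrightarrow> enumerate N i \<le> enumerate N j" for i
      using mono assms by (auto simp: enumerate_in_set strict_mono_less_eq)
    ultimately show ?thesis by (auto simp: less_Suc_eq_le simp del: upt_Suc)
  qed
qed (simp_all add: sorted_wrt_filter del: upt_Suc)

text \<open>\<open>exit_mode x y f n\<close> tells whether the last exit from \<open>x\<close> up to position \<open>n\<close> went to \<open>y\<close>;
  it looks ahead to \<open>f (Suc n)\<close> only if \<open>f n = x\<close>.\<close>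

primrec exit_mode :: "'v \<Rightarrow> 'v \<Rightarrow> (nat \<Rightarrow> 'v) \<Rightarrow> nat \<Rightarrow> bool" where
  "exit_mode x y f 0 \<longleftrightarrow> f 1 = y"
| "exit_mode x y f (Suc n) \<longleftrightarrow> (if f (Suc n) = x then f (Suc (Suc n)) = y else exit_mode x y f n)"

lemma exit_mode_cong:
  assumes "\<And>i. i \<le> n \<Longrightarrow> f i = g i" "f n = x \<Longrightarrow> f (Suc n) = g (Suc n)" "f 0 = x"
  shows "exit_mode x y f n = exit_mode x y g n"
  using assms
proof (induction n)
  case (Suc n)
  then have "f (Suc n) = g (Suc n)" by simp
  with Suc show ?case by auto
qed auto

lemma exit_mode_at: "f n = x \<Longrightarrow> exit_mode x y f n \<longleftrightarrow> f (Suc n) = y"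
  by (cases n) auto

text \<open>A play returning to \<open>x\<close> is cut into its loops at \<open>x\<close>, sorted by whether they leave \<open>x\<close>
  through \<open>y\<close>; each class of loops, concatenated, is a play of one of the two smaller arenas.\<close>

lemma interleave_at_vertex:
  fixes x y :: 'v
  defines "sub b E \<equiv> {(c, d). (c, d) \<in> E \<and> (c = x \<longrightarrow> (d = y) = b)}"
  assumes L: "tail_closed L" "shuffle_closed L"
    and x: "x \<in> P"
    and t: "\<And>b. hist_strategy (sub b E) (- P) (t b)"
    and wins: "\<And>b u. infpath (sub b E) u \<Longrightarrow> u 0 = x \<Longrightarrow> hist_follows (- P) (t b) u \<Longrightarrow> L u"
  obtains t' where "hist_strategy E (- P) t'"
    and "\<And>u. infpath E u \<Longrightarrow> u 0 = x \<Longrightarrow> hist_follows (- P) t' u \<Longrightarrow> L u"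
proof
  \<comment> \<open>The last position of \<open>h\<close> decides which class of loops is being
    continued; the strategy of that class is then shown the positions of its own class only.\<close>
  define t' where "t' h = (let n = length h - 1; m = exit_mode x y (nth h); b = m n in
      t b (map (nth h) (filter (\<lambda>k. m k = b) [0..<Suc n])))" for h
  show "hist_strategy E (- P) t'"
    unfolding hist_strategy_def
  proof (intro allI impI)
    fix h assume h: "h \<noteq> [] \<and> last h \<in> - P \<inter> Domain E"
    define n where "n = length h - 1"
    define m where "m = exit_mode x y (nth h)"
    define g where "g = map (nth h) (filter (\<lambda>k. m k = m n) [0..<Suc n])"
    have "g = map (nth h) (filter (\<lambda>k. m k = m n) [0..<n]) @ [h ! n]" by (simp add: g_def)
    then have "g \<noteq> []" "last g = last h" using h by (auto simp: n_def last_conv_nth)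
    moreover have "last h \<in> Domain (sub (m n) E)" using h x by (auto simp: sub_def)
    ultimately have "(last h, t (m n) g) \<in> sub (m n) E"
      using t[of "m n"] h unfolding hist_strategy_def by (metis Int_iff)
    moreover have "t' h = t (m n) g" by (simp add: t'_def g_def m_def n_def Let_def)
    ultimately show "(last h, t' h) \<in> E" by (auto simp: sub_def)
  qed
  fix u assume u: "infpath E u" "u 0 = x" "hist_follows (- P) t' u"
  define m where "m = exit_mode x y u"
  have part: "L (u \<circ> enumerate {n. m n = b})" if inf: "infinite {n. m n = b}" for b
  proof (rule wins)
    define N where "N = {n. m n = b}"
    define e where "e = enumerate N"
    have infN: "infinite N" using inf by (simp add: N_def)
    have eN: "m (e j) = b" for j using enumerate_in_set[OF infN, of j] by (simp add: e_def N_def)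
    have m_Suc: "m (Suc n) = m n \<or> u (Suc n) = x" for n by (simp add: m_def)
    \<comment> \<open>The class changes only at visits of \<open>x\<close>, so a class that does not
      begin at position 0 begins when the play is at \<open>x\<close>.\<close>
    have e0: "u (e 0) = x"
    proof (cases "e 0")
      case (Suc k)
      have "k \<notin> N"
      proof
        assume "k \<in> N"
        then obtain i where "e i = k" using enumerate_Ex[OF infN] e_def by blast
        with Suc show False using enumerate_mono[of 0 i N] infN by (cases i) (auto simp: e_def)
      qed
      then show ?thesis using m_Suc[of k] eN[of 0] Suc by (auto simp: N_def)
    qed (simp add: u)
    \<comment> \<open>If the class is suspended after \<open>e j\<close>, the play is then at
      \<open>x\<close>, and it is at \<open>x\<close> again when the class is resumed; the loops in
      between can be cut out without breaking the path.\<close>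
    have next_eq: "u (e (Suc j)) = u (Suc (e j))" for j
    proof (cases "Suc (e j) \<in> N")
      case True
      have "e (Suc j) = (LEAST s. s \<in> N \<and> e j < s)"
        using infN by (simp add: e_def enumerate_Suc'')
      also have "\<dots> = Suc (e j)" using True by (intro Least_equality) auto
      finally show ?thesis by simp
    next
      case False
      then have 1: "u (Suc (e j)) = x" using m_Suc[of "e j"] eN[of j] by (auto simp: N_def)
      have less: "e j < e (Suc j)" using infN by (simp add: e_def enumerate_step)
      then obtain k where k: "e (Suc j) = Suc k" "e j \<le> k" by (cases "e (Suc j)") auto
      have "k \<notin> N"
      proof
        assume kN: "k \<in> N"
        then obtain i where i: "e i = k" using enumerate_Ex[OF infN] e_def by blast
        have sm: "strict_mono e" unfolding e_def by (rule strict_mono_enumerate[OF infN])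
        have "j \<le> i" "i < Suc j"
          using k i sm by (metis strict_mono_less_eq, metis lessI strict_mono_less)
        then have "i = j" by simp
        with i k eN[of "Suc j"] False show False by (auto simp: N_def)
      qed
      then have "u (e (Suc j)) = x" using m_Suc[of k] eN[of "Suc j"] k by (auto simp: N_def)
      with 1 show ?thesis by simp
    qed
    have ue: "u \<circ> enumerate {n. m n = b} = (\<lambda>j. u (e j))"
      by (auto simp: e_def N_def)
    show "infpath (sub b E) (u \<circ> enumerate {n. m n = b})"
      unfolding ue infpath_def
    proof
      fix j
      have "(u (e j), u (Suc (e j))) \<in> E" using u(1) by (rule infpathD)
      moreover have "(u (Suc (e j)) = y) = b" if "u (e j) = x"
        using exit_mode_at[of u "e j" x y] that eN[of j] by (simp add: m_def)
      ultimately show "(u (e j), u (e (Suc j))) \<in> sub b E"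
        by (simp add: next_eq sub_def)
    qed
    show "(u \<circ> enumerate {n. m n = b}) 0 = x" unfolding ue by (rule e0)
    show "hist_follows (- P) (t b) (u \<circ> enumerate {n. m n = b})"
      unfolding ue hist_follows_def
    proof (intro allI impI)
      fix j assume j: "u (e j) \<in> - P"
      define h where "h = map u [0..<Suc (e j)]"
      have hn: "h ! i = u i" if "i \<le> e j" for i using that by (simp add: h_def nth_append)
      \<comment> \<open>The history \<open>h\<close> ends at \<open>e j\<close>, so a look-ahead of
        \<open>exit_mode\<close> at that position would be undefined. It does not occur there,
        because this vertex belongs to the opponent and thus differs from \<open>x\<close>.\<close>
      have mh: "exit_mode x y (nth h) k = m k" if "k \<le> e j" for k
      proof -
        have "m k = exit_mode x y (nth h) k"
          unfolding m_def
        proof (rule exit_mode_cong)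
          show "u k = x \<Longrightarrow> u (Suc k) = h ! Suc k"
            using that j x by (cases "k = e j") (auto simp: hn)
        qed (use that u hn in auto)
        then show ?thesis by simp
      qed
      have len: "length h = Suc (e j)" by (simp add: h_def)
      have "u (Suc (e j)) = t' h"
        using u(3) j unfolding hist_follows_def h_def by blast
      also have "\<dots> = t b (map (nth h) (filter (\<lambda>k. exit_mode x y (nth h) k = b) [0..<Suc (e j)]))"
        using eN[of j] mh by (simp add: t'_def len Let_def del: upt_Suc)
      also have "filter (\<lambda>k. exit_mode x y (nth h) k = b) [0..<Suc (e j)]
          = filter (\<lambda>k. k \<in> N) [0..<Suc (e j)]"
        by (rule filter_cong) (auto simp: mh N_def)
      also have "\<dots> = map e [0..<Suc j]"
        unfolding e_def by (rule enumerate_prefix_filter[OF infN])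
      also have "map (nth h) (map e [0..<Suc j]) = map (\<lambda>j. u (e j)) [0..<Suc j]"
      proof -
        have "e i \<le> e j" if "i \<le> j" for i
          using strict_mono_enumerate[OF infN] that by (simp add: e_def strict_mono_less_eq)
        then show ?thesis by (simp add: hn)
      qed
      finally show "u (e (Suc j)) = t b (map (\<lambda>j. u (e j)) [0..<Suc j])"
        by (simp add: next_eq)
    qed
  qed
  have "- {n. m n = True} = {n. m n = False}" by auto
  then show "L u"
    using shuffle_closedD[OF L, of "{n. m n = True}" u] part[of True] part[of False] by metis
qed

text \<open>From the first visit of \<open>x\<close> on, \<open>t2\<close> is played as if the play
  had started there; tail closure makes the forgotten prefix harmless.\<close>

lemma switch_at_vertex:
  assumes L: "tail_closed L"
    and t1: "hist_strategy E (- P) t1" and t2: "hist_strategy E (- P) t2"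
    and wins1: "\<And>u. infpath E u \<Longrightarrow> u 0 = v \<Longrightarrow> hist_follows (- P) t1 u \<Longrightarrow> x \<notin> range u \<Longrightarrow> L u"
    and wins2: "\<And>u. infpath E u \<Longrightarrow> u 0 = x \<Longrightarrow> hist_follows (- P) t2 u \<Longrightarrow> L u"
  obtains t where "hist_strategy E (- P) t"
    and "\<And>u. infpath E u \<Longrightarrow> u 0 = v \<Longrightarrow> hist_follows (- P) t u \<Longrightarrow> L u"
proof
  define t where "t h = (if x \<in> set h then t2 (dropWhile (\<lambda>a. a \<noteq> x) h) else t1 h)" for h
  have drop: "dropWhile (\<lambda>a. a \<noteq> x) h \<noteq> [] \<and> last (dropWhile (\<lambda>a. a \<noteq> x) h) = last h"
    if "x \<in> set h" for h
  proof -
    have "dropWhile (\<lambda>a. a \<noteq> x) h \<noteq> []" using that by (auto simp: dropWhile_eq_Nil_conv)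
    then show ?thesis by (metis last_appendR takeWhile_dropWhile_id)
  qed
  show "hist_strategy E (- P) t"
    unfolding hist_strategy_def
  proof (intro allI impI)
    fix h assume h: "h \<noteq> [] \<and> last h \<in> - P \<inter> Domain E"
    show "(last h, t h) \<in> E"
    proof (cases "x \<in> set h")
      case True
      define g where "g = dropWhile (\<lambda>a. a \<noteq> x) h"
      have "g \<noteq> []" "last g = last h" using drop[OF True] by (auto simp: g_def)
      then have "(last g, t2 g) \<in> E" using t2 h unfolding hist_strategy_def by metis
      then show ?thesis using True \<open>last g = last h\<close> by (simp add: t_def g_def)
    next
      case False
      then show ?thesis using t1 h by (auto simp: hist_strategy_def t_def)
    qed
  qed
  fix u assume u: "infpath E u" "u 0 = v" "hist_follows (- P) t u"
  show "L u"
  proof (cases "x \<in> range u")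
    case False
    then have "t (map u [0..<Suc n]) = t1 (map u [0..<Suc n])" for n
      by (auto simp: t_def simp del: upt_Suc)
    then have "hist_follows (- P) t1 u" using u(3) by (simp add: hist_follows_def del: upt_Suc)
    with u False show ?thesis by (intro wins1)
  next
    case True
    then obtain k0 where "u k0 = x" by auto
    define k where "k = (LEAST k. u k = x)"
    have k: "u k = x" unfolding k_def using \<open>u k0 = x\<close> by (rule LeastI)
    have before: "u i \<noteq> x" if "i < k" for i using that not_less_Least unfolding k_def by blast
    have split: "map u [0..<Suc (n + k)] = map u [0..<k] @ map (\<lambda>i. u (i + k)) [0..<Suc n]" for n
    proof -
      have "[0..<Suc (n + k)] = [0..<k] @ map (\<lambda>i. i + k) [0..<Suc n]"
        using upt_add_eq_append[of 0 k "Suc n"] map_add_upt[of k "Suc n"]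
        by (simp add: add.commute del: upt_Suc)
      then show ?thesis by (simp add: o_def del: upt_Suc)
    qed
    have dw: "dropWhile (\<lambda>a. a \<noteq> x) (map u [0..<Suc (n + k)]) = map (\<lambda>i. u (i + k)) [0..<Suc n]" for n
    proof -
      have "a \<noteq> x" if "a \<in> set (map u [0..<k])" for a
        using that before by (metis atLeastLessThan_iff image_iff set_map set_upt)
      then have "dropWhile (\<lambda>a. a \<noteq> x) (map u [0..<k] @ ys) = dropWhile (\<lambda>a. a \<noteq> x) ys" for ys
        by (rule dropWhile_append2)
      then show ?thesis unfolding split by (simp add: upt_conv_Cons k del: upt_Suc)
    qed
    have xin: "x \<in> set (map u [0..<Suc (n + k)])" for n
      using k by (auto simp: image_iff simp del: upt_Suc intro!: bexI[of _ k])
    have "hist_follows (- P) t2 (\<lambda>n. u (n + k))"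
      unfolding hist_follows_def
    proof (intro allI impI)
      fix n assume "u (n + k) \<in> - P"
      then have "u (Suc (n + k)) = t (map u [0..<Suc (n + k)])"
        using u(3) unfolding hist_follows_def by blast
      also have "\<dots> = t2 (map (\<lambda>i. u (i + k)) [0..<Suc n])"
        using xin[of n] dw[of n] by (simp only: t_def if_True)
      finally show "u (Suc n + k) = t2 (map (\<lambda>i. u (i + k)) [0..<Suc n])" by simp
    qed
    then have "L (\<lambda>n. u (n + k))"
      using infpath_shift[OF u(1)] k by (intro wins2) auto
    then show ?thesis by (simp only: tail_closedD[OF L] simp_thms)
  qed
qed

section \<open>Objectives avoided by a positional strategy\<close>

definition avoids :: "('v \<times> 'v) set \<Rightarrow> 'v set \<Rightarrow> ((nat \<Rightarrow> 'v) \<Rightarrow> bool) \<Rightarrow> ('v \<Rightarrow> 'v) \<Rightarrow> 'v \<Rightarrow> bool" where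
  "avoids E P L s v \<longleftrightarrow> (\<forall>u. infpath E u \<and> u 0 = v \<and> follows P s u \<longrightarrow> \<not> L u)"

lemma avoidsD:
  "avoids E P L s v \<Longrightarrow> infpath E u \<Longrightarrow> u 0 = v \<Longrightarrow> follows P s u \<Longrightarrow> \<not> L u"
  by (simp add: avoids_def)

lemma avoids_step:
  assumes L: "tail_closed L" and v: "avoids E P L s v" and e: "(v, y) \<in> E" "v \<in> P \<Longrightarrow> y = s v"
  shows "avoids E P L s y"
  unfolding avoids_def
proof (intro allI impI notI)
  fix u assume u: "infpath E u \<and> u 0 = y \<and> follows P s u" "L u"
  define u' where "u' = case_nat v u"
  have "infpath E u'" using u e by (auto simp: infpath_def u'_def split: nat.split)
  moreover have "follows P s u'" using u e by (auto simp: follows_def u'_def split: nat.split)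
  moreover have "L (\<lambda>n. u' (n + 1))" using u by (simp add: u'_def)
  then have "L u'" by (simp only: tail_closedD[OF L] simp_thms)
  ultimately show False using v by (auto simp: avoids_def u'_def)
qed

text \<open>Where the first strategy is winning it stays winning, so it may be given priority.\<close>

lemma avoids_combine:
  assumes L: "tail_closed L"
    and s: "\<And>v. avoids E1 P L s1 v \<Longrightarrow> s v = s1 v" "\<And>v. \<not> avoids E1 P L s1 v \<Longrightarrow> s v = s2 v"
    and E1: "\<And>a b. (a, b) \<in> E \<Longrightarrow> (a \<in> P \<Longrightarrow> b = s1 a) \<Longrightarrow> (a, b) \<in> E1"
    and E2: "\<And>a b. (a, b) \<in> E \<Longrightarrow> (a \<in> P \<Longrightarrow> b = s2 a) \<Longrightarrow> (a, b) \<in> E2"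
    and v: "avoids E1 P L s1 v \<or> avoids E2 P L s2 v"
  shows "avoids E P L s v"
  unfolding avoids_def
proof (intro allI impI)
  fix u assume u: "infpath E u \<and> u 0 = v \<and> follows P s u"
  have step: "(u n, u (Suc n)) \<in> E" "u n \<in> P \<Longrightarrow> u (Suc n) = s (u n)" for n
    using u by (auto simp: infpath_def follows_def)
  have in1: "\<not> L u" if "avoids E1 P L s1 (u k)" for k
  proof -
    have all: "avoids E1 P L s1 (u (n + k))" for n
    proof (induction n)
      case (Suc n)
      have next_eq: "u (Suc (n + k)) = s1 (u (n + k))" if "u (n + k) \<in> P"
        using step(2)[OF that] s(1)[OF Suc] by simp
      have "(u (n + k), u (Suc (n + k))) \<in> E1" by (rule E1[OF step(1)]) (rule next_eq)
      then have "avoids E1 P L s1 (u (Suc (n + k)))" by (rule avoids_step[OF L Suc]) (rule next_eq)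
      then show ?case by simp
    qed (simp add: that)
    have f1: "u (Suc (n + k)) = s1 (u (n + k))" if "u (n + k) \<in> P" for n
      using step(2)[OF that] s(1)[OF all] by simp
    have "infpath E1 (\<lambda>n. u (n + k))"
      unfolding infpath_def
    proof
      fix n
      have "(u (n + k), u (Suc (n + k))) \<in> E1" by (rule E1[OF step(1)]) (rule f1)
      then show "(u (n + k), u (Suc n + k)) \<in> E1" by simp
    qed
    moreover have "follows P s1 (\<lambda>n. u (n + k))"
      unfolding follows_def using f1 by simp
    ultimately
    have "\<not> L (\<lambda>n. u (n + k))" using avoidsD[OF that, of "\<lambda>n. u (n + k)"] by simp
    then show ?thesis by (simp only: tail_closedD[OF L] simp_thms)
  qed
  show "\<not> L u"
  proof (cases "\<exists>k. avoids E1 P L s1 (u k)")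
    case True
    then show ?thesis using in1 by blast
  next
    case False
    then have f2: "u (Suc n) = s2 (u n)" if "u n \<in> P" for n
      using step(2)[OF that] s(2)[of "u n"] by simp
    have "(u n, u (Suc n)) \<in> E2" for n by (rule E2[OF step(1)]) (rule f2)
    then have "infpath E2 u" by (simp add: infpath_def)
    moreover have "follows P s2 u" unfolding follows_def using f2 by simp
    moreover have "avoids E2 P L s2 (u 0)" using v u False by auto
    ultimately show ?thesis using avoidsD[of E2 P L s2 "u 0" u] by simp
  qed
qed

definition hist_wins :: "('v \<times> 'v) set \<Rightarrow> 'v set \<Rightarrow> ((nat \<Rightarrow> 'v) \<Rightarrow> bool) \<Rightarrow> ('v list \<Rightarrow> 'v) \<Rightarrow> 'v \<Rightarrow> bool" where
  "hist_wins E P L t v \<longleftrightarrow> hist_strategy E P t \<and>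
     (\<forall>u. infpath E u \<and> u 0 = v \<and> hist_follows P t u \<longrightarrow> L u)"

text \<open>If \<open>x\<close> were reached, the play could be continued with \<open>t\<close>
  against \<open>s\<close>. It would satisfy \<open>L\<close> because it follows \<open>t\<close>
  from \<open>v\<close>, while its tail from \<open>x\<close> would violate \<open>L\<close> because
  it follows \<open>s\<close>.\<close>

lemma hist_wins_not_reach:
  assumes E: "arena E" and L: "tail_closed L"
    and s: "positional E P s" "avoids E P L s x"
    and t: "hist_wins E (- P) L t v"
    and u: "\<And>n. n < k \<Longrightarrow> (u n, u (Suc n)) \<in> E" "u 0 = v" "u k \<in> Domain E"
      "\<And>n. n < k \<Longrightarrow> u n \<in> - P \<Longrightarrow> u (Suc n) = t (map u [0..<Suc n])"
  shows "u k \<noteq> x"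
proof
  assume x: "u k = x"
  define f where "f h = (if last h \<in> P then s (last h) else t h)" for h
  define h where "h = map u [0..<Suc k]"
  obtain z where z: "\<And>i. i < length h \<Longrightarrow> z i = h ! i"
      "\<And>n. length h \<le> Suc n \<Longrightarrow> z (Suc n) = f (map z [0..<Suc n])"
    by (rule extend_history[of h f]) (auto simp: h_def)
  have zu: "z i = u i" if "i \<le> k" for i using that z(1)[of i] by (simp add: h_def nth_append)
  have zf: "z (Suc n) = f (map z [0..<Suc n])" if "k \<le> n" for n using that z(2)[of n] by (simp add: h_def)
  have ft: "f (map z [0..<Suc n]) = (if z n \<in> P then s (z n) else t (map z [0..<Suc n]))" for n
    by (simp add: f_def)
  have dom_step: "(z n, z (Suc n)) \<in> E" if "k \<le> n" "z n \<in> Domain E" for n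
  proof (cases "z n \<in> P")
    case True
    then show ?thesis using that s(1) zf[of n] ft[of n] by (auto simp: positional_def)
  next
    case False
    have last: "last (map z [0..<Suc n]) = z n" by simp
    have "(last (map z [0..<Suc n]), t (map z [0..<Suc n])) \<in> E"
      using t that False unfolding hist_wins_def hist_strategy_def
      by (metis ComplI IntI Nil_is_append_conv last list.distinct(1) map_append map_is_Nil_conv upt_Suc_append zero_le)
    then show ?thesis using False that zf[of n] ft[of n] by simp
  qed
  have dom: "z n \<in> Domain E" if "k \<le> n" for n
    using that
  proof (induction n rule: dec_induct)
    case base
    then show ?case using zu[of k] u(3) by simp
  next
    case (step n)
    then show ?case using dom_step[of n] arena_succ[OF E] by blast
  qed
  have path: "infpath E z"
    unfolding infpath_def
  proof
    fix n show "(z n, z (Suc n)) \<in> E"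
      using dom_step[of n] dom[of n] u(1)[of n] zu[of n] zu[of "Suc n"] by (cases "k \<le> n") auto
  qed
  have "hist_follows (- P) t z"
    unfolding hist_follows_def
  proof (intro allI impI)
    fix n assume n: "z n \<in> - P"
    show "z (Suc n) = t (map z [0..<Suc n])"
    proof (cases "k \<le> n")
      case True
      then show ?thesis using zf[of n] ft[of n] n by simp
    next
      case False
      then have "map z [0..<Suc n] = map u [0..<Suc n]" by (simp add: zu)
      moreover have "u (Suc n) = t (map u [0..<Suc n])" using u(4)[of n] False n zu[of n] by simp
      moreover have "z (Suc n) = u (Suc n)" using False zu[of "Suc n"] by simp
      ultimately show ?thesis by metis
    qed
  qed
  then have "L z" using t path u(2) zu[of 0] by (auto simp: hist_wins_def)
  moreover have "follows P s (\<lambda>n. z (n + k))"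
    unfolding follows_def
  proof (intro allI impI)
    fix n assume "z (n + k) \<in> P"
    then show "z (Suc n + k) = s (z (n + k))" using zf[of "n + k"] ft[of "n + k"] by simp
  qed
  then have "\<not> L (\<lambda>n. z (n + k))"
    using avoidsD[OF s(2) infpath_shift[OF path, of k]] x zu[of k] by simp
  ultimately show False by (simp add: tail_closedD[OF L])
qed

text \<open>A vertex \<open>x\<close> of \<open>P\<close> with two successors yields two smaller
  arenas: one keeps only the edge to \<open>y\<close> at \<open>x\<close>, the other all the
  remaining edges at \<open>x\<close>. If the opponent enforces \<open>L\<close> from
  \<open>x\<close> in both, the interleaved strategy does so in \<open>E\<close>. Otherwise
  \<open>P\<close> avoids \<open>L\<close> from \<open>x\<close> in one of them, and there the
  opponent's winning plays never meet \<open>x\<close>, so they are not affected by the missing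
  edges.\<close>

theorem half_positional:
  assumes "arena E" and L: "tail_closed L" "shuffle_closed L"
  shows "\<exists>s. positional E P s \<and> (\<forall>v \<in> Domain E. avoids E P L s v \<or> (\<exists>t. hist_wins E (- P) L t v))"
  using assms(1)
proof (induction "card E" arbitrary: E rule: less_induct)
  case less
  note E = \<open>arena E\<close>
  have fin: "finite E" using E by (simp add: arena_def)
  show ?case
  proof (cases "\<exists>x y z. x \<in> P \<and> (x, y) \<in> E \<and> (x, z) \<in> E \<and> y \<noteq> z")
    case False
    define s where "s v = (SOME y. (v, y) \<in> E)" for v
    have s: "(v, s v) \<in> E" if "v \<in> Domain E" for v
      using that unfolding s_def by (auto intro: someI)
    have "\<exists>t. hist_wins E (- P) L t v" if v: "v \<in> Domain E" and na: "\<not> avoids E P L s v" for v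
    proof -
      obtain u where u: "infpath E u" "u 0 = v" "L u" using na by (auto simp: avoids_def)
      \<comment> \<open>Here the owner of \<open>P\<close> has no choice anywhere, so the opponent
        can replay a fixed play satisfying \<open>L\<close>; off this play any successor will
        do.\<close>
      define t where "t h = (if h = map u [0..<length h] then u (length h) else s (last h))" for h
      have "hist_strategy E (- P) t"
        unfolding hist_strategy_def
      proof (intro allI impI)
        fix h assume h: "h \<noteq> [] \<and> last h \<in> - P \<inter> Domain E"
        show "(last h, t h) \<in> E"
        proof (cases "h = map u [0..<length h]")
          case True
          obtain n where n: "length h = Suc n" using h by (cases h) auto
          then have "h = map u [0..<n] @ [u n]" using True by simp
          then have "last h = u n" by simp
          then show ?thesis using True n u(1) by (simp add: t_def infpath_def)
        qed (use h s in \<open>auto simp: t_def\<close>)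
      qed
      moreover have "z = u" if z: "infpath E z" "z 0 = v" "hist_follows (- P) t z" for z
      proof
        have eq: "z n = u n \<and> map z [0..<n] = map u [0..<n]" for n
        proof (induction n)
          case (Suc n)
          then have m: "map z [0..<Suc n] = map u [0..<Suc n]" by simp
          have "z (Suc n) = u (Suc n)"
          proof (cases "z n \<in> P")
            case True
            then show ?thesis using False infpathD[OF z(1), of n] infpathD[OF u(1), of n] Suc by metis
          next
            case False
            then have "z (Suc n) = t (map z [0..<Suc n])" using z(3) unfolding hist_follows_def by blast
            then show ?thesis unfolding m by (simp add: t_def del: upt_Suc)
          qed
          with m show ?case by blast
        qed (simp add: z u)
        show "z n = u n" for n using eq by blast
      qed
      ultimately have "hist_wins E (- P) L t v" using u unfolding hist_wins_def by blast
      then show ?thesis by blast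
    qed
    then have "positional E P s \<and>
        (\<forall>v \<in> Domain E. avoids E P L s v \<or> (\<exists>t. hist_wins E (- P) L t v))"
      using s unfolding positional_def by blast
    then show ?thesis by blast
  next
    case True
    then obtain x y z where xyz: "x \<in> P" "(x, y) \<in> E" "(x, z) \<in> E" "y \<noteq> z" by blast
    define sub where "sub b = {(c, d). (c, d) \<in> E \<and> (c = x \<longrightarrow> (d = y) = b)}" for b
    have subE: "sub b \<subseteq> E" for b by (auto simp: sub_def)
    have dom: "Domain (sub b) = Domain E" for b
    proof
      show "Domain (sub b) \<subseteq> Domain E" using subE by auto
      show "Domain E \<subseteq> Domain (sub b)"
      proof
        fix c assume "c \<in> Domain E"
        then obtain d where d: "(c, d) \<in> E" by auto
        have "(c, if c = x then (if b then y else z) else d) \<in> sub b"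
          using d xyz by (auto simp: sub_def)
        then show "c \<in> Domain (sub b)" by blast
      qed
    qed
    have ar: "arena (sub b)" for b
      using E Range_mono[OF subE[of b]] finite_subset[OF subE fin, of b]
      unfolding arena_def dom by blast
    have card: "card (sub b) < card E" for b
    proof (rule psubset_card_mono[OF fin])
      show "sub b \<subset> E" using xyz by (cases b) (auto simp: sub_def)
    qed
    have "\<forall>b. \<exists>s. positional (sub b) P s \<and>
        (\<forall>v \<in> Domain E. avoids (sub b) P L s v \<or> (\<exists>t. hist_wins (sub b) (- P) L t v))"
      using less.hyps[OF card ar] unfolding dom by blast
    then obtain s where s': "\<forall>b. positional (sub b) P (s b) \<and>
        (\<forall>v \<in> Domain E. avoids (sub b) P L (s b) v \<or> (\<exists>t. hist_wins (sub b) (- P) L t v))"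
      by (rule choice[THEN exE])
    have s: "positional (sub b) P (s b)"
        "v \<in> Domain E \<Longrightarrow> avoids (sub b) P L (s b) v \<or> (\<exists>t. hist_wins (sub b) (- P) L t v)" for b v
      using s' by blast+
    define S where "S v = (if avoids (sub True) P L (s True) v then s True v else s False v)" for v
    have "(c, s b c) \<in> E" if "c \<in> P \<inter> Domain E" for b c
      using s(1)[of b] subE[of b] that unfolding positional_def dom by blast
    then have "positional E P S"
      by (simp add: positional_def S_def)
    moreover have "avoids E P L S v" if v: "avoids (sub b) P L (s b) v" "v \<in> Domain E" for b v
    proof (rule avoids_combine[OF L(1), of "sub True" P "s True" S "s False" E "sub False"])
      have sub': "(c, d) \<in> sub b'" if "(c, d) \<in> E" "c \<in> P \<Longrightarrow> d = s b' c" for c d b'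
        using that s(1)[of b'] xyz(1) dom[of b'] by (cases "c \<in> P") (auto simp: positional_def sub_def)
      show "(c, d) \<in> sub True" if "(c, d) \<in> E" "c \<in> P \<Longrightarrow> d = s True c" for c d using sub'[OF that] .
      show "(c, d) \<in> sub False" if "(c, d) \<in> E" "c \<in> P \<Longrightarrow> d = s False c" for c d using sub'[OF that] .
      show "avoids (sub True) P L (s True) v \<or> avoids (sub False) P L (s False) v"
        using v by (cases b) auto
    qed (auto simp: S_def)
    moreover have "\<exists>t. hist_wins E (- P) L t v"
      if v: "v \<in> Domain E" and na: "\<And>b. \<not> avoids (sub b) P L (s b) v" for v
    proof -
      have "\<forall>b. \<exists>t. hist_wins (sub b) (- P) L t v" using s(2)[OF v] na by blast
      then obtain t where t: "\<And>b. hist_wins (sub b) (- P) L (t b) v" by (auto dest!: choice)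
      have lift: "hist_strategy E (- P) t'" if "hist_strategy (sub b) (- P) t'" for t' b
        using that subE[of b] unfolding hist_strategy_def dom by (meson subsetD)
      have sub_path: "(c, d) \<in> sub b" if "(c, d) \<in> E" "c \<noteq> x" for c d b
        using that by (auto simp: sub_def)
      have no_x: "L u" if "infpath E u" "u 0 = v" "hist_follows (- P) (t b) u" "x \<notin> range u" for u b
      proof -
        have "infpath (sub b) u"
          unfolding infpath_def
        proof
          fix n
          have "u n \<noteq> x" using that(4) by auto
          then show "(u n, u (Suc n)) \<in> sub b" by (rule sub_path[OF infpathD[OF that(1)]])
        qed
        then show ?thesis using t[of b] that unfolding hist_wins_def by blast
      qed
      have xD: "x \<in> Domain E" using xyz by auto
      show ?thesis
      proof (cases "\<exists>b. avoids (sub b) P L (s b) x")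
        case True
        then obtain b where b: "avoids (sub b) P L (s b) x" by blast
        have "L u" if u: "infpath E u" "u 0 = v" "hist_follows (- P) (t b) u" for u
        proof -
          have "x \<notin> range u"
          proof
            assume "x \<in> range u"
            then obtain k0 where "u k0 = x" by auto
            define k where "k = (LEAST k. u k = x)"
            have k: "u k = x" unfolding k_def using \<open>u k0 = x\<close> by (rule LeastI)
            have before: "u i \<noteq> x" if "i < k" for i using that not_less_Least unfolding k_def by blast
            have "u k \<noteq> x"
            proof (rule hist_wins_not_reach[where u = u and k = k, OF ar L(1) s(1) b t _ u(2)])
              show "(u n, u (Suc n)) \<in> sub b" if "n < k" for n
                using sub_path before[OF that] infpathD[OF u(1)] by blast
              show "u k \<in> Domain (sub b)" using k xD dom by simp
              show "u (Suc n) = t b (map u [0..<Suc n])" if "n < k" "u n \<in> - P" for n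
                using u(3) that unfolding hist_follows_def by blast
            qed
            with k show False by simp
          qed
          then show ?thesis using no_x u by blast
        qed
        then show ?thesis using lift[of b "t b"] t[of b] unfolding hist_wins_def by blast
      next
        case False
        then have "\<forall>b. \<exists>t. hist_wins (sub b) (- P) L t x" using s(2)[OF xD] by blast
        then obtain tx where tx: "\<And>b. hist_wins (sub b) (- P) L (tx b) x" by (auto dest!: choice)
        obtain t2 where t2: "hist_strategy E (- P) t2"
            "\<And>u. infpath E u \<Longrightarrow> u 0 = x \<Longrightarrow> hist_follows (- P) t2 u \<Longrightarrow> L u"
        proof (rule interleave_at_vertex[where y = y and E = E and t = tx, OF L xyz(1), folded sub_def])
          show "hist_strategy (sub b) (- P) (tx b)" for b using tx[of b] by (simp add: hist_wins_def)
          show "L u" if "infpath (sub b) u" "u 0 = x" "hist_follows (- P) (tx b) u" for b u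
            using tx[of b] that unfolding hist_wins_def by blast
        qed blast
        \<comment> \<open>Before the first visit of \<open>x\<close> both subarenas allow the same
          moves, so the choice of \<open>True\<close> is arbitrary.\<close>
        have st1: "hist_strategy E (- P) (t True)"
          using t[of True] unfolding hist_wins_def by (intro lift) blast
        obtain t3 where "hist_strategy E (- P) t3"
            "\<And>u. infpath E u \<Longrightarrow> u 0 = v \<Longrightarrow> hist_follows (- P) t3 u \<Longrightarrow> L u"
          by (rule switch_at_vertex[OF L(1) st1 t2(1)]) (use no_x t2(2) in \<open>blast+\<close>)
        then show ?thesis unfolding hist_wins_def by blast
      qed
    qed
    ultimately have "positional E P S \<and>
        (\<forall>v \<in> Domain E. avoids E P L S v \<or> (\<exists>t. hist_wins E (- P) L t v))"
      by blast
    then show ?thesis by blast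
  qed
qed

lemma hist_wins_disjoint:
  assumes E: "arena E" and v: "v \<in> Domain E"
    and t: "hist_wins E P L t v" and t': "hist_wins E (- P) L' t' v"
  obtains u where "L u" "L' u"
proof -
  define f where "f h = (if last h \<in> P then t h else t' h)" for h
  obtain u where u: "u 0 = v" "\<And>n. u (Suc n) = f (map u [0..<Suc n])"
    using extend_history[of "[v]" f] by auto
  have f: "f (map u [0..<Suc n]) = (if u n \<in> P then t (map u [0..<Suc n]) else t' (map u [0..<Suc n]))" for n
    by (simp add: f_def)
  have step: "(u n, u (Suc n)) \<in> E" if "u n \<in> Domain E" for n
  proof -
    have l: "map u [0..<Suc n] \<noteq> []" "last (map u [0..<Suc n]) = u n" by auto
    show ?thesis
      using t t' that l u(2)[of n] f[of n] unfolding hist_wins_def hist_strategy_def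
      by (cases "u n \<in> P") (metis IntI, metis IntI ComplI)
  qed
  have "u n \<in> Domain E" for n
    by (induction n) (use u v step arena_succ[OF E] in \<open>blast+\<close>)
  then have "infpath E u" using step by (simp add: infpath_def)
  moreover have "hist_follows P t u" "hist_follows (- P) t' u"
    using u(2) f by (simp_all add: hist_follows_def del: upt_Suc)
  ultimately have "L u" "L' u" using t t' u(1) unfolding hist_wins_def by blast+
  then show ?thesis by (rule that)
qed

text \<open>Each player gets a positional strategy from the half-positional theorem; where both
  fail, the two history strategies played against each other would satisfy \<open>L\<close> and
  \<open>L'\<close> at once. Asking for disjoint rather than complementary objectives makes room for
  pairs in which both are closed under interleaving.\<close>

theorem positional_determinacy:
  assumes E: "arena E"
    and L: "tail_closed L" "shuffle_closed L" and L': "tail_closed L'" "shuffle_closed L'"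
    and disj: "\<And>u. \<not> (L u \<and> L' u)"
  shows "\<exists>s t. positional E P s \<and> positional E (- P) t \<and>
    (\<forall>v \<in> Domain E. avoids E P L s v \<or> avoids E (- P) L' t v)"
proof -
  obtain s where s: "positional E P s" "\<And>v. v \<in> Domain E \<Longrightarrow> avoids E P L s v \<or> (\<exists>t. hist_wins E (- P) L t v)"
    using half_positional[OF E L] by metis
  obtain t where t: "positional E (- P) t"
      "\<And>v. v \<in> Domain E \<Longrightarrow> avoids E (- P) L' t v \<or> (\<exists>t. hist_wins E P L' t v)"
    using half_positional[OF E L', of "- P"] by (metis double_complement)
  have "avoids E P L s v \<or> avoids E (- P) L' t v" if "v \<in> Domain E" for v
    using s(2)[OF that] t(2)[OF that] hist_wins_disjoint[OF E that] disj by metis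
  with s t show ?thesis by blast
qed

section \<open>Energy and parity objectives\<close>

definition esum :: "('v \<Rightarrow> int) \<Rightarrow> (nat \<Rightarrow> 'v) \<Rightarrow> nat \<Rightarrow> int" where
  "esum w u n = (\<Sum>k<n. w (u k))"

definition bounded_below :: "('v \<Rightarrow> int) \<Rightarrow> (nat \<Rightarrow> 'v) \<Rightarrow> bool" where
  "bounded_below w u \<longleftrightarrow> (\<exists>c. \<forall>n. c \<le> esum w u n)"

text \<open>The energy lies below a line of slope \<open>- 1 / K\<close>. Expressed as boundedness
  for modified weights, this inherits the closure properties of
  \<open>bounded_below\<close>.\<close>

definition lin_decreasing :: "('v \<Rightarrow> int) \<Rightarrow> (nat \<Rightarrow> 'v) \<Rightarrow> bool" where
  "lin_decreasing w u \<longleftrightarrow> (\<exists>K > 0. bounded_below (\<lambda>v. - (K * w v) - 1) u)"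

text \<open>The number \<open>p\<close> is the limit inferior of the priorities, and
  \<open>b = True\<close> is the min-even condition. The form also makes sense when infinitely many
  priorities occur, in which case both parities may fail.\<close>

definition parity :: "bool \<Rightarrow> ('v \<Rightarrow> nat) \<Rightarrow> (nat \<Rightarrow> 'v) \<Rightarrow> bool" where
  "parity b pr u \<longleftrightarrow> (\<exists>p. even p = b \<and> (\<exists>\<^sub>\<infinity>n. pr (u n) = p) \<and> (\<forall>\<^sub>\<infinity>n. p \<le> pr (u n)))"

lemma esum_0 [simp]: "esum w u 0 = 0"
  by (simp add: esum_def)

lemma esum_Suc [simp]: "esum w u (Suc n) = esum w u n + w (u n)"
  by (simp add: esum_def)

lemma esum_add: "esum w u (k + n) = esum w u k + esum w (\<lambda>i. u (i + k)) n"
  by (induction n) (auto simp: add.commute)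

lemma tail_closed_bounded_below: "tail_closed (bounded_below w)"
  unfolding tail_closed_def
proof (intro allI iffI)
  fix u k
  assume "bounded_below w (\<lambda>n. u (n + k))"
  then obtain c where c: "\<And>n. c \<le> esum w (\<lambda>n. u (n + k)) n" by (auto simp: bounded_below_def)
  define d where "d = Min (esum w u ` {..k})"
  have "min d (c + esum w u k) \<le> esum w u n" for n
  proof (cases "n \<le> k")
    case True
    then have "d \<le> esum w u n" by (auto simp: d_def)
    then show ?thesis by simp
  next
    case False
    then have "esum w u n = esum w u k + esum w (\<lambda>i. u (i + k)) (n - k)"
      using esum_add[of w u k "n - k"] by simp
    then show ?thesis using c[of "n - k"] by linarith
  qed
  then show "bounded_below w u" by (auto simp: bounded_below_def)
next
  fix u k
  assume "bounded_below w u"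
  then obtain c where c: "\<And>n. c \<le> esum w u n" by (auto simp: bounded_below_def)
  have "c - esum w u k \<le> esum w (\<lambda>n. u (n + k)) n" for n
    using c[of "k + n"] esum_add[of w u k n] by simp
  then show "bounded_below w (\<lambda>n. u (n + k))" by (auto simp: bounded_below_def)
qed

lemma esum_enumerate:
  fixes N :: "nat set"
  assumes "infinite N"
  obtains m where "(\<Sum>k \<in> N \<inter> {..<n}. w (u k)) = esum w (u \<circ> enumerate N) m"
proof -
  \<comment> \<open>\<open>m\<close> is the number of elements of \<open>N\<close> below
    \<open>n\<close>.\<close>
  define m where "m = (LEAST m. n \<le> enumerate N m)"
  have m: "n \<le> enumerate N m"
    unfolding m_def by (rule LeastI[of _ n]) (rule le_enumerate[OF assms])
  have less: "enumerate N i < n" if "i < m" for i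
    using that not_less_Least[of i "\<lambda>m. n \<le> enumerate N m"] by (auto simp: m_def)
  have mono: "strict_mono (enumerate N)" by (rule strict_mono_enumerate[OF assms])
  have "N \<inter> {..<n} = enumerate N ` {..<m}"
  proof
    show "enumerate N ` {..<m} \<subseteq> N \<inter> {..<n}" using less enumerate_in_set[OF assms] by auto
    show "N \<inter> {..<n} \<subseteq> enumerate N ` {..<m}"
    proof
      fix k assume k: "k \<in> N \<inter> {..<n}"
      then obtain i where i: "enumerate N i = k" using enumerate_Ex[OF assms] by auto
      then have "enumerate N i < enumerate N m" using k m by auto
      then have "i < m" using mono by (simp add: strict_mono_less)
      with i show "k \<in> enumerate N ` {..<m}" by auto
    qed
  qed
  moreover have "inj_on (enumerate N) {..<m}"
    using strict_mono_imp_inj_on[OF mono] by (auto simp: inj_on_def)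
  ultimately have "(\<Sum>k \<in> N \<inter> {..<n}. w (u k)) = esum w (u \<circ> enumerate N) m"
    by (simp add: sum.reindex esum_def)
  then show ?thesis by (rule that)
qed

text \<open>The energy of a prefix is the sum of the energies of a prefix of either part, so the two
  lower bounds add up.\<close>

lemma shuffle_closed_bounded_below: "shuffle_closed (bounded_below w)"
  unfolding shuffle_closed_def
proof (intro allI impI)
  fix u :: "nat \<Rightarrow> 'a" and N :: "nat set"
  assume a: "infinite N \<and> infinite (- N) \<and> bounded_below w (u \<circ> enumerate N) \<and>
    bounded_below w (u \<circ> enumerate (- N))"
  then obtain c d where c: "\<And>n. c \<le> esum w (u \<circ> enumerate N) n"
    and d: "\<And>n. d \<le> esum w (u \<circ> enumerate (- N)) n"
    by (auto simp: bounded_below_def)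
  have "c + d \<le> esum w u n" for n
  proof -
    have "esum w u n = (\<Sum>k \<in> N \<inter> {..<n}. w (u k)) + (\<Sum>k \<in> - N \<inter> {..<n}. w (u k))"
      using sum.Int_Diff[of "{..<n}" "\<lambda>k. w (u k)" N]
      by (simp add: esum_def Int_commute Diff_eq)
    moreover obtain m where "(\<Sum>k \<in> N \<inter> {..<n}. w (u k)) = esum w (u \<circ> enumerate N) m"
      using esum_enumerate a by blast
    moreover obtain m' where "(\<Sum>k \<in> - N \<inter> {..<n}. w (u k)) = esum w (u \<circ> enumerate (- N)) m'"
      using esum_enumerate a by blast
    ultimately show ?thesis using c[of m] d[of m'] by linarith
  qed
  then show "bounded_below w u" by (auto simp: bounded_below_def)
qed

lemma tail_closed_lin_decreasing: "tail_closed (lin_decreasing w)"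
  using tail_closed_bounded_below unfolding tail_closed_def lin_decreasing_def by metis

lemma esum_lin: "esum (\<lambda>v. - (K * w v) - 1) u n = - (K * esum w u n) - int n"
  by (induction n) (auto simp: algebra_simps)

text \<open>A rate of decrease \<open>1 / K\<close> may be weakened to \<open>1 / (M * K)\<close>;
  this gives two plays a common rate before they are interleaved.\<close>

lemma lin_decreasing_mult:
  assumes "bounded_below (\<lambda>v. - (K * w v) - 1) u" "M > 0"
  shows "bounded_below (\<lambda>v. - ((M * K) * w v) - 1) u"
proof -
  obtain c where c: "\<And>n. c \<le> - (K * esum w u n) - int n"
    using assms(1) by (auto simp: bounded_below_def esum_lin)
  have "M * c \<le> - ((M * K) * esum w u n) - int n" for n
  proof -
    have "M * c \<le> M * (- (K * esum w u n) - int n)"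
      using c[of n] assms(2) by (intro mult_left_mono) auto
    moreover have "int n \<le> M * int n" using assms(2) by (simp add: mult_le_cancel_right1)
    ultimately show ?thesis by (simp add: algebra_simps)
  qed
  then show ?thesis by (auto simp: bounded_below_def esum_lin)
qed

lemma shuffle_closed_lin_decreasing: "shuffle_closed (lin_decreasing w)"
  unfolding shuffle_closed_def
proof (intro allI impI)
  fix u :: "nat \<Rightarrow> 'a" and N :: "nat set"
  assume a: "infinite N \<and> infinite (- N) \<and> lin_decreasing w (u \<circ> enumerate N) \<and>
    lin_decreasing w (u \<circ> enumerate (- N))"
  then obtain K M where K: "K > 0" "bounded_below (\<lambda>v. - (K * w v) - 1) (u \<circ> enumerate N)"
    and M: "M > 0" "bounded_below (\<lambda>v. - (M * w v) - 1) (u \<circ> enumerate (- N))"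
    unfolding lin_decreasing_def by blast
  have "bounded_below (\<lambda>v. - ((M * K) * w v) - 1) (u \<circ> enumerate N)"
    using lin_decreasing_mult[OF K(2) M(1)] .
  moreover have "bounded_below (\<lambda>v. - ((M * K) * w v) - 1) (u \<circ> enumerate (- N))"
    using lin_decreasing_mult[OF M(2) K(1)] by (simp add: mult.commute)
  ultimately have "bounded_below (\<lambda>v. - ((M * K) * w v) - 1) u"
    using shuffle_closed_bounded_below a unfolding shuffle_closed_def by blast
  moreover have "M * K > 0" using K M by simp
  ultimately show "lin_decreasing w u" unfolding lin_decreasing_def by blast
qed

lemma bounded_below_not_lin_decreasing: "\<not> (lin_decreasing w u \<and> bounded_below w u)"
proof
  assume "lin_decreasing w u \<and> bounded_below w u"
  then obtain K c d where K: "K > 0" and c: "\<And>n. c \<le> - (K * esum w u n) - int n"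
    and d: "\<And>n. d \<le> esum w u n"
    by (auto simp: lin_decreasing_def bounded_below_def esum_lin)
  define n where "n = nat (\<bar>c\<bar> + \<bar>K * d\<bar> + 1)"
  have "K * d \<le> K * esum w u n" using d[of n] K by (intro mult_left_mono) auto
  then show False using c[of n] by (simp add: n_def)
qed

section \<open>Parity conditions under tails and interleavings\<close>

lemma MOST_shift: "(\<forall>\<^sub>\<infinity>n. Q (n + k)) \<longleftrightarrow> (\<forall>\<^sub>\<infinity>n. Q n)" for k :: nat
  unfolding cofinite_eq_sequentially by (rule eventually_sequentially_seg[of Q k])

lemma INFM_shift: "(\<exists>\<^sub>\<infinity>n. Q (n + k)) \<longleftrightarrow> (\<exists>\<^sub>\<infinity>n. Q n)" for k :: nat
  unfolding frequently_def using MOST_shift[of "\<lambda>n. \<not> Q n" k] by (rule arg_cong)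

lemma tail_closed_parity: "tail_closed (parity b pr)"
  unfolding tail_closed_def parity_def
proof (intro allI)
  fix u :: "nat \<Rightarrow> 'a" and k
  have "(\<exists>\<^sub>\<infinity>n. pr (u (n + k)) = p) \<longleftrightarrow> (\<exists>\<^sub>\<infinity>n. pr (u n) = p)"
    "(\<forall>\<^sub>\<infinity>n. p \<le> pr (u (n + k))) \<longleftrightarrow> (\<forall>\<^sub>\<infinity>n. p \<le> pr (u n))" for p
    by (rule INFM_shift[of "\<lambda>n. pr (u n) = p" k], rule MOST_shift[of "\<lambda>n. p \<le> pr (u n)" k])
  then show "(\<exists>p. even p = b \<and> (\<exists>\<^sub>\<infinity>n. pr (u (n + k)) = p) \<and> (\<forall>\<^sub>\<infinity>n. p \<le> pr (u (n + k)))) =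
      (\<exists>p. even p = b \<and> (\<exists>\<^sub>\<infinity>n. pr (u n) = p) \<and> (\<forall>\<^sub>\<infinity>n. p \<le> pr (u n)))"
    by (intro ex_cong1 conj_cong refl)
qed

text \<open>The limit inferior of an interleaving is the smaller of the two limits, hence again a
  number of parity \<open>b\<close>.\<close>

lemma shuffle_closed_parity: "shuffle_closed (parity b pr)"
  unfolding shuffle_closed_def
proof (intro allI impI)
  fix u :: "nat \<Rightarrow> 'a" and N :: "nat set"
  assume a: "infinite N \<and> infinite (- N) \<and> parity b pr (u \<circ> enumerate N) \<and>
    parity b pr (u \<circ> enumerate (- N))"
  then have inf: "infinite N" "infinite (- N)" by auto
  have "parity b pr (u \<circ> enumerate N)" using a by simp
  then obtain p where p: "even p = b" "\<exists>\<^sub>\<infinity>n. pr ((u \<circ> enumerate N) n) = p"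
      "\<forall>\<^sub>\<infinity>n. p \<le> pr ((u \<circ> enumerate N) n)"
    unfolding parity_def by (elim exE conjE)
  have "parity b pr (u \<circ> enumerate (- N))" using a by simp
  then obtain q where q: "even q = b" "\<exists>\<^sub>\<infinity>n. pr ((u \<circ> enumerate (- N)) n) = q"
      "\<forall>\<^sub>\<infinity>n. q \<le> pr ((u \<circ> enumerate (- N)) n)"
    unfolding parity_def by (elim exE conjE)
  have often: "\<exists>\<^sub>\<infinity>n. pr (u n) = r"
    if M: "infinite M" and r: "\<exists>\<^sub>\<infinity>n. pr ((u \<circ> enumerate M) n) = r" for M r
  proof -
    have "infinite (enumerate M ` {n. pr ((u \<circ> enumerate M) n) = r})"
    proof
      assume "finite (enumerate M ` {n. pr ((u \<circ> enumerate M) n) = r})"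
      moreover have "inj_on (enumerate M) {n. pr ((u \<circ> enumerate M) n) = r}"
        by (rule strict_mono_imp_inj_on[OF strict_mono_enumerate[OF M]])
      ultimately have "finite {n. pr ((u \<circ> enumerate M) n) = r}" by (rule finite_imageD)
      then show False using r by (simp add: INFM_iff_infinite)
    qed
    moreover have "enumerate M ` {n. pr ((u \<circ> enumerate M) n) = r} \<subseteq> {n. pr (u n) = r}" by auto
    ultimately show ?thesis unfolding INFM_iff_infinite using finite_subset by blast
  qed
  have "{n. \<not> min p q \<le> pr (u n)} \<subseteq> enumerate N ` {n. \<not> p \<le> pr ((u \<circ> enumerate N) n)} \<union>
      enumerate (- N) ` {n. \<not> q \<le> pr ((u \<circ> enumerate (- N)) n)}"
  proof
    fix n assume n: "n \<in> {n. \<not> min p q \<le> pr (u n)}"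
    show "n \<in> enumerate N ` {n. \<not> p \<le> pr ((u \<circ> enumerate N) n)} \<union>
      enumerate (- N) ` {n. \<not> q \<le> pr ((u \<circ> enumerate (- N)) n)}"
    proof (cases "n \<in> N")
      case True
      then obtain i where i: "enumerate N i = n" using enumerate_Ex[OF inf(1)] by blast
      have "n \<in> enumerate N ` {n. \<not> p \<le> pr ((u \<circ> enumerate N) n)}"
        by (rule image_eqI[of _ _ i]) (use n i in auto)
      then show ?thesis by (rule UnI1)
    next
      case False
      then obtain i where i: "enumerate (- N) i = n" using enumerate_Ex[OF inf(2)] by blast
      have "n \<in> enumerate (- N) ` {n. \<not> q \<le> pr ((u \<circ> enumerate (- N)) n)}"
        by (rule image_eqI[of _ _ i]) (use n i in auto)
      then show ?thesis by (rule UnI2)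
    qed
  qed
  then have "finite {n. \<not> min p q \<le> pr (u n)}"
    by (rule finite_subset) (use p(3) q(3) in \<open>simp add: MOST_iff_cofinite\<close>)
  then have "\<forall>\<^sub>\<infinity>n. min p q \<le> pr (u n)" by (simp add: MOST_iff_cofinite)
  moreover have "\<exists>\<^sub>\<infinity>n. pr (u n) = min p q"
    using often[OF inf(1) p(2)] often[OF inf(2) q(2)] by (simp add: min_def)
  moreover have "even (min p q) = b" using p(1) q(1) by (simp add: min_def)
  ultimately show "parity b pr u" unfolding parity_def by (intro exI[of _ "min p q"] conjI)
qed

lemma parity_disjoint: "\<not> (parity True pr u \<and> parity False pr u)"
proof
  assume "parity True pr u \<and> parity False pr u"
  then obtain p q where p: "even p" "\<exists>\<^sub>\<infinity>n. pr (u n) = p" "\<forall>\<^sub>\<infinity>n. p \<le> pr (u n)"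
    and q: "odd q" "\<exists>\<^sub>\<infinity>n. pr (u n) = q" "\<forall>\<^sub>\<infinity>n. q \<le> pr (u n)"
    unfolding parity_def by auto
  have "p \<le> q" using INFM_EX[OF INFM_conjI[OF q(2) p(3)]] by auto
  moreover have "q \<le> p" using INFM_EX[OF INFM_conjI[OF p(2) q(3)]] by auto
  ultimately show False using p q by auto
qed

lemma finite_range_often:
  assumes "finite V" "\<And>n. u n \<in> V" "\<exists>\<^sub>\<infinity>n. Q (u n)"
  obtains q where "q \<in> V" "Q q" "\<exists>\<^sub>\<infinity>n. u n = q"
proof -
  define A where "A = {n. Q (u n)}"
  have "infinite A" using assms(3) by (simp add: A_def INFM_iff_infinite)
  moreover have "finite (u ` A)" using assms(1,2) by (meson finite_subset image_subsetI)
  ultimately obtain a where a: "a \<in> A" "infinite {n \<in> A. u n = u a}"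
    using pigeonhole_infinite by blast
  then have "infinite {n. u n = u a}" by (rule_tac infinite_super[of "{n \<in> A. u n = u a}"]) auto
  with a show ?thesis using that[of "u a"] assms(2) by (auto simp: A_def INFM_iff_infinite)
qed

lemma parity_total:
  assumes "finite V" "\<And>n. u n \<in> V"
  shows "parity True pr u \<or> parity False pr u"
proof -
  obtain v where "\<exists>\<^sub>\<infinity>n. u n = v" using finite_range_often[of V u "\<lambda>_. True"] assms by auto
  then have ex: "\<exists>\<^sub>\<infinity>n. pr (u n) = pr v" by (rule INFM_mono) simp
  define p where "p = (LEAST p. \<exists>\<^sub>\<infinity>n. pr (u n) = p)"
  have p: "\<exists>\<^sub>\<infinity>n. pr (u n) = p" unfolding p_def using ex by (rule LeastI)
  have less: "finite {n. pr (u n) = q}" if "q < p" for q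
    using not_less_Least[of q "\<lambda>p. \<exists>\<^sub>\<infinity>n. pr (u n) = p"] that by (auto simp: p_def INFM_iff_infinite)
  have "{n. \<not> p \<le> pr (u n)} = (\<Union>q<p. {n. pr (u n) = q})" by auto
  then have "finite {n. \<not> p \<le> pr (u n)}" using less by auto
  then have "\<forall>\<^sub>\<infinity>n. p \<le> pr (u n)" by (simp add: MOST_iff_cofinite)
  with p show ?thesis unfolding parity_def by (cases "even p") auto
qed

section \<open>Good-for-energy strategies\<close>

definition conform :: "('v \<times> 'v) set \<Rightarrow> 'v set \<Rightarrow> ('v \<Rightarrow> 'v) \<Rightarrow> ('v \<times> 'v) set" where
  "conform E P s = {(a, b) \<in> E. a \<in> P \<longrightarrow> b = s a}"

lemma infpath_conform: "infpath (conform E P s) u \<longleftrightarrow> infpath E u \<and> follows P s u"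
  by (auto simp: infpath_def follows_def conform_def)

lemma avoids_conform: "avoids E P L s v \<longleftrightarrow> (\<forall>u. infpath (conform E P s) u \<and> u 0 = v \<longrightarrow> \<not> L u)"
  unfolding avoids_def infpath_conform by blast

lemma avoids_reachable:
  assumes "tail_closed L" "avoids E P L s v" "(v, y) \<in> (conform E P s)\<^sup>*"
  shows "avoids E P L s y"
  using assms(3,2)
proof (induction rule: rtrancl_induct)
  case (step y z)
  then show ?case using avoids_step[OF assms(1), of E P s y z] by (auto simp: conform_def)
qed simp

section \<open>Closed walks and their repetitions\<close>

definition closed_walk :: "('v \<times> 'v) set \<Rightarrow> 'v list \<Rightarrow> bool" where
  "closed_walk F xs \<longleftrightarrow> xs \<noteq> [] \<and> successively (\<lambda>a b. (a, b) \<in> F) (xs @ [hd xs])"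

text \<open>The cycle condition of good-for-energy strategies. A positive cycle is accepted whatever
  its priorities, since the energy it gains can pay for a detour to an even priority; a cycle of
  weight zero has to be even itself.\<close>

definition good_walk :: "('v \<Rightarrow> int) \<Rightarrow> ('v \<Rightarrow> nat) \<Rightarrow> 'v list \<Rightarrow> bool" where
  "good_walk w pr xs \<longleftrightarrow>
     (let t = sum_list (map w xs) in t > 0 \<or> t = 0 \<and> even (Min (pr ` set xs)))"

lemma closed_walk_split:
  assumes "closed_walk F (a @ [y] @ b @ [y] @ c)"
  shows "closed_walk F (y # b)" "closed_walk F (a @ y # c)"
proof -
  let ?R = "\<lambda>a b. (a, b) \<in> F"
  define h where "h = hd (a @ [y])"
  have hd: "hd (a @ y # z) = h" for z by (cases a) (auto simp: h_def)
  have S: "successively ?R (a @ (y # b @ [y]) @ (c @ [h]))"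
    using assms by (simp add: closed_walk_def hd)
  then have yby: "successively ?R (y # b @ [y])"
    unfolding successively_append_iff by blast
  have a: "successively ?R a" "a = [] \<or> ?R (last a) y"
    using S successively_append_iff[of ?R a "(y # b @ [y]) @ (c @ [h])"] by auto
  have c: "successively ?R (c @ [h])" "?R y (hd (c @ [h]))"
    using S successively_append_iff[of ?R "a @ (y # b @ [y])" "c @ [h]"] by auto
  show "closed_walk F (y # b)" using yby by (simp add: closed_walk_def)
  have "successively ?R (y # (c @ [h]))" using c by (cases "c @ [h]") auto
  then have "successively ?R (a @ (y # (c @ [h])))"
    using a by (subst successively_append_iff) auto
  then show "closed_walk F (a @ y # c)" by (simp add: closed_walk_def hd)
qed

text \<open>The truth value \<open>g\<close> is a parameter because arenas with only good cycles and arenas with only bad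
  cycles are both needed.\<close>

lemma good_walk_merge:
  assumes "good_walk w pr (y # b) = g" "good_walk w pr (a @ y # c) = g"
  shows "good_walk w pr (a @ [y] @ b @ [y] @ c) = g"
proof -
  define t1 t2 where "t1 = sum_list (map w (y # b))" and "t2 = sum_list (map w (a @ y # c))"
  define m1 m2 where "m1 = Min (pr ` set (y # b))" and "m2 = Min (pr ` set (a @ y # c))"
  have "set (a @ [y] @ b @ [y] @ c) = set (y # b) \<union> set (a @ y # c)" by auto
  then have "Min (pr ` set (a @ [y] @ b @ [y] @ c)) = min m1 m2"
    unfolding m1_def m2_def by (simp only: image_Un) (rule Min_Un, auto)
  moreover have "sum_list (map w (a @ [y] @ b @ [y] @ c)) = t1 + t2"
    by (simp add: t1_def t2_def)
  ultimately show ?thesis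
    using assms unfolding good_walk_def Let_def t1_def[symmetric] t2_def[symmetric] m1_def[symmetric] m2_def[symmetric]
    by (cases g) (auto simp: min_def)
qed

text \<open>A repeated vertex cuts a closed walk into two shorter closed walks, and merging them
  preserves a common verdict.\<close>

lemma closed_walk_good_iff:
  assumes "\<And>xs. closed_walk F xs \<Longrightarrow> distinct xs \<Longrightarrow> good_walk w pr xs = g"
  shows "closed_walk F xs \<Longrightarrow> good_walk w pr xs = g"
proof (induction "length xs" arbitrary: xs rule: less_induct)
  case less
  show ?case
  proof (cases "distinct xs")
    case False
    then obtain a b c y where xs: "xs = a @ [y] @ b @ [y] @ c" using not_distinct_decomp by blast
    show ?thesis
      unfolding xs using closed_walk_split less.prems less.hyps xs
      by (intro good_walk_merge) force+
  qed (use assms less.prems in auto)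
qed

definition cycle_path :: "'v list \<Rightarrow> nat \<Rightarrow> 'v" where
  "cycle_path xs n = xs ! (n mod length xs)"

lemma infpath_cycle_path:
  assumes "closed_walk F xs"
  shows "infpath F (cycle_path xs)" "cycle_path xs 0 = hd xs"
proof -
  have ne: "xs \<noteq> []" using assms by (simp add: closed_walk_def)
  show "cycle_path xs 0 = hd xs" using ne by (simp add: cycle_path_def hd_conv_nth)
  have step: "((xs @ [hd xs]) ! i, (xs @ [hd xs]) ! Suc i) \<in> F" if "i < length xs" for i
    using assms that by (auto simp: closed_walk_def successively_conv_nth)
  show "infpath F (cycle_path xs)"
    unfolding infpath_def
  proof
    fix n
    define i where "i = n mod length xs"
    have i: "i < length xs" using ne by (simp add: i_def)
    show "(cycle_path xs n, cycle_path xs (Suc n)) \<in> F"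
      using step[OF i] i ne unfolding cycle_path_def i_def[symmetric]
      by (cases "Suc i = length xs") (auto simp: nth_append mod_Suc i_def[symmetric] hd_conv_nth)
  qed
qed

lemma esum_cycle_path:
  assumes "xs \<noteq> []"
  shows "esum w (cycle_path xs) (k * length xs + r) =
    int k * sum_list (map w xs) + esum w (cycle_path xs) r"
proof (induction k)
  case (Suc k)
  have shift: "(\<lambda>i. cycle_path xs (i + length xs)) = cycle_path xs"
    by (simp add: cycle_path_def fun_eq_iff)
  have "esum w (cycle_path xs) (length xs) = sum_list (map w xs)"
    by (simp add: esum_def cycle_path_def sum_list_sum_nth atLeast0LessThan)
  then have "esum w (cycle_path xs) (length xs + (k * length xs + r)) =
      sum_list (map w xs) + esum w (cycle_path xs) (k * length xs + r)"
    by (simp add: esum_add shift)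
  then show ?case using Suc by (simp add: algebra_simps)
qed simp

lemma bounded_below_cycle_path:
  assumes "xs \<noteq> []" "sum_list (map w xs) \<ge> 0"
  shows "bounded_below w (cycle_path xs)"
proof -
  define d where "d = Min (esum w (cycle_path xs) ` {..<length xs})"
  have "d \<le> esum w (cycle_path xs) n" for n
  proof -
    have "d \<le> esum w (cycle_path xs) (n mod length xs)"
      using assms(1) by (auto simp: d_def)
    moreover have "0 \<le> int (n div length xs) * sum_list (map w xs)" using assms(2) by simp
    ultimately show ?thesis
      using esum_cycle_path[OF assms(1), of w "n div length xs" "n mod length xs"] by simp
  qed
  then show ?thesis by (auto simp: bounded_below_def)
qed

lemma lin_decreasing_cycle_path:
  assumes "xs \<noteq> []" "sum_list (map w xs) < 0"
  shows "lin_decreasing w (cycle_path xs)"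
proof -
  \<comment> \<open>One pass takes \<open>length xs\<close> steps and lowers the energy by at least
    1.\<close>
  define K where "K = int (length xs)"
  have K: "K > 0" using assms(1) by (simp add: K_def)
  have "sum_list (map (\<lambda>v. - (K * w v) - 1) ys) = - (K * sum_list (map w ys)) - int (length ys)" for ys
    by (induction ys) (auto simp: algebra_simps)
  then have "sum_list (map (\<lambda>v. - (K * w v) - 1) xs) = - (K * sum_list (map w xs)) - K"
    by (simp add: K_def)
  moreover have "K * sum_list (map w xs) \<le> K * (- 1)" using assms(2) K by (intro mult_left_mono) auto
  ultimately have "sum_list (map (\<lambda>v. - (K * w v) - 1) xs) \<ge> 0" by simp
  then have "bounded_below (\<lambda>v. - (K * w v) - 1) (cycle_path xs)"
    by (rule bounded_below_cycle_path[OF assms(1)])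
  with K show ?thesis unfolding lin_decreasing_def by blast
qed

section \<open>Segments between visits of a recurring vertex\<close>

lemma closed_walk_segment:
  assumes "infpath F u" "i < j" "u i = u j"
  shows "closed_walk F (map u [i..<j])"
    and "sum_list (map w (map u [i..<j])) = esum w u j - esum w u i"
proof -
  have "map u [i..<j] @ [hd (map u [i..<j])] = map u [i..<Suc j]"
    using assms(2,3) by (simp add: hd_map)
  moreover have "successively (\<lambda>a b. (a, b) \<in> F) (map u [i..<Suc j])"
    using assms(1) by (auto simp: successively_conv_nth infpath_def simp del: upt_Suc)
  ultimately show "closed_walk F (map u [i..<j])"
    using assms(2) by (simp add: closed_walk_def)
  have "sum_list (map w (map u [i..<j])) = (\<Sum>k = i..<j. w (u k))"
    by (simp add: interv_sum_list_conv_sum_set_nat o_def)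
  also have "\<dots> = esum w u j - esum w u i"
    unfolding esum_def atLeast0LessThan[symmetric]
    using assms(2) sum.atLeastLessThan_concat[of 0 i j "\<lambda>k. w (u k)"] by simp
  finally show "sum_list (map w (map u [i..<j])) = esum w u j - esum w u i" .
qed

text \<open>As there are finitely many vertices, some \<open>q\<close> carrying the limit priority
  recurs. Dropping from \<open>N\<close> the positions at which smaller priorities may still lie
  ahead makes \<open>pr q\<close> the minimum of every segment that starts in
  \<open>N\<close>.\<close>

lemma parity_often:
  assumes "finite V" "\<And>n. u n \<in> V" "parity b pr u"
  obtains q N where "even (pr q) = b" "infinite N" "\<And>n. n \<in> N \<Longrightarrow> u n = q"
    "\<And>i j. i \<in> N \<Longrightarrow> i < j \<Longrightarrow> Min (pr ` set (map u [i..<j])) = pr q"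
proof -
  obtain p where p: "even p = b" "\<exists>\<^sub>\<infinity>n. pr (u n) = p" "\<forall>\<^sub>\<infinity>n. p \<le> pr (u n)"
    using assms(3) unfolding parity_def by (elim exE conjE)
  obtain q where "q \<in> V" and q: "pr q = p" "\<exists>\<^sub>\<infinity>n. u n = q"
    by (rule finite_range_often[of V u "\<lambda>v. pr v = p", OF assms(1,2) p(2)])
  obtain m where m: "\<And>n. m \<le> n \<Longrightarrow> p \<le> pr (u n)"
    using p(3) by (auto simp: cofinite_eq_sequentially eventually_sequentially)
  define N where "N = {n. u n = q} - {..<m}"
  have "infinite N" using q(2) by (simp add: N_def INFM_iff_infinite)
  moreover have "Min (pr ` set (map u [i..<j])) = pr q" if "i \<in> N" "i < j" for i j
  proof (rule Min_eqI)
    have "u i \<in> set (map u [i..<j])" using that(2) by simp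
    then show "pr q \<in> pr ` set (map u [i..<j])" using that(1) by (simp add: N_def)
    show "pr q \<le> y" if "y \<in> pr ` set (map u [i..<j])" for y
      using that \<open>i \<in> N\<close> m q(1) by (auto simp: N_def)
  qed simp
  moreover have "even (pr q) = b" "\<And>n. n \<in> N \<Longrightarrow> u n = q"
    using q(1) p(1) by (simp_all add: N_def)
  ultimately show ?thesis by (intro that[of q N])
qed

text \<open>Among the late visits of a recurring vertex of least, hence even, priority, choose one
  with least energy: the walk from there to any later visit has non-negative weight and an even
  minimum.\<close>

lemma good_walk_on_winning_path:
  assumes "infpath F u" "finite (Domain F)" "bounded_below w u" "parity True pr u"
  obtains xs where "closed_walk F xs" "good_walk w pr xs"
proof -
  obtain q N where q: "even (pr q)" "infinite N" "\<And>n. n \<in> N \<Longrightarrow> u n = q"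
    and m: "\<And>i j. i \<in> N \<Longrightarrow> i < j \<Longrightarrow> Min (pr ` set (map u [i..<j])) = pr q"
    using parity_often[OF assms(2) infpath_Domain[OF assms(1)] assms(4)] by metis
  obtain c where c: "\<And>n. c \<le> esum w u n" using assms(3) by (auto simp: bounded_below_def)
  obtain n0 where "n0 \<in> N" using q(2) by (meson finite.emptyI subsetI finite_subset empty_iff)
  then obtain i where i: "i \<in> N" "\<And>n. n \<in> N \<Longrightarrow> nat (esum w u i - c) \<le> nat (esum w u n - c)"
    using ex_has_least_nat[of "\<lambda>n. n \<in> N" n0 "\<lambda>n. nat (esum w u n - c)"] by blast
  obtain j where j: "j \<in> N" "i < j" using q(2) by (meson infinite_nat_iff_unbounded)
  have "esum w u i \<le> esum w u j" using i(2)[OF j(1)] c[of i] c[of j] by linarith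
  then have "good_walk w pr (map u [i..<j])"
    using closed_walk_segment(2)[OF assms(1) j(2), of w] q i j m[OF i(1) j(2)]
    by (auto simp: good_walk_def)
  moreover have "closed_walk F (map u [i..<j])"
    using closed_walk_segment(1)[OF assms(1) j(2)] q(3) i j by simp
  ultimately show ?thesis by (rule that[rotated])
qed

text \<open>If the parity is odd, the walk between two late visits of a recurring vertex of least
  priority has an odd minimum. Being good, it has positive weight, so the energy grows from visit to
  visit.\<close>

lemma good_walk_even_or_unbounded:
  assumes "infpath F u" "finite (Domain F)"
    and good: "\<And>xs. closed_walk F xs \<Longrightarrow> good_walk w pr xs"
    and odd: "\<not> parity True pr u"
  shows "\<exists>n. B < esum w u n"
proof -
  note V = infpath_Domain[OF assms(1)]
  have "parity False pr u" using parity_total[where u = u and pr = pr, OF assms(2) V] odd by blast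
  then obtain q N where q: "odd (pr q)" "infinite N" "\<And>n. n \<in> N \<Longrightarrow> u n = q"
    and m: "\<And>i j. i \<in> N \<Longrightarrow> i < j \<Longrightarrow> Min (pr ` set (map u [i..<j])) = pr q"
    using parity_often[where u = u, OF assms(2) V] by (metis (full_types))
  have step: "esum w u i < esum w u j" if "i \<in> N" "j \<in> N" "i < j" for i j
    using good[OF closed_walk_segment(1)[OF assms(1) that(3)]] q that m[OF that(1,3)]
      closed_walk_segment(2)[OF assms(1) that(3), of w]
    by (auto simp: good_walk_def)
  have "esum w u (enumerate N 0) + int k \<le> esum w u (enumerate N k)" for k
  proof (induction k)
    case (Suc k)
    have "esum w u (enumerate N k) < esum w u (enumerate N (Suc k))"
      using q(2) by (intro step enumerate_in_set enumerate_step)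
    with Suc show ?case by simp
  qed simp
  moreover obtain k :: nat where "B - esum w u (enumerate N 0) < int k"
    using that[of "Suc (nat (B - esum w u (enumerate N 0)))"] by linarith
  ultimately have "B < esum w u (enumerate N k)" by (smt (verit))
  then show ?thesis ..
qed

text \<open>Cutting out closed walks removes only non-negative weight. What is left is a simple path
  of at most \<open>card V\<close> vertices, each losing at most \<open>W\<close>.\<close>

lemma good_walk_drop:
  assumes good: "\<And>xs. closed_walk F xs \<Longrightarrow> good_walk w pr xs"
    and V: "finite V" "\<And>v. v \<in> V \<Longrightarrow> \<bar>w v\<bar> \<le> W" and W: "W \<ge> 0"
  shows "successively (\<lambda>a b. (a, b) \<in> F) xs \<Longrightarrow> set xs \<subseteq> V \<Longrightarrow>
    sum_list (map w xs) \<ge> - (int (card V) * W)"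
proof (induction "length xs" arbitrary: xs rule: less_induct)
  case less
  show ?case
  proof (cases "distinct xs")
    case True
    have "length xs \<le> card V"
      using card_mono[OF V(1) less.prems(2)] distinct_card[OF True] by simp
    then have "int (length xs) * W \<le> int (card V) * W" using W by (intro mult_right_mono) auto
    moreover have "sum_list (map w ys) \<ge> - (int (length ys) * W)" if "set ys \<subseteq> V" for ys
      using that
    proof (induction ys)
      case (Cons y ys)
      then have "\<bar>w y\<bar> \<le> W" using V(2) by auto
      with Cons show ?case by (auto simp: algebra_simps)
    qed simp
    ultimately show ?thesis using less.prems(2) by fastforce
  next
    case False
    then obtain a b c y where xs: "xs = a @ [y] @ b @ [y] @ c" using not_distinct_decomp by blast
    let ?R = "\<lambda>a b. (a, b) \<in> F"
    have S: "successively ?R (a @ (y # b @ [y]) @ c)" using less.prems(1) by (simp add: xs)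
    then have "successively ?R (y # b @ [y])"
      unfolding successively_append_iff by blast
    then have "closed_walk F (y # b)" by (simp add: closed_walk_def)
    then have "sum_list (map w (y # b)) \<ge> 0" using good[of "y # b"] by (auto simp: good_walk_def Let_def)
    moreover have "sum_list (map w (a @ y # c)) \<ge> - (int (card V) * W)"
    proof (rule less.hyps)
      have a: "successively ?R a" "a = [] \<or> ?R (last a) y"
        using S successively_append_iff[of ?R a "(y # b @ [y]) @ c"] by auto
      have c: "successively ?R c" "c = [] \<or> ?R y (hd c)"
        using S successively_append_iff[of ?R "a @ (y # b @ [y])" c] by auto
      have "successively ?R (y # c)" using c by (cases c) auto
      then show "successively ?R (a @ y # c)" using a by (subst successively_append_iff) auto
    qed (use less.prems in \<open>auto simp: xs\<close>)
    ultimately show ?thesis by (simp add: xs)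
  qed
qed

text \<open>On simple cycles the sign of the perturbed weight is decided by the weight and, if that is zero,
  by the parity of the minimal priority.\<close>

definition pert_weight :: "int \<Rightarrow> int \<Rightarrow> nat \<Rightarrow> ('v \<Rightarrow> int) \<Rightarrow> ('v \<Rightarrow> nat) \<Rightarrow> 'v \<Rightarrow> int" where
  "pert_weight M B K w pr v = M * w v + (- 1) ^ pr v * B ^ (K - pr v)"

text \<open>The perturbation is a number in base \<open>B = n + 1\<close>: the vertices of least
  priority all have the same sign and outweigh the others in a list of length at most
  \<open>n\<close>. The factor \<open>M\<close> exceeds the absolute value of the whole
  perturbation, which therefore counts only if the weights sum to zero.\<close>

lemma pert_weight_sum:
  assumes xs: "xs \<noteq> []" "length xs \<le> n" "\<And>v. v \<in> set xs \<Longrightarrow> pr v \<le> K"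
    and B: "B = int n + 1" and M: "M = int n * B ^ K + 1"
  shows "if good_walk w pr xs then sum_list (map (pert_weight M B K w pr) xs) > 0
    else sum_list (map (pert_weight M B K w pr) xs) < 0"
proof -
  define f where "f v = (- 1) ^ pr v * B ^ (K - pr v)" for v
  define S where "S = sum_list (map w xs)"
  define D where "D = sum_list (map f xs)"
  define m where "m = Min (pr ` set xs)"
  have B1: "B \<ge> 1" using B by simp
  have total: "sum_list (map (pert_weight M B K w pr) xs) = M * S + D"
    unfolding S_def D_def by (induction xs) (auto simp: pert_weight_def f_def algebra_simps)
  have lb: "sum_list (map g ys) \<ge> - (int (length ys) * c)"
    if "\<And>v. v \<in> set ys \<Longrightarrow> g v \<ge> - c" for g :: "'a \<Rightarrow> int" and ys c
    using that by (induction ys) (auto simp: algebra_simps, smt (verit))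
  have fK: "\<bar>f v\<bar> \<le> B ^ K" for v
    using B1 by (simp add: f_def abs_mult power_abs power_increasing)
  have "int (length xs) * B ^ K \<le> int n * B ^ K" using xs(2) B1 by (intro mult_right_mono) auto
  moreover have "D \<ge> - (int (length xs) * B ^ K)"
    unfolding D_def by (rule lb) (use fK in \<open>smt (verit)\<close>)
  moreover have "- D \<ge> - (int (length xs) * B ^ K)"
  proof -
    have "sum_list (map (\<lambda>v. - f v) xs) \<ge> - (int (length xs) * B ^ K)"
      by (rule lb) (use fK in \<open>smt (verit)\<close>)
    then show ?thesis by (simp add: D_def uminus_sum_list_map o_def)
  qed
  ultimately have DM: "\<bar>D\<bar> < M" using M by linarith
  have mem: "m \<in> pr ` set xs" unfolding m_def using xs(1) by (intro Min_in) auto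
  then obtain v where v: "v \<in> set xs" "pr v = m" by auto
  then have mK: "m \<le> K" using xs(3) by auto
  have m_le: "m \<le> pr x" if "x \<in> set xs" for x using that by (auto simp: m_def)
  define c where "c = B ^ (K - m)"
  have c: "c > 0" using B1 by (simp add: c_def)
  \<comment> \<open>The factor \<open>(- 1) ^ m\<close> makes the least priority count positively. A
    larger priority lacks at least one factor \<open>B\<close>, so after multiplication by
    \<open>B\<close> it costs at most \<open>c\<close>; the distinguished entry \<open>v\<close>
    contributes \<open>B * c\<close>, and fewer than \<open>B\<close> entries remain.\<close>
  have summand: "B * ((- 1) ^ m * f x) \<ge> - c" if x: "x \<in> set xs" for x
  proof (cases "pr x = m")
    case True
    then have "(- 1) ^ m * f x = c" by (simp add: f_def c_def flip: mult.assoc power_mult_distrib)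
    then show ?thesis using c B1 by (smt (verit) mult_nonneg_nonneg)
  next
    case False
    then have "Suc (K - pr x) \<le> K - m" using m_le[OF x] xs(3)[OF x] by simp
    then have "B * B ^ (K - pr x) \<le> c"
      using power_increasing[of "Suc (K - pr x)" "K - m" B] B1 by (simp add: c_def)
    moreover have "\<bar>B * ((- 1) ^ m * f x)\<bar> = B * B ^ (K - pr x)"
      using B1 by (simp add: f_def abs_mult power_abs)
    ultimately show ?thesis by linarith
  qed
  obtain ys zs where split: "xs = ys @ v # zs" using split_list[OF v(1)] by blast
  have "(- 1) ^ m * f v = c" using v(2) by (simp add: f_def c_def flip: mult.assoc power_mult_distrib)
  moreover have "sum_list (map (\<lambda>x. B * ((- 1) ^ m * f x)) l) = B * ((- 1) ^ m * sum_list (map f l))" for l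
    by (induction l) (auto simp: algebra_simps)
  ultimately have "B * ((- 1) ^ m * D) = B * c + sum_list (map (\<lambda>x. B * ((- 1) ^ m * f x)) (ys @ zs))"
    by (simp add: D_def split distrib_left)
  moreover have "sum_list (map (\<lambda>x. B * ((- 1) ^ m * f x)) (ys @ zs)) \<ge> - (int (length (ys @ zs)) * c)"
    by (rule lb) (use summand in \<open>auto simp: split\<close>)
  moreover have "int (length (ys @ zs)) * c < B * c"
    using c xs(2) B by (intro mult_strict_right_mono) (auto simp: split)
  ultimately have "B * ((- 1) ^ m * D) > 0" by linarith
  then have sign: "(- 1) ^ m * D > 0" using B1 by (simp add: zero_less_mult_iff)
  have pos: "M * S + D > 0" if "S > 0"
  proof -
    have "M * 1 \<le> M * S" using that DM by (intro mult_left_mono) auto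
    then show ?thesis using DM by linarith
  qed
  have neg: "M * S + D < 0" if "S < 0"
  proof -
    have "M * S \<le> M * (- 1)" using that DM by (intro mult_left_mono) auto
    then show ?thesis using DM by linarith
  qed
  show ?thesis
    using pos neg sign unfolding good_walk_def total Let_def S_def[symmetric] m_def[symmetric]
    by (cases "S = 0"; cases "even m") auto
qed

text \<open>Quantifying over positional strategies of the opponent only makes the condition easy to
  restrict to subarenas: no strategy of the player owning \<open>P\<close> has to be transported.\<close>

definition unbeaten :: "('v \<times> 'v) set \<Rightarrow> 'v set \<Rightarrow> ('v \<Rightarrow> int) \<Rightarrow> ('v \<Rightarrow> nat) \<Rightarrow> bool" where
  "unbeaten E P w pr \<longleftrightarrow> (\<forall>t v. positional E (- P) t \<and> v \<in> Domain E \<longrightarrow>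
     \<not> avoids E (- P) (\<lambda>u. bounded_below w u \<and> parity True pr u) t v)"

text \<open>On simple cycles the perturbed weight is positive if and only if the cycle is good, so
  determinacy for the perturbed energy decides the matter. If the opponent's \<open>t\<close> kept
  the perturbed energy from being bounded below, all cycles reachable under \<open>t\<close> would
  be bad, yet the winning play that exists against \<open>t\<close> contains a good one.\<close>

theorem good_for_energy:
  assumes E: "arena E" and win: "unbeaten E P w pr"
  obtains s where "positional E P s"
    and "\<And>xs. closed_walk (conform E P s) xs \<Longrightarrow> good_walk w pr xs"
proof -
  define n where "n = card (Domain E)"
  define K where "K = Max (insert 0 (pr ` Domain E))"
  define B where "B = int n + 1"
  define M where "M = int n * B ^ K + 1"
  define w' where "w' = pert_weight M B K w pr"
  have fin: "finite (Domain E)" using E by (simp add: arena_def finite_Domain)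
  have sub: "set xs \<subseteq> Domain F" if "closed_walk F xs" for xs and F :: "('a \<times> 'a) set"
  proof
    fix x assume "x \<in> set xs"
    then obtain i where i: "i < length xs" "x = xs ! i" by (auto simp: in_set_conv_nth)
    then show "x \<in> Domain F"
      using infpath_Domain[OF infpath_cycle_path(1)[OF that], of i] by (simp add: cycle_path_def)
  qed
  have sign: "if good_walk w pr xs then sum_list (map w' xs) > 0 else sum_list (map w' xs) < 0"
    if "closed_walk F xs" "distinct xs" "F \<subseteq> E" for xs F
    unfolding w'_def
  proof (rule pert_weight_sum[OF _ _ _ B_def M_def])
    have sE: "set xs \<subseteq> Domain E" using sub[OF that(1)] that(3) by blast
    show "xs \<noteq> []" using that(1) by (simp add: closed_walk_def)
    show "length xs \<le> n" using card_mono[OF fin sE] distinct_card[OF that(2)] by (simp add: n_def)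
    show "pr v \<le> K" if "v \<in> set xs" for v
      unfolding K_def using fin sE that by (intro Max_ge) auto
  qed
  obtain s t where s: "positional E P s" and t: "positional E (- P) t"
    and st: "\<And>v. v \<in> Domain E \<Longrightarrow> avoids E P (lin_decreasing w') s v \<or> avoids E (- P) (bounded_below w') t v"
    using positional_determinacy[OF E tail_closed_lin_decreasing shuffle_closed_lin_decreasing
        tail_closed_bounded_below shuffle_closed_bounded_below bounded_below_not_lin_decreasing, of P w'] by blast
  have "\<not> avoids E (- P) (bounded_below w') t v" if v: "v \<in> Domain E" for v
  proof
    assume av: "avoids E (- P) (bounded_below w') t v"
    obtain u where u: "infpath (conform E (- P) t) u" "u 0 = v" "bounded_below w u" "parity True pr u"
      using win t v unfolding unbeaten_def avoids_conform by blast
    \<comment> \<open>Only edges reachable from \<open>v\<close> are kept, because the guarantee of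
      \<open>t\<close> from \<open>v\<close> extends to them alone.\<close>
    define F where "F = {(a, b) \<in> conform E (- P) t. (v, a) \<in> (conform E (- P) t)\<^sup>*}"
    have FE: "F \<subseteq> E" by (auto simp: F_def conform_def)
    have reach: "(v, u k) \<in> (conform E (- P) t)\<^sup>*" for k
    proof (induction k)
      case (Suc k)
      then show ?case using infpathD[OF u(1), of k] by (rule rtrancl_into_rtrancl)
    qed (simp add: u)
    have "infpath F u" using u(1) reach by (simp add: infpath_def F_def)
    moreover have "finite (Domain F)" using fin FE by (meson Domain_mono finite_subset)
    ultimately obtain xs where xs: "closed_walk F xs" "good_walk w pr xs"
      using good_walk_on_winning_path u(3,4) by blast
    have "good_walk w pr ys = False" if ys: "closed_walk F ys" "distinct ys" for ys
    proof (rule ccontr)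
      assume "good_walk w pr ys \<noteq> False"
      then have pos: "sum_list (map w' ys) \<ge> 0" using sign[OF ys FE] by simp
      have ne: "ys \<noteq> []" using ys by (simp add: closed_walk_def)
      have "hd ys \<in> Domain F" using sub[OF ys(1)] ne by auto
      then have "(v, hd ys) \<in> (conform E (- P) t)\<^sup>*" by (auto simp: F_def)
      then have "avoids E (- P) (bounded_below w') t (hd ys)"
        by (rule avoids_reachable[OF tail_closed_bounded_below av])
      moreover have "infpath (conform E (- P) t) (cycle_path ys)"
        using infpath_cycle_path(1)[OF ys(1)] by (auto simp: infpath_def F_def)
      ultimately show False
        using bounded_below_cycle_path[OF ne pos] infpath_cycle_path(2)[OF ys(1)]
        unfolding avoids_conform by blast
    qed
    then have "good_walk w pr xs = False" using closed_walk_good_iff xs(1) by blast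
    with xs(2) show False by simp
  qed
  then have s': "avoids E P (lin_decreasing w') s v" if "v \<in> Domain E" for v using st that by blast
  have CE: "conform E P s \<subseteq> E" by (auto simp: conform_def)
  have "good_walk w pr xs = True" if xs: "closed_walk (conform E P s) xs" "distinct xs" for xs
  proof (rule ccontr)
    assume "good_walk w pr xs \<noteq> True"
    then have neg: "sum_list (map w' xs) < 0" using sign[OF xs CE] by simp
    have ne: "xs \<noteq> []" using xs by (simp add: closed_walk_def)
    have "hd xs \<in> Domain E" using sub[OF xs(1)] ne CE by (meson Domain_mono hd_in_set subsetD)
    then show False
      using s' infpath_cycle_path[OF xs(1)] lin_decreasing_cycle_path[OF ne neg]
      unfolding avoids_conform by blast
  qed
  then have "good_walk w pr xs" if "closed_walk (conform E P s) xs" for xs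
    using closed_walk_good_iff that by blast
  with s show ?thesis by (rule that)
qed

section \<open>Attractors and capped energy\<close>

abbreviation winning_play :: "('v \<Rightarrow> int) \<Rightarrow> ('v \<Rightarrow> nat) \<Rightarrow> (nat \<Rightarrow> 'v) \<Rightarrow> bool" where
  "winning_play w pr u \<equiv> bounded_below w u \<and> parity True pr u"

lemma tail_closed_winning_play: "tail_closed (winning_play w pr)"
  using tail_closed_bounded_below[of w] tail_closed_parity[of True pr] unfolding tail_closed_def by simp

lemma arena_finite: "arena E \<Longrightarrow> finite (Domain E)"
  by (simp add: arena_def finite_Domain)

section \<open>Subarenas, attractors and traps\<close>

lemma subarena:
  assumes "finite E" "\<And>v. v \<in> X \<Longrightarrow> \<exists>y \<in> X. (v, y) \<in> E"
  shows "Domain (Restr E X) = X" "arena (Restr E X)"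
proof -
  show dom: "Domain (Restr E X) = X" using assms(2) by blast
  have "Range (Restr E X) \<subseteq> X" by auto
  then show "arena (Restr E X)" using assms(1) unfolding arena_def dom by simp
qed

lemma infpath_Restr: "infpath (Restr E X) u \<longleftrightarrow> infpath E u \<and> (\<forall>n. u n \<in> X)"
  by (auto simp: infpath_def)

text \<open>Instead of an iteration, a set with a rank function is taken of largest cardinality: a
  vertex violating one of the last two clauses could be added with the next rank. These clauses make
  the complement of \<open>A\<close> a trap for the owner of \<open>P\<close>.\<close>

lemma attractor:
  assumes E: "arena E" and T: "T \<subseteq> Domain E"
  obtains A r where "T \<subseteq> A" "A \<subseteq> Domain E"
    and "\<And>v. v \<in> A \<Longrightarrow> r v \<le> card (A - T)"
    and "\<And>v. v \<in> A - T \<Longrightarrow> v \<in> P \<Longrightarrow> \<exists>y \<in> A. (v, y) \<in> E \<and> r y < r v"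
    and "\<And>v y. v \<in> A - T \<Longrightarrow> v \<notin> P \<Longrightarrow> (v, y) \<in> E \<Longrightarrow> y \<in> A \<and> r y < r v"
    and "\<And>v y. v \<in> Domain E - A \<Longrightarrow> v \<in> P \<Longrightarrow> (v, y) \<in> E \<Longrightarrow> y \<notin> A"
    and "\<And>v. v \<in> Domain E - A \<Longrightarrow> v \<notin> P \<Longrightarrow> \<exists>y. (v, y) \<in> E \<and> y \<notin> A"
proof -
  define ok where "ok A r \<longleftrightarrow> T \<subseteq> A \<and> A \<subseteq> Domain E \<and> (\<forall>v\<in>A. r v \<le> card (A - T)) \<and>
     (\<forall>v \<in> A - T. v \<in> P \<longrightarrow> (\<exists>y \<in> A. (v, y) \<in> E \<and> r y < r v)) \<and>
     (\<forall>v \<in> A - T. \<forall>y. v \<notin> P \<and> (v, y) \<in> E \<longrightarrow> y \<in> A \<and> r y < r v)" for A and r :: "'a \<Rightarrow> nat"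
  have fin: "finite (Domain E)" using E by (rule arena_finite)
  have "ok T (\<lambda>_. 0)" using T by (simp add: ok_def)
  then have ex: "\<exists>r. ok T r" by blast
  have "\<forall>B. (\<exists>r. ok B r) \<longrightarrow> card B < Suc (card (Domain E))"
    using card_mono[OF fin] by (auto simp: ok_def less_Suc_eq_le)
  with ex have "\<exists>A. (\<exists>r. ok A r) \<and> (\<forall>B. (\<exists>r. ok B r) \<longrightarrow> card B \<le> card A)"
    by (rule ex_has_greatest_nat[of "\<lambda>A. \<exists>r. ok A r"])
  then obtain A r where ok: "ok A r" and max: "\<And>B r'. ok B r' \<Longrightarrow> card B \<le> card A" by blast
  have finA: "finite A" using ok fin finite_subset unfolding ok_def by blast
  have no_ext: False
    if v: "v \<in> Domain E - A" and 1: "v \<in> P \<Longrightarrow> \<exists>y \<in> A. (v, y) \<in> E"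
      and 2: "\<And>y. v \<notin> P \<Longrightarrow> (v, y) \<in> E \<Longrightarrow> y \<in> A" for v
  proof -
    define r' where "r' = r(v := Suc (card (A - T)))"
    have old: "r' x = r x" if "x \<in> A" for x using that v by (auto simp: r'_def)
    have new: "r' v = Suc (card (A - T))" by (simp add: r'_def)
    have vT: "v \<notin> T" using ok v by (auto simp: ok_def)
    have c: "card (insert v A - T) = Suc (card (A - T))"
      using v vT finA by (simp add: insert_Diff_if)
    have le: "r x \<le> card (A - T)" if "x \<in> A" for x using ok that by (simp add: ok_def)
    have "ok (insert v A) r'"
      unfolding ok_def c
    proof (intro conjI ballI allI impI)
      show "T \<subseteq> insert v A" "insert v A \<subseteq> Domain E" using ok v by (auto simp: ok_def)
      show "r' x \<le> Suc (card (A - T))" if "x \<in> insert v A" for x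
        using that le old new by (metis insert_iff le_SucI order_refl)
      show "\<exists>y\<in>insert v A. (x, y) \<in> E \<and> r' y < r' x" if x: "x \<in> insert v A - T" "x \<in> P" for x
      proof (cases "x = v")
        case True
        then obtain y where "y \<in> A" "(v, y) \<in> E" using 1 x by blast
        then show ?thesis using True le[of y] old[of y] new by auto
      next
        case False
        then have "x \<in> A - T" using x by auto
        then obtain y where "y \<in> A" "(x, y) \<in> E" "r y < r x" using ok x unfolding ok_def by blast
        then show ?thesis using old[of y] old[of x] \<open>x \<in> A - T\<close> by auto
      qed
      fix x y assume x: "x \<in> insert v A - T" and xy: "x \<notin> P \<and> (x, y) \<in> E"
      have "y \<in> A \<and> r' y < r' x"
      proof (cases "x = v")
        case True
        then have "y \<in> A" using 2 xy by blast
        then show ?thesis using True le[of y] old[of y] new by auto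
      next
        case False
        then have "x \<in> A - T" using x by auto
        then have "y \<in> A" "r y < r x" using ok xy unfolding ok_def by blast+
        then show ?thesis using old[of y] old[of x] \<open>x \<in> A - T\<close> by auto
      qed
      then show "y \<in> insert v A" "r' y < r' x" by auto
    qed
    then have "card (insert v A) \<le> card A" by (rule max)
    then show False using v finA by simp
  qed
  show ?thesis
  proof (rule that[of A r])
    show "T \<subseteq> A" "A \<subseteq> Domain E" "\<And>v. v \<in> A \<Longrightarrow> r v \<le> card (A - T)"
      using ok by (auto simp: ok_def)
    show "\<exists>y \<in> A. (v, y) \<in> E \<and> r y < r v" if "v \<in> A - T" "v \<in> P" for v
      using ok that unfolding ok_def by blast
    show "y \<in> A \<and> r y < r v" if "v \<in> A - T" "v \<notin> P" "(v, y) \<in> E" for v y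
      using ok that unfolding ok_def by blast
    show "y \<notin> A" if "v \<in> Domain E - A" "v \<in> P" "(v, y) \<in> E" for v y
      using no_ext[OF that(1)] that by blast
    show "\<exists>y. (v, y) \<in> E \<and> y \<notin> A" if "v \<in> Domain E - A" "v \<notin> P" for v
      using no_ext[OF that(1)] that by blast
  qed
qed

text \<open>\<open>X\<close> is a trap for the owner of \<open>P\<close>. An opponent strategy on
  \<open>X\<close>, extended arbitrarily, is a strategy on \<open>E\<close>, and the winning play
  that exists against it cannot leave \<open>X\<close>.\<close>

lemma unbeaten_trap:
  assumes E: "arena E" and win: "unbeaten E P w pr" and X: "X \<subseteq> Domain E"
    and own: "\<And>v y. v \<in> X \<Longrightarrow> v \<in> P \<Longrightarrow> (v, y) \<in> E \<Longrightarrow> y \<in> X"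
    and opp: "\<And>v. v \<in> X \<Longrightarrow> v \<notin> P \<Longrightarrow> \<exists>y \<in> X. (v, y) \<in> E"
  shows "Domain (Restr E X) = X" "arena (Restr E X)" "unbeaten (Restr E X) P w pr"
proof -
  have fin: "finite E" using E by (simp add: arena_def)
  have succ: "\<exists>y \<in> X. (v, y) \<in> E" if "v \<in> X" for v using that X own opp by (cases "v \<in> P") blast+
  note sub = subarena[OF fin succ]
  show "Domain (Restr E X) = X" "arena (Restr E X)" using sub by blast+
  show "unbeaten (Restr E X) P w pr"
    unfolding unbeaten_def
  proof (intro allI impI notI)
    fix t v assume tv: "positional (Restr E X) (- P) t \<and> v \<in> Domain (Restr E X)"
      and av: "avoids (Restr E X) (- P) (winning_play w pr) t v"
    define t' where "t' x = (if x \<in> X then t x else SOME y. (x, y) \<in> E)" for x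
    have tX: "(x, t x) \<in> Restr E X" if "x \<in> X" "x \<notin> P" for x
      using tv that sub(1) unfolding positional_def by blast
    have some: "(x, SOME y. (x, y) \<in> E) \<in> E" if "x \<in> Domain E" for x
      using that by (auto intro: someI)
    have "positional E (- P) t'"
      unfolding positional_def t'_def using tX some by auto
    moreover have v: "v \<in> X" using tv sub(1) by blast
    ultimately have "\<not> avoids E (- P) (winning_play w pr) t' v"
      using win X unfolding unbeaten_def by blast
    then obtain u where u: "infpath E u" "u 0 = v" "follows (- P) t' u" "winning_play w pr u"
      unfolding avoids_def by blast
    have uX: "u n \<in> X" for n
    proof (induction n)
      case (Suc n)
      show ?case
      proof (cases "u n \<in> P")
        case True
        then show ?thesis using own[OF Suc] infpathD[OF u(1)] by blast
      next
        case False
        then have "u (Suc n) = t (u n)" using u(3) Suc by (simp add: follows_def t'_def)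
        then show ?thesis using tX[OF Suc False] by auto
      qed
    qed (simp add: u v)
    have "follows (- P) t u" using u(3) uX by (simp add: follows_def t'_def)
    then show False using avoidsD[OF av, of u] u uX by (simp add: infpath_Restr)
  qed
qed

text \<open>Strategies for single vertices are merged one at a time by
  \<open>avoids_combine\<close>, which terminates because there are finitely many vertices.\<close>

lemma uniform_avoids:
  assumes E: "arena E" and L: "tail_closed L"
  obtains t where "positional E P t"
    and "\<And>v t'. v \<in> Domain E \<Longrightarrow> positional E P t' \<Longrightarrow> avoids E P L t' v \<Longrightarrow> avoids E P L t v"
proof -
  define S where "S = {v \<in> Domain E. \<exists>t'. positional E P t' \<and> avoids E P L t' v}"
  have "finite S" using arena_finite[OF E] by (simp add: S_def)
  have "\<exists>t. positional E P t \<and> (\<forall>v \<in> S'. avoids E P L t v)" if "finite S'" "S' \<subseteq> S" for S'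
    using that
  proof (induction S')
    case empty
    have "positional E P (\<lambda>v. SOME y. (v, y) \<in> E)"
      unfolding positional_def by (auto intro: someI)
    then show ?case by blast
  next
    case (insert v S')
    then obtain t1 t2 where t1: "positional E P t1" "\<forall>v \<in> S'. avoids E P L t1 v"
      and t2: "positional E P t2" "avoids E P L t2 v"
      unfolding S_def by blast
    define t where "t x = (if avoids E P L t1 x then t1 x else t2 x)" for x
    have "positional E P t" using t1(1) t2(1) by (simp add: positional_def t_def)
    moreover have "avoids E P L t x" if "x \<in> insert v S'" for x
    proof (rule avoids_combine[OF L, of E P t1 t t2 E E])
      show "avoids E P L t1 x \<or> avoids E P L t2 x" using that t1 t2 by blast
    qed (auto simp: t_def)
    ultimately show ?case by blast
  qed
  from this[OF \<open>finite S\<close> order_refl] obtain t where "positional E P t" "\<forall>v \<in> S. avoids E P L t v" by blast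
  then show ?thesis by (intro that[of t]) (auto simp: S_def)
qed

text \<open>The energy level \<open>- 1\<close> stands for exhausted energy; it is absorbing and gets the odd priority 1.\<close>

definition cap_step :: "int \<Rightarrow> ('v \<Rightarrow> int) \<Rightarrow> 'v \<Rightarrow> int \<Rightarrow> int" where
  "cap_step D w v e = max (- 1) (min D (e + w v))"

definition cap_edges :: "('v \<times> 'v) set \<Rightarrow> int \<Rightarrow> ('v \<Rightarrow> int) \<Rightarrow> (('v \<times> int) \<times> ('v \<times> int)) set" where
  "cap_edges E D w =
     {((v, e), (y, cap_step D w v e)) | v e y. (v, y) \<in> E \<and> 0 \<le> e \<and> e \<le> D} \<union>
     {((v, - 1), (v, - 1)) | v. v \<in> Domain E}"

definition cap_prio :: "('v \<Rightarrow> nat) \<Rightarrow> 'v \<times> int \<Rightarrow> nat" where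
  "cap_prio pr c = (if snd c < 0 then 1 else pr (fst c))"

definition lift_player :: "'v set \<Rightarrow> ('v \<times> int) set" where
  "lift_player P = P \<times> UNIV"

lemma cap_step_bounds: "- 1 \<le> cap_step D w v e" "0 \<le> D \<Longrightarrow> cap_step D w v e \<le> D"
  by (auto simp: cap_step_def)

lemma mem_lift_player [simp]: "(v, e) \<in> lift_player P \<longleftrightarrow> v \<in> P"
  by (simp add: lift_player_def)

lemma cap_edges_iff:
  "((v, e), (y, f)) \<in> cap_edges E D w \<longleftrightarrow>
     0 \<le> e \<and> e \<le> D \<and> (v, y) \<in> E \<and> f = cap_step D w v e \<or>
     e = - 1 \<and> f = - 1 \<and> y = v \<and> v \<in> Domain E"
  by (auto simp: cap_edges_def)

lemma cap_edges_arena: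
  assumes "arena E" "0 \<le> D"
  shows "Domain (cap_edges E D w) = Domain E \<times> {- 1..D}" "arena (cap_edges E D w)"
proof -
  show dom: "Domain (cap_edges E D w) = Domain E \<times> {- 1..D}"
  proof
    show "Domain (cap_edges E D w) \<subseteq> Domain E \<times> {- 1..D}"
      using assms(2) by (auto simp: cap_edges_def)
    show "Domain E \<times> {- 1..D} \<subseteq> Domain (cap_edges E D w)"
    proof
      fix c assume "c \<in> Domain E \<times> {- 1..D}"
      then obtain v e y where c: "c = (v, e)" "(v, y) \<in> E" "- 1 \<le> e" "e \<le> D" by auto
      show "c \<in> Domain (cap_edges E D w)"
      proof (cases "e = - 1")
        case True
        then have "(c, (v, - 1)) \<in> cap_edges E D w" using c by (auto simp: cap_edges_iff)
        then show ?thesis by blast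
      next
        case False
        then have "(c, (y, cap_step D w v e)) \<in> cap_edges E D w" using c by (auto simp: cap_edges_iff)
        then show ?thesis by blast
      qed
    qed
  qed
  have ran: "Range (cap_edges E D w) \<subseteq> Domain E \<times> {- 1..D}"
    using assms cap_step_bounds[of D w] arena_succ[OF assms(1)]
    by (fastforce simp: cap_edges_def)
  have "cap_edges E D w \<subseteq> (Domain E \<times> {- 1..D}) \<times> (Domain E \<times> {- 1..D})"
    using dom ran by (auto dest: DomainI RangeI)
  moreover have "finite ((Domain E \<times> {- 1..D}) \<times> (Domain E \<times> {- 1..D}))"
    using arena_finite[OF assms(1)] by simp
  ultimately have "finite (cap_edges E D w)" by (rule finite_subset)
  then show "arena (cap_edges E D w)" using ran dom by (simp add: arena_def)
qed

definition cap_unbeaten :: "('v \<times> 'v) set \<Rightarrow> 'v set \<Rightarrow> ('v \<Rightarrow> int) \<Rightarrow> ('v \<Rightarrow> nat) \<Rightarrow> int \<Rightarrow> bool" where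
  "cap_unbeaten E P w pr D \<longleftrightarrow> (\<forall>t v. positional (cap_edges E D w) (- lift_player P) t \<and> v \<in> Domain E \<longrightarrow>
     \<not> avoids (cap_edges E D w) (- lift_player P) (parity True (cap_prio pr)) t (v, D))"

text \<open>The capped arena is finite and both parity objectives are closed under interleaving, so
  determinacy turns the absence of a positional refutation into a positional winning
  strategy.\<close>

lemma cap_unbeaten_strategy:
  assumes "arena E" "0 \<le> D" "cap_unbeaten E P w pr D"
  obtains s where "positional (cap_edges E D w) (lift_player P) s"
    and "\<And>v. v \<in> Domain E \<Longrightarrow>
      avoids (cap_edges E D w) (lift_player P) (parity False (cap_prio pr)) s (v, D)"
proof -
  have disj: "\<not> (parity False (cap_prio pr) u \<and> parity True (cap_prio pr) u)" for u :: "nat \<Rightarrow> 'a \<times> int"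
    using parity_disjoint by blast
  obtain s t where "positional (cap_edges E D w) (lift_player P) s"
      "positional (cap_edges E D w) (- lift_player P) t"
      "\<And>c. c \<in> Domain (cap_edges E D w) \<Longrightarrow>
         avoids (cap_edges E D w) (lift_player P) (parity False (cap_prio pr)) s c \<or>
         avoids (cap_edges E D w) (- lift_player P) (parity True (cap_prio pr)) t c"
    using positional_determinacy[where P = "lift_player P", OF cap_edges_arena(2)[OF assms(1,2), of w]
        tail_closed_parity shuffle_closed_parity tail_closed_parity shuffle_closed_parity disj] by blast
  moreover have "(v, D) \<in> Domain (cap_edges E D w)" if "v \<in> Domain E" for v
    using that assms(2) cap_edges_arena(1)[OF assms(1,2)] by auto
  ultimately show ?thesis using assms(3) that unfolding cap_unbeaten_def by blast
qed

text \<open>Follow shortest paths to \<open>Z\<close>: \<open>dst\<close> decreases until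
  \<open>Z\<close> is entered and is then measured anew. Counting \<open>Suc n\<close> edges forces
  progress also from a vertex already in \<open>Z\<close>.\<close>

lemma frequent_path:
  assumes Z: "\<And>z. z \<in> Z \<Longrightarrow> \<exists>z' \<in> Z. (z, z') \<in> F\<^sup>+" and z: "z0 \<in> Z"
  obtains u where "infpath F u" "u 0 = z0" "\<exists>\<^sub>\<infinity>n. u n \<in> Z"
proof -
  define Q where "Q a n \<longleftrightarrow> (\<exists>z \<in> Z. (a, z) \<in> F ^^ Suc n)" for a n
  define M where "M = {a. \<exists>n. Q a n}"
  define dst where "dst a = (LEAST n. Q a n)" for a
  have ZM: "a \<in> M" if "a \<in> Z" for a
  proof -
    obtain z' where "z' \<in> Z" "(a, z') \<in> F\<^sup>+" using Z[OF \<open>a \<in> Z\<close>] by blast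
    then obtain n where "n > 0" "(a, z') \<in> F ^^ n" using trancl_power by blast
    then show ?thesis using \<open>z' \<in> Z\<close> unfolding M_def Q_def by (cases n) blast+
  qed
  have "\<exists>b. (a, b) \<in> F \<and> b \<in> M \<and> (b \<in> Z \<or> dst b < dst a)" if "a \<in> M" for a
  proof -
    have Qa: "Q a (dst a)" unfolding dst_def using that by (auto simp: M_def intro: LeastI)
    then obtain z where z: "z \<in> Z" "(a, z) \<in> F ^^ Suc (dst a)" by (auto simp: Q_def)
    then obtain b where b: "(a, b) \<in> F" "(b, z) \<in> F ^^ dst a" using relpow_Suc_D2 by metis
    show ?thesis
    proof (cases "dst a")
      case 0
      then have "b = z" using b(2) by simp
      then show ?thesis using b z ZM by blast
    next
      case (Suc k)
      then have Qb: "Q b k" using b(2) z(1) by (auto simp: Q_def)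
      then have "dst b \<le> k" unfolding dst_def by (rule Least_le)
      moreover have "b \<in> M" using Qb by (auto simp: M_def)
      ultimately show ?thesis using b(1) Suc by auto
    qed
  qed
  then obtain nx where nx: "\<And>a. a \<in> M \<Longrightarrow> (a, nx a) \<in> F \<and> nx a \<in> M \<and> (nx a \<in> Z \<or> dst (nx a) < dst a)"
    by metis
  define u where "u n = (nx ^^ n) z0" for n
  have uM: "u n \<in> M" for n by (induction n) (use ZM z nx in \<open>auto simp: u_def\<close>)
  have uS: "u (Suc n) = nx (u n)" for n by (simp add: u_def)
  have "\<exists>m > n. u m \<in> Z" for n
  proof (induction "dst (u n)" arbitrary: n rule: less_induct)
    case less
    show ?case
    proof (cases "u (Suc n) \<in> Z")
      case False
      then have "dst (u (Suc n)) < dst (u n)" using nx[OF uM[of n]] uS by simp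
      then obtain m where "m > Suc n" "u m \<in> Z" using less by blast
      then show ?thesis by (intro exI[of _ m]) simp
    qed blast
  qed
  then have "\<exists>\<^sub>\<infinity>n. u n \<in> Z" by (simp add: INFM_nat)
  moreover have "infpath F u" unfolding infpath_def using nx[OF uM] uS by simp
  ultimately show ?thesis using that[of u] by (simp add: u_def)
qed

text \<open>The self-loop is the only move at level \<open>- 1\<close>, and its priority 1 is odd.
  Hence a strategy that avoids odd parity never exhausts the energy.\<close>

lemma cap_sunk:
  assumes s: "positional (cap_edges E D w) (lift_player P) s" and v: "v \<in> Domain E"
  shows "\<not> avoids (cap_edges E D w) (lift_player P) (parity False (cap_prio pr)) s (v, - 1)"
proof -
  have edge: "((v, - 1), (v, - 1)) \<in> cap_edges E D w" using v by (simp add: cap_edges_iff)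
  have "s (v, - 1) = (v, - 1)" if "v \<in> P"
  proof -
    have "((v, - 1), s (v, - 1)) \<in> cap_edges E D w"
      using s that edge unfolding positional_def by auto
    then show ?thesis by (cases "s (v, - 1)") (auto simp: cap_edges_iff)
  qed
  then have "infpath (conform (cap_edges E D w) (lift_player P) s) (\<lambda>_. (v, - 1))"
    using edge by (auto simp: infpath_def conform_def)
  moreover have "parity False (cap_prio pr) (\<lambda>_. (v, - 1))"
    by (auto simp: parity_def cap_prio_def intro!: exI[of _ 1])
  ultimately show ?thesis unfolding avoids_conform by (metis (no_types, lifting))
qed

text \<open>A fixed positional strategy \<open>t\<close> of the opponent in the capped game, to be refuted.\<close>

locale capped_game =
  fixes E :: "('v \<times> 'v) set" and P :: "'v set" and w :: "'v \<Rightarrow> int" and pr :: "'v \<Rightarrow> nat"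
    and D W :: int and t :: "'v \<times> int \<Rightarrow> 'v \<times> int"
  assumes E: "arena E" and D: "0 \<le> D" and W: "1 \<le> W"
    and wW: "\<And>v. v \<in> Domain E \<Longrightarrow> \<bar>w v\<bar> \<le> W"
    and t: "positional (cap_edges E D w) (- lift_player P) t"
begin

text \<open>With \<open>t\<close> fixed, only the owner of \<open>P\<close> still chooses, so
  refuting \<open>t\<close> means finding a path of \<open>C\<close> with even parity.\<close>

definition C :: "(('v \<times> int) \<times> ('v \<times> int)) set" where
  "C = conform (cap_edges E D w) (- lift_player P) t"

lemma C_step:
  assumes v: "v \<in> Domain E" "0 \<le> e" "e \<le> D"
    and y: "v \<in> P \<Longrightarrow> (v, y) \<in> E" "v \<notin> P \<Longrightarrow> y = fst (t (v, e))"
  shows "(v, y) \<in> E" "((v, e), (y, cap_step D w v e)) \<in> C"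
proof -
  have "(v, y) \<in> E \<and> ((v, e), (y, cap_step D w v e)) \<in> C"
  proof (cases "v \<in> P")
    case True
    then show ?thesis using y(1) v by (simp add: C_def conform_def cap_edges_iff)
  next
    case False
    have "(v, e) \<in> Domain (cap_edges E D w)" using cap_edges_arena(1)[OF E D] v by auto
    then have edge: "((v, e), t (v, e)) \<in> cap_edges E D w"
      using t False unfolding positional_def by auto
    obtain a f where af: "t (v, e) = (a, f)" by fastforce
    have "(v, a) \<in> E" "f = cap_step D w v e" using edge v unfolding af cap_edges_iff by auto
    then show ?thesis using edge y(2)[OF False] af False by (simp add: C_def conform_def)
  qed
  then show "(v, y) \<in> E" "((v, e), (y, cap_step D w v e)) \<in> C" by blast+
qed

lemma cap_step_ge: "v \<in> Domain E \<Longrightarrow> c \<le> D \<Longrightarrow> c \<le> e - W \<Longrightarrow> c \<le> cap_step D w v e"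
  using wW[of v] by (auto simp: cap_step_def)

text \<open>Each step towards \<open>T\<close> lowers the rank and costs at most \<open>W\<close>,
  so \<open>r v * W\<close> pays for the way and \<open>c\<close> is left over.\<close>

lemma attractor_run:
  assumes A: "A \<subseteq> Domain E"
    and own: "\<And>v. v \<in> A - T \<Longrightarrow> v \<in> P \<Longrightarrow> \<exists>y \<in> A. (v, y) \<in> E \<and> r y < r v"
    and opp: "\<And>v y. v \<in> A - T \<Longrightarrow> v \<notin> P \<Longrightarrow> (v, y) \<in> E \<Longrightarrow> y \<in> A \<and> r y < r v"
    and c: "0 \<le> c"
  shows "v \<in> A \<Longrightarrow> int (r v) * W + c \<le> e \<Longrightarrow> e \<le> D \<Longrightarrow>
    \<exists>z f. z \<in> T \<and> c \<le> f \<and> f \<le> D \<and> ((v, e), (z, f)) \<in> C\<^sup>*"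
proof (induction "r v" arbitrary: v e rule: less_induct)
  case less
  show ?case
  proof (cases "v \<in> T")
    case True
    have "0 \<le> int (r v) * W" using W by simp
    then have "c \<le> e" using less.prems by linarith
    then show ?thesis using True less.prems(3) by blast
  next
    case False
    then have vA: "v \<in> A - T" using less.prems by simp
    have vD: "v \<in> Domain E" using A less.prems(1) by auto
    have "0 \<le> int (r v) * W" using W by simp
    then have e: "0 \<le> e" "e \<le> D" using less.prems c by linarith+
    obtain y where y: "y \<in> A" "r y < r v" "((v, e), (y, cap_step D w v e)) \<in> C"
    proof (cases "v \<in> P")
      case True
      then obtain y where "y \<in> A" "(v, y) \<in> E" "r y < r v" using own[OF vA] by blast
      then show ?thesis using that C_step(2)[OF vD e] True by blast
    next
      case False
      define y where "y = fst (t (v, e))"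
      have "(v, y) \<in> E" "((v, e), (y, cap_step D w v e)) \<in> C"
        using C_step[OF vD e, of y] False by (auto simp: y_def)
      then show ?thesis using that opp[OF vA False] by blast
    qed
    have "int (r y) + 1 \<le> int (r v)" using y(2) by simp
    then have "(int (r y) + 1) * W \<le> int (r v) * W" using W by (intro mult_right_mono) auto
    then have "int (r y) * W + c \<le> e - W" using less.prems(2) by (simp add: algebra_simps)
    then have "int (r y) * W + c \<le> cap_step D w v e"
      using e W by (intro cap_step_ge[OF vD]) auto
    then obtain z f where zf: "z \<in> T" "c \<le> f" "f \<le> D" "((y, cap_step D w v e), (z, f)) \<in> C\<^sup>*"
      using less.hyps[OF y(2) y(1) _ cap_step_bounds(2)[OF D]] by metis
    have "((v, e), (z, f)) \<in> C\<^sup>*" using y(3) zf(4) by (rule converse_rtrancl_into_rtrancl)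
    then show ?thesis using zf by blast
  qed
qed

text \<open>Until level \<open>D\<close> is reached nothing is cut off, so the level is exactly
  \<open>e0 + esum w x n\<close>, which \<open>good_walk_drop\<close> keeps non-negative. If
  \<open>D\<close> were never reached, the energy would be bounded from above; good cycles then
  force even parity, which \<open>lose\<close> excludes.\<close>

lemma good_for_energy_run:
  assumes s: "positional E P s" and good: "\<And>xs. closed_walk (conform E P s) xs \<Longrightarrow> good_walk w pr xs"
    and v0: "v0 \<in> Domain E" and e0: "int (card (Domain E)) * W \<le> e0" "e0 \<le> D"
    and lose: "\<And>u. infpath C u \<Longrightarrow> u 0 = (v0, e0) \<Longrightarrow> \<not> parity True (cap_prio pr) u"
  shows "\<exists>q. ((v0, e0), (q, D)) \<in> C\<^sup>*"
proof (rule ccontr)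
  assume never: "\<not> (\<exists>q. ((v0, e0), (q, D)) \<in> C\<^sup>*)"
  define g where "g = (\<lambda>(v, e). (if v \<in> P then s v else fst (t (v, e)), cap_step D w v e))"
  define u where "u n = (g ^^ n) (v0, e0)" for n
  define x where "x n = fst (u n)" for n
  have u0: "u 0 = (v0, e0)" by (simp add: u_def)
  have nonneg: "0 \<le> int (card (Domain E)) * W" using W by simp
  have inv: "x n \<in> Domain E \<and> snd (u n) = e0 + esum w x n \<and> ((v0, e0), u n) \<in> C\<^sup>* \<and>
      0 \<le> snd (u n) \<and> snd (u n) \<le> D \<and> (u n, u (Suc n)) \<in> C \<and> (x n, x (Suc n)) \<in> conform E P s" for n
  proof (induction n rule: less_induct)
    case (less n)
    have walk: "successively (\<lambda>a b. (a, b) \<in> conform E P s) (map x [0..<n])"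
      using less by (auto simp: successively_conv_nth)
    have "set (map x [0..<n]) \<subseteq> Domain E" using less by auto
    then have "sum_list (map w (map x [0..<n])) \<ge> - (int (card (Domain E)) * W)"
      using good_walk_drop[OF good arena_finite[OF E] wW _ walk] W by auto
    moreover have "sum_list (map w (map x [0..<n])) = esum w x n"
      by (simp add: esum_def interv_sum_list_conv_sum_set_nat o_def atLeast0LessThan)
    ultimately have low: "0 \<le> e0 + esum w x n" using e0(1) by linarith
    have prefix: "x n \<in> Domain E \<and> snd (u n) = e0 + esum w x n \<and> ((v0, e0), u n) \<in> C\<^sup>* \<and> snd (u n) \<le> D"
    proof (cases n)
      case 0
      then show ?thesis using u0 v0 e0 by (simp add: x_def)
    next
      case (Suc m)
      then have m: "x m \<in> Domain E" "snd (u m) = e0 + esum w x m" "((v0, e0), u m) \<in> C\<^sup>*"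
          "0 \<le> snd (u m)" "snd (u m) \<le> D" "(u m, u n) \<in> C" "(x m, x n) \<in> conform E P s"
        using less[of m] by auto
      have r: "((v0, e0), u n) \<in> C\<^sup>*" using m(3,6) by (rule rtrancl_into_rtrancl)
      have xn: "x n \<in> Domain E" using m(7) arena_succ[OF E] by (auto simp: conform_def)
      have sn: "snd (u n) = cap_step D w (x m) (snd (u m))"
        using Suc by (simp add: u_def g_def x_def split: prod.split)
      have "snd (u n) \<noteq> D" using r never by (metis prod.collapse)
      moreover have es: "snd (u m) + w (x m) = e0 + esum w x n" using m(2) Suc by simp
      ultimately have "snd (u n) = e0 + esum w x n"
        using sn low D unfolding cap_step_def by linarith
      moreover have "snd (u n) \<le> D" unfolding sn by (rule cap_step_bounds(2)[OF D])
      ultimately show ?thesis using r xn by blast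
    qed
    have low: "0 \<le> snd (u n)" using low prefix by simp
    have un: "u n = (x n, snd (u n))" by (simp add: x_def)
    have uS: "u (Suc n) = (if x n \<in> P then s (x n) else fst (t (u n)), cap_step D w (x n) (snd (u n)))"
      by (simp add: u_def g_def x_def split: prod.split)
    then have xS: "x (Suc n) = (if x n \<in> P then s (x n) else fst (t (u n)))" by (simp add: x_def)
    have own: "(x n, x (Suc n)) \<in> E" if "x n \<in> P"
      using that prefix s xS by (auto simp: positional_def)
    have opp: "x (Suc n) = fst (t (x n, snd (u n)))" if "x n \<notin> P" using that xS un by simp
    have "(x n, x (Suc n)) \<in> E" "((x n, snd (u n)), (x (Suc n), cap_step D w (x n) (snd (u n)))) \<in> C"
      using C_step[of "x n" "snd (u n)" "x (Suc n)"] prefix low own opp by blast+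
    moreover have "u (Suc n) = (x (Suc n), cap_step D w (x n) (snd (u n)))" using uS xS by simp
    ultimately show ?case using prefix low un xS by (auto simp: conform_def)
  qed
  have pathC: "infpath C u" using inv by (simp add: infpath_def)
  have pathx: "infpath (conform E P s) x" using inv by (simp add: infpath_def)
  have "parity True pr x"
  proof (rule ccontr)
    assume "\<not> parity True pr x"
    moreover have "finite (Domain (conform E P s))"
      by (rule finite_subset[OF _ arena_finite[OF E]]) (auto simp: conform_def)
    ultimately obtain n where "D - e0 < esum w x n"
      using good_walk_even_or_unbounded[OF pathx _ good] by blast
    then show False using inv[of n] by simp
  qed
  moreover have "cap_prio pr (u n) = pr (x n)" for n using inv[of n] by (simp add: cap_prio_def x_def)
  ultimately have "parity True (cap_prio pr) u" by (simp add: parity_def)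
  then show False using lose[OF pathC u0] by simp
qed

text \<open>The winning strategy of the capped game on \<open>X\<close> is simulated with a virtual
  level \<open>e'\<close> that stays at least \<open>c\<close> below the actual one. A run that
  remains in \<open>X\<close> would have even parity, so the opponent leaves \<open>X\<close> at
  some point, and that step costs at most another \<open>W\<close>.\<close>

lemma transfer_run:
  assumes X: "X \<subseteq> Domain E" and dom: "Domain (Restr E X) = X" and sub: "arena (Restr E X)"
    and D': "0 \<le> D'" and win: "cap_unbeaten (Restr E X) P w pr D'"
    and c: "0 \<le> c" "c \<le> D - D'" and v0: "v0 \<in> X" and e0: "D' + c \<le> e0" "e0 \<le> D"
    and lose: "\<And>u. infpath C u \<Longrightarrow> u 0 = (v0, e0) \<Longrightarrow> \<not> parity True (cap_prio pr) u"
  shows "\<exists>a y f. a \<in> X - P \<and> (a, y) \<in> E \<and> y \<notin> X \<and> c - W \<le> f \<and> f \<le> D \<and> ((v0, e0), (y, f)) \<in> C\<^sup>*"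
proof -
  let ?K = "cap_edges (Restr E X) D' w"
  let ?S = "\<lambda>s. conform ?K (lift_player P) s"
  obtain s where s: "positional ?K (lift_player P) s"
      "\<And>v. v \<in> X \<Longrightarrow> avoids ?K (lift_player P) (parity False (cap_prio pr)) s (v, D')"
    using cap_unbeaten_strategy[OF sub D' win] unfolding dom by blast
  have Kdom: "Domain ?K = X \<times> {- 1..D'}" using cap_edges_arena(1)[OF sub D'] dom by simp
  define g where "g = (\<lambda>(v, e', e). (if v \<in> P then fst (s (v, e')) else fst (t (v, e)),
      cap_step D' w v e', cap_step D w v e))"
  define z where "z n = (g ^^ n) (v0, D', e0)" for n
  define x e' e where "x n = fst (z n)" and "e' n = fst (snd (z n))" and "e n = snd (snd (z n))" for n
  have z0: "x 0 = v0" "e' 0 = D'" "e 0 = e0" by (simp_all add: z_def x_def e'_def e_def)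
  have zS: "x (Suc n) = (if x n \<in> P then fst (s (x n, e' n)) else fst (t (x n, e n)))"
      "e' (Suc n) = cap_step D' w (x n) (e' n)" "e (Suc n) = cap_step D w (x n) (e n)" for n
    by (simp_all add: z_def x_def e'_def e_def g_def split: prod.split)
  have sunk: "\<not> avoids ?K (lift_player P) (parity False (cap_prio pr)) s (v, - 1)" if "v \<in> X" for v
    by (rule cap_sunk[OF s(1)]) (use that dom in simp)
  define pre where "pre n \<longleftrightarrow> avoids ?K (lift_player P) (parity False (cap_prio pr)) s (x n, e' n) \<and>
      0 \<le> e' n \<and> e' n \<le> D' \<and> e' n + c \<le> e n \<and> e n \<le> D \<and> ((v0, e0), (x n, e n)) \<in> C\<^sup>*" for n
  have step: "(x n, x (Suc n)) \<in> E \<and> ((x n, e n), (x (Suc n), e (Suc n))) \<in> C \<and>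
      (x n \<in> P \<longrightarrow> x (Suc n) \<in> X) \<and>
      (x (Suc n) \<in> X \<longrightarrow> ((x n, e' n), (x (Suc n), e' (Suc n))) \<in> ?S s)"
    if n: "pre n" "x n \<in> X" for n
  proof -
    have e: "0 \<le> e n" "e n \<le> D" and e': "0 \<le> e' n" "e' n \<le> D'" using n(1) c by (auto simp: pre_def)
    have own: "s (x n, e' n) = (x (Suc n), e' (Suc n)) \<and> (x n, x (Suc n)) \<in> Restr E X" if "x n \<in> P"
    proof -
      have "(x n, e' n) \<in> Domain ?K" using Kdom n(2) e' by auto
      then have edge: "((x n, e' n), s (x n, e' n)) \<in> ?K"
        using s(1) that unfolding positional_def by auto
      then show ?thesis
        using that zS(1,2)[of n] e' by (cases "s (x n, e' n)") (auto simp: cap_edges_iff)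
    qed
    have xD: "x n \<in> Domain E" using X n(2) by blast
    have 1: "(x n, x (Suc n)) \<in> E" if "x n \<in> P" using own[OF that] by blast
    have 2: "x (Suc n) = fst (t (x n, e n))" if "x n \<notin> P" using zS(1)[of n] that by simp
    have edge: "(x n, x (Suc n)) \<in> E" by (rule C_step(1)[OF xD e 1 2])
    have "((x n, e n), (x (Suc n), cap_step D w (x n) (e n))) \<in> C" by (rule C_step(2)[OF xD e 1 2])
    then have C: "((x n, e n), (x (Suc n), e (Suc n))) \<in> C" by (simp only: zS(3))
    have "((x n, e' n), (x (Suc n), e' (Suc n))) \<in> ?S s" if "x (Suc n) \<in> X"
    proof -
      have "((x n, e' n), (x (Suc n), e' (Suc n))) \<in> ?K"
        using that n(2) edge e' zS(2)[of n] by (simp add: cap_edges_iff)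
      moreover have "(x (Suc n), e' (Suc n)) = s (x n, e' n)" if "(x n, e' n) \<in> lift_player P"
        using own that by simp
      ultimately show ?thesis unfolding conform_def by blast
    qed
    then show ?thesis using own C edge by blast
  qed
  have pre_Suc: "pre (Suc n)" if n: "pre n" "x n \<in> X" "x (Suc n) \<in> X" for n
  proof -
    note st = step[OF n(1,2)]
    have "avoids ?K (lift_player P) (parity False (cap_prio pr)) s (x n, e' n)"
      using n(1) by (simp add: pre_def)
    moreover have "((x n, e' n), (x (Suc n), e' (Suc n))) \<in> (?S s)\<^sup>*" using st n(3) by blast
    ultimately have av: "avoids ?K (lift_player P) (parity False (cap_prio pr)) s (x (Suc n), e' (Suc n))"
      by (rule avoids_reachable[OF tail_closed_parity])
    \<comment> \<open>A sunk virtual level would be lost for \<open>s\<close>, so the virtual level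
      stays non-negative, and the actual one with it.\<close>
    then have "e' (Suc n) \<noteq> - 1" using sunk[OF n(3)] by auto
    then have pos: "0 \<le> e' (Suc n)" using zS(2)[of n] cap_step_bounds(1)[of D' w "x n" "e' n"] by simp
    have "e' n + c \<le> e n" using n(1) by (simp add: pre_def)
    \<comment> \<open>The two caps differ by at least \<open>c\<close>, so cutting off energy
      preserves the gap.\<close>
    then have "e' (Suc n) + c \<le> e (Suc n)"
      using c pos unfolding zS(2,3)[of n] cap_step_def by linarith
    moreover have "e' (Suc n) \<le> D'" "e (Suc n) \<le> D"
      using zS(2,3)[of n] cap_step_bounds(2)[OF D'] cap_step_bounds(2)[OF D] by auto
    moreover have "((v0, e0), (x n, e n)) \<in> C\<^sup>*" using n(1) by (simp add: pre_def)
    then have "((v0, e0), (x (Suc n), e (Suc n))) \<in> C\<^sup>*"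
      by (rule rtrancl_into_rtrancl) (use st in blast)
    ultimately show ?thesis using av pos by (simp add: pre_def)
  qed
  have pre0: "pre 0" using s(2)[OF v0] e0 c D' z0 by (simp add: pre_def)
  have pre_all: "pre n" if "\<And>i. i \<le> n \<Longrightarrow> x i \<in> X" for n
    using that by (induction n) (auto intro: pre0 pre_Suc)
  show ?thesis
  proof (cases "\<forall>n. x n \<in> X")
    case True
    then have pre: "pre n" for n by (intro pre_all) auto
    have "infpath (?S s) (\<lambda>n. (x n, e' n))" unfolding infpath_def using step[OF pre] True by blast
    moreover have "avoids ?K (lift_player P) (parity False (cap_prio pr)) s (x 0, e' 0)"
      using pre[of 0] by (simp add: pre_def)
    ultimately have "\<not> parity False (cap_prio pr) (\<lambda>n. (x n, e' n))"
      unfolding avoids_conform by (metis (no_types, lifting))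
    moreover have "parity True (cap_prio pr) (\<lambda>n. (x n, e' n)) \<or> parity False (cap_prio pr) (\<lambda>n. (x n, e' n))"
    proof (rule parity_total)
      show "finite (X \<times> {- 1..D'})" using arena_finite[OF sub] dom by simp
      show "(x n, e' n) \<in> X \<times> {- 1..D'}" for n
      proof -
        have "0 \<le> e' n" "e' n \<le> D'" using pre[of n] by (simp_all add: pre_def)
        then show ?thesis using True by simp
      qed
    qed
    ultimately have "parity True (cap_prio pr) (\<lambda>n. (x n, e' n))" by blast
    moreover have "cap_prio pr (x n, e' n) = cap_prio pr (x n, e n)" for n
      using pre[of n] c by (simp add: cap_prio_def pre_def)
    ultimately have "parity True (cap_prio pr) (\<lambda>n. (x n, e n))" by (simp add: parity_def)
    moreover have "infpath C (\<lambda>n. (x n, e n))" unfolding infpath_def using step[OF pre] True by blast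
    ultimately show ?thesis using lose[of "\<lambda>n. (x n, e n)"] z0 by simp
  next
    case False
    then obtain m where m: "x m \<notin> X" "\<And>i. i < m \<Longrightarrow> x i \<in> X"
      using exists_least_iff[of "\<lambda>n. x n \<notin> X"] by blast
    obtain n where n: "m = Suc n" using m(1) v0 z0 by (cases m) auto
    have xn: "x n \<in> X" using m(2) n by simp
    have pre: "pre n" using m(2) n by (intro pre_all) auto
    note st = step[OF pre xn]
    have xD: "x n \<in> Domain E" using X xn by blast
    have "c - W \<le> e m"
      using pre c D D' W zS(3)[of n] cap_step_ge[OF xD, of "c - W" "e n"] n by (auto simp: pre_def)
    moreover have "e m \<le> D" using zS(3)[of n] n cap_step_bounds(2)[OF D] by simp
    moreover have "((v0, e0), (x n, e n)) \<in> C\<^sup>*" using pre by (simp add: pre_def)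
    then have "((v0, e0), (x m, e m)) \<in> C\<^sup>*"
      unfolding n by (rule rtrancl_into_rtrancl) (use st in blast)
    ultimately show ?thesis using st xn m(1) n by blast
  qed
qed

end

section \<open>Even and odd minimal priority in the capped game\<close>

lemma cap_edges_sunk:
  assumes "infpath (cap_edges E D w) u" "snd (u n) < 0" "n \<le> m"
  shows "snd (u m) < 0"
  using assms(3)
proof (induction m rule: dec_induct)
  case (step m)
  obtain v e y f where uv: "u m = (v, e)" "u (Suc m) = (y, f)" by (meson surj_pair)
  then have "((v, e), (y, f)) \<in> cap_edges E D w" using infpathD[OF assms(1), of m] by simp
  then show ?case using step.IH uv by (auto simp: cap_edges_iff)
qed (rule assms)

lemma parity_min_often:
  assumes "\<And>n. p \<le> pr (u n)" "\<exists>\<^sub>\<infinity>n. pr (u n) = p"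
  shows "parity (even p) pr u"
  unfolding parity_def using assms by (intro exI[of _ p]) auto

lemma priorities_below:
  assumes "finite X" "X' \<subseteq> X" "v \<in> X" "pr v \<notin> pr ` X'"
  shows "Suc (card (pr ` X')) \<le> card (pr ` X)"
proof -
  have "pr ` X' \<subset> pr ` X" using assms(2-4) by blast
  then have "card (pr ` X') < card (pr ` X)" using assms(1) by (intro psubset_card_mono) auto
  then show ?thesis by simp
qed

lemma (in capped_game) avoids_C:
  assumes "tail_closed L" "avoids (cap_edges E D w) (- lift_player P) L t c"
    and "(c, u 0) \<in> C\<^sup>*" "infpath C u"
  shows "\<not> L u"
proof -
  have "avoids (cap_edges E D w) (- lift_player P) L t (u 0)"
    using avoids_reachable[OF assms(1,2)] assms(3) by (simp add: C_def)
  then show ?thesis by (rule avoidsD) (use assms(4) in \<open>simp_all add: C_def infpath_conform\<close>)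
qed

text \<open>The budget from full energy: \<open>D'\<close> for play inside \<open>X\<close>,
  \<open>W\<close> for the edge out of \<open>X\<close>, \<open>card (A - T) * W\<close> for the
  attractor, \<open>W\<close> for an edge out of \<open>T\<close>, and
  \<open>card (Domain E) * W\<close> to start the good-for-energy strategy. That strategy wins or
  restores full energy, so \<open>T\<close> can be visited again and again.\<close>

lemma (in capped_game) cap_unbeaten_even:
  assumes win: "unbeaten E P w pr" and v0: "v0 \<in> Domain E"
    and p: "p = Min (pr ` Domain E)" "even p"
    and T: "T = {v \<in> Domain E. pr v = p}"
    and A: "T \<subseteq> A" "A \<subseteq> Domain E" "\<And>v. v \<in> A \<Longrightarrow> r v \<le> card (A - T)"
      "\<And>v. v \<in> A - T \<Longrightarrow> v \<in> P \<Longrightarrow> \<exists>y \<in> A. (v, y) \<in> E \<and> r y < r v"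
      "\<And>v y. v \<in> A - T \<Longrightarrow> v \<notin> P \<Longrightarrow> (v, y) \<in> E \<Longrightarrow> y \<in> A \<and> r y < r v"
    and X: "X = Domain E - A" "Domain (Restr E X) = X" "arena (Restr E X)"
    and D': "0 \<le> D'" "cap_unbeaten (Restr E X) P w pr D'"
    and bound: "D' + W + int (card (A - T)) * W + int (Suc (card (Domain E))) * W \<le> D"
  shows "\<not> avoids (cap_edges E D w) (- lift_player P) (parity True (cap_prio pr)) t (v0, D)"
proof
  assume av: "avoids (cap_edges E D w) (- lift_player P) (parity True (cap_prio pr)) t (v0, D)"
  have lose: "\<not> parity True (cap_prio pr) u" if "((v0, D), u 0) \<in> C\<^sup>*" "infpath C u" for u
    by (rule avoids_C[OF tail_closed_parity av that])
  let ?n = "card (Domain E)"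
  define B where "B = int (Suc ?n) * W"
  have nn: "0 \<le> int (card (A - T)) * W" "0 \<le> int ?n * W" using W by auto
  have Bn: "B = int ?n * W + W" by (simp add: B_def algebra_simps)
  have B: "0 \<le> B" using nn W Bn by linarith
  obtain s where s: "positional E P s" "\<And>xs. closed_walk (conform E P s) xs \<Longrightarrow> good_walk w pr xs"
    using good_for_energy[OF E win] by blast
  have CD: "c \<in> Domain E \<times> {- 1..D} \<and> d \<in> Domain E \<times> {- 1..D}" if "(c, d) \<in> C" for c d
  proof -
    have "(c, d) \<in> cap_edges E D w" using that by (simp add: C_def conform_def)
    then show ?thesis
      using cap_edges_arena(1)[OF E D, of w] arena_succ[OF cap_edges_arena(2)[OF E D, of w]] by blast
  qed
  have reachD: "q \<in> Domain E" if "((v0, D), (q, e)) \<in> C\<^sup>*" for q e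
    using that v0 CD by (cases rule: rtranclE) auto
  have to_T: "\<exists>z f. z \<in> T \<and> B \<le> f \<and> f \<le> D \<and> ((q, D), (z, f)) \<in> C\<^sup>*"
    if q: "((v0, D), (q, D)) \<in> C\<^sup>*" for q
  proof -
    have from_A: "\<exists>z f. z \<in> T \<and> B \<le> f \<and> f \<le> D \<and> ((y, f'), (z, f)) \<in> C\<^sup>*"
      if y: "y \<in> A" "D - D' - W \<le> f'" "f' \<le> D" for y f'
    proof (rule attractor_run[OF A(2) A(4,5) B y(1) _ y(3)])
      have "int (r y) * W \<le> int (card (A - T)) * W" using A(3)[OF y(1)] W by (intro mult_right_mono) auto
      then show "int (r y) * W + B \<le> f'" using bound y(2) B_def by linarith
    qed auto
    show ?thesis
    proof (cases "q \<in> A")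
      case True
      then show ?thesis using from_A[of q D] D' W by auto
    next
      case False
      then have qX: "q \<in> X" using reachD[OF q] X(1) by blast
      have XD: "X \<subseteq> Domain E" using X(1) by blast
      have c: "0 \<le> D - D'" using bound nn W B B_def by linarith
      have lose': "\<not> parity True (cap_prio pr) u" if "infpath C u" "u 0 = (q, D)" for u
        using lose[of u] that q by simp
      have "\<exists>a y f. a \<in> X - P \<and> (a, y) \<in> E \<and> y \<notin> X \<and> D - D' - W \<le> f \<and> f \<le> D \<and> ((q, D), (y, f)) \<in> C\<^sup>*"
        by (rule transfer_run[OF XD X(2,3) D' c order_refl qX _ order_refl lose']) auto
      then obtain a y f where y: "(a, y) \<in> E" "y \<notin> X" "D - D' - W \<le> f" "f \<le> D" "((q, D), (y, f)) \<in> C\<^sup>*"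
        by blast
      have "y \<in> A" using y(1,2) X(1) arena_succ[OF E] by blast
      then obtain z f' where "z \<in> T" "B \<le> f'" "f' \<le> D" "((y, f), (z, f')) \<in> C\<^sup>*"
        using from_A y(3,4) by blast
      then show ?thesis using rtrancl_trans[OF y(5)] by blast
    qed
  qed
  have from_T: "\<exists>q. ((z, f), (q, D)) \<in> C\<^sup>+"
    if z: "z \<in> T" "B \<le> f" "f \<le> D" "((v0, D), (z, f)) \<in> C\<^sup>*" for z f
  proof -
    have zD: "z \<in> Domain E" using z(1) T by blast
    have f0: "0 \<le> f" using z(2) B by linarith
    define y where "y = (if z \<in> P then s z else fst (t (z, f)))"
    have st: "(z, y) \<in> E" "((z, f), (y, cap_step D w z f)) \<in> C"
      using C_step[OF zD f0 z(3), of y] s(1) zD by (auto simp: y_def positional_def)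
    have low: "int ?n * W \<le> cap_step D w z f"
      using z(2,3) Bn W by (intro cap_step_ge[OF zD]) auto
    have "\<exists>q. ((y, cap_step D w z f), (q, D)) \<in> C\<^sup>*"
    proof (rule good_for_energy_run[OF s arena_succ[OF E st(1)] low cap_step_bounds(2)[OF D]])
      show "\<not> parity True (cap_prio pr) u" if "infpath C u" "u 0 = (y, cap_step D w z f)" for u
        using lose[of u] that rtrancl_into_rtrancl[OF z(4) st(2)] by simp
    qed
    then show ?thesis using rtrancl_into_trancl2[OF st(2)] by blast
  qed
  define Z where "Z = {(z, f). z \<in> T \<and> B \<le> f \<and> f \<le> D \<and> ((v0, D), (z, f)) \<in> C\<^sup>*}"
  have to_Z: "\<exists>c \<in> Z. ((q, D), c) \<in> C\<^sup>*" if q: "((v0, D), (q, D)) \<in> C\<^sup>*" for q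
    using to_T[OF q] rtrancl_trans[OF q] unfolding Z_def by blast
  obtain c0 where c0: "c0 \<in> Z" using to_Z[of v0] by blast
  have "\<exists>c' \<in> Z. (c, c') \<in> C\<^sup>+" if c: "c \<in> Z" for c
  proof -
    obtain z f where zf: "c = (z, f)" "z \<in> T" "B \<le> f" "f \<le> D" "((v0, D), (z, f)) \<in> C\<^sup>*"
      using c by (auto simp: Z_def)
    obtain q where q: "((z, f), (q, D)) \<in> C\<^sup>+" using from_T[OF zf(2-5)] by blast
    have "((v0, D), (q, D)) \<in> C\<^sup>*" using zf(5) trancl_into_rtrancl[OF q] by (rule rtrancl_trans)
    then obtain c' where "c' \<in> Z" "((q, D), c') \<in> C\<^sup>*" using to_Z by blast
    then show ?thesis using trancl_rtrancl_trancl[OF q] zf(1) by blast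
  qed
  then obtain u where u: "infpath C u" "u 0 = c0" "\<exists>\<^sub>\<infinity>n. u n \<in> Z"
    using frequent_path[of Z C c0] c0 by metis
  have uK: "infpath (cap_edges E D w) u" using u(1) by (simp add: C_def infpath_conform)
  \<comment> \<open>Nothing is known of the levels between visits of \<open>Z\<close>, but level
    \<open>- 1\<close> is absorbing and the levels in \<open>Z\<close> are non-negative.\<close>
  have pos: "0 \<le> snd (u n)" for n
  proof (rule ccontr)
    assume "\<not> 0 \<le> snd (u n)"
    moreover obtain m where "n \<le> m" "u m \<in> Z" using u(3) by (auto simp: INFM_nat_le)
    ultimately show False using cap_edges_sunk[OF uK, of n m] B by (auto simp: Z_def)
  qed
  have xD: "fst (u n) \<in> Domain E" for n using CD[OF infpathD[OF u(1), of n]] by (auto simp: mem_Times_iff)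
  have prio: "cap_prio pr (u n) = pr (fst (u n))" for n using pos[of n] by (simp add: cap_prio_def)
  have "parity (even p) (cap_prio pr) u"
  proof (rule parity_min_often)
    show "p \<le> cap_prio pr (u n)" for n
      unfolding prio p using xD arena_finite[OF E] by (intro Min_le) auto
    show "\<exists>\<^sub>\<infinity>n. cap_prio pr (u n) = p"
      using u(3) by (rule INFM_mono) (auto simp: prio Z_def T)
  qed
  moreover have "((v0, D), u 0) \<in> C\<^sup>*" using u(2) c0 by (auto simp: Z_def)
  ultimately show False using lose u(1) p(2) by simp
qed

text \<open>Play is driven through \<open>A\<close> into \<open>T\<close>, where the strategy for
  \<open>T\<close> takes over with energy at least its cap \<open>D1\<close>. By
  \<open>transfer_run\<close> the opponent would have to leave \<open>T\<close>, and no edge allows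
  this.\<close>

lemma (in capped_game) cap_unbeaten_odd:
  assumes v0: "v0 \<in> Domain E"
    and T: "T \<subseteq> Domain E" "Domain (Restr E T) = T" "arena (Restr E T)"
      "\<And>v y. v \<in> T \<Longrightarrow> v \<notin> P \<Longrightarrow> (v, y) \<in> E \<Longrightarrow> y \<in> T"
    and A: "A \<subseteq> Domain E" "\<And>v. v \<in> A \<Longrightarrow> r v \<le> card (A - T)"
      "\<And>v. v \<in> A - T \<Longrightarrow> v \<in> P \<Longrightarrow> \<exists>y \<in> A. (v, y) \<in> E \<and> r y < r v"
      "\<And>v y. v \<in> A - T \<Longrightarrow> v \<notin> P \<Longrightarrow> (v, y) \<in> E \<Longrightarrow> y \<in> A \<and> r y < r v"
    and X: "X = Domain E - A" "Domain (Restr E X) = X" "arena (Restr E X)"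
    and D': "0 \<le> D'" "cap_unbeaten (Restr E X) P w pr D'"
    and D1: "0 \<le> D1" "cap_unbeaten (Restr E T) P w pr D1"
    and bound: "D' + W + int (card (A - T)) * W + D1 \<le> D"
  shows "\<not> avoids (cap_edges E D w) (- lift_player P) (parity True (cap_prio pr)) t (v0, D)"
proof
  assume av: "avoids (cap_edges E D w) (- lift_player P) (parity True (cap_prio pr)) t (v0, D)"
  have lose: "\<not> parity True (cap_prio pr) u" if "((v0, D), u 0) \<in> C\<^sup>*" "infpath C u" for u
    by (rule avoids_C[OF tail_closed_parity av that])
  have nn: "0 \<le> int (card (A - T)) * W" using W by auto
  have from_A: "\<exists>z f. z \<in> T \<and> D1 \<le> f \<and> f \<le> D \<and> ((y, f'), (z, f)) \<in> C\<^sup>*"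
    if y: "y \<in> A" "D - D' - W \<le> f'" "f' \<le> D" for y f'
  proof (rule attractor_run[OF A(1) A(3,4) D1(1) y(1) _ y(3)])
    have "int (r y) * W \<le> int (card (A - T)) * W" using A(2)[OF y(1)] W by (intro mult_right_mono) auto
    then show "int (r y) * W + D1 \<le> f'" using bound y(2) by linarith
  qed auto
  have "\<exists>z f. z \<in> T \<and> D1 \<le> f \<and> f \<le> D \<and> ((v0, D), (z, f)) \<in> C\<^sup>*"
  proof (cases "v0 \<in> A")
    case True
    then show ?thesis using from_A[of v0 D] D' W by auto
  next
    case False
    then have vX: "v0 \<in> X" using v0 X(1) by blast
    have XD: "X \<subseteq> Domain E" using X(1) by blast
    have c: "0 \<le> D - D'" using bound nn W D1 by linarith
    have lose': "\<not> parity True (cap_prio pr) u" if "infpath C u" "u 0 = (v0, D)" for u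
      using lose[of u] that by simp
    have "\<exists>a y f. a \<in> X - P \<and> (a, y) \<in> E \<and> y \<notin> X \<and> D - D' - W \<le> f \<and> f \<le> D \<and> ((v0, D), (y, f)) \<in> C\<^sup>*"
      by (rule transfer_run[OF XD X(2,3) D' c order_refl vX _ order_refl lose']) auto
    then obtain a y f where y: "(a, y) \<in> E" "y \<notin> X" "D - D' - W \<le> f" "f \<le> D" "((v0, D), (y, f)) \<in> C\<^sup>*"
      by blast
    have "y \<in> A" using y(1,2) X(1) arena_succ[OF E] by blast
    then obtain z f' where "z \<in> T" "D1 \<le> f'" "f' \<le> D" "((y, f), (z, f')) \<in> C\<^sup>*"
      using from_A y(3,4) by blast
    then show ?thesis using rtrancl_trans[OF y(5)] by blast
  qed
  then obtain z f where z: "z \<in> T" "D1 \<le> f" "f \<le> D" "((v0, D), (z, f)) \<in> C\<^sup>*" by blast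
  have c: "0 \<le> D - D1" using z by linarith
  have lose': "\<not> parity True (cap_prio pr) u" if "infpath C u" "u 0 = (z, f)" for u
    using lose[of u] that z(4) by simp
  have "\<exists>a y f'. a \<in> T - P \<and> (a, y) \<in> E \<and> y \<notin> T \<and> 0 - W \<le> f' \<and> f' \<le> D \<and> ((z, f), (y, f')) \<in> C\<^sup>*"
    by (rule transfer_run[OF T(1-3) D1 order_refl c z(1) _ z(3) lose']) (use z(2) in auto)
  then obtain a y where "a \<in> T - P" "(a, y) \<in> E" "y \<notin> T" by blast
  then show False using T(4) by blast
qed

section \<open>The bound on the energy cap\<close>

text \<open>\<open>t\<close> is a uniformly best opponent strategy and \<open>X\<close> the set of
  vertices it does not refute. An opponent move from \<open>X\<close> to a refuted vertex could be
  built into \<open>t\<close> and would refute its source as well; a vertex of \<open>P\<close> all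
  of whose successors are refuted is refuted itself.\<close>

lemma unbeaten_region:
  assumes E: "arena E"
  obtains t X where "positional E (- P) t" "X = {v \<in> Domain E. \<not> avoids E (- P) (winning_play w pr) t v}"
    "\<And>v t'. v \<in> X \<Longrightarrow> positional E (- P) t' \<Longrightarrow> \<not> avoids E (- P) (winning_play w pr) t' v"
    "Domain (Restr E X) = X" "arena (Restr E X)" "unbeaten (Restr E X) P w pr"
    "\<And>v y. v \<in> X \<Longrightarrow> v \<notin> P \<Longrightarrow> (v, y) \<in> E \<Longrightarrow> y \<in> X"
proof -
  let ?L = "winning_play w pr"
  have finE: "finite E" using E by (simp add: arena_def)
  obtain t0 where t0: "positional E (- P) t0"
    and best: "\<And>v t'. v \<in> Domain E \<Longrightarrow> positional E (- P) t' \<Longrightarrow> avoids E (- P) ?L t' v \<Longrightarrow>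
      avoids E (- P) ?L t0 v"
    by (rule uniform_avoids[OF E tail_closed_winning_play, of "- P" w pr]) blast
  let ?lost = "avoids E (- P) ?L t0"
  define X where "X = {v \<in> Domain E. \<not> ?lost v}"
  have tE: "(v, t0 v) \<in> E" if "v \<in> Domain E" "v \<notin> P" for v
    using t0 that unfolding positional_def by blast
  \<comment> \<open>Agreement with \<open>t0\<close> is required only at refuted vertices from
    \<open>k\<close> on, because the play never leaves them again. So strategies that differ from
    \<open>t0\<close> elsewhere are covered.\<close>
  have lost_path: "\<not> ?L u" if u: "infpath E u" and k: "?lost (u k)"
    and f: "\<And>n. k \<le> n \<Longrightarrow> ?lost (u n) \<Longrightarrow> u n \<notin> P \<Longrightarrow> u (Suc n) = t0 (u n)" for u k
  proof -
    have all: "?lost (u (n + k))" for n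
    proof (induction n)
      case (Suc n)
      have "?lost (u (Suc (n + k)))"
      proof (rule avoids_step[OF tail_closed_winning_play Suc])
        show "(u (n + k), u (Suc (n + k))) \<in> E" by (rule infpathD[OF u])
        show "u (Suc (n + k)) = t0 (u (n + k))" if "u (n + k) \<in> - P"
          using f[of "n + k"] Suc that by simp
      qed
      then show ?case by simp
    qed (simp add: k)
    have "follows (- P) t0 (\<lambda>n. u (n + k))"
      unfolding follows_def
    proof (intro allI impI)
      fix n assume "u (n + k) \<in> - P"
      then show "u (Suc n + k) = t0 (u (n + k))" using f[of "n + k"] all[of n] by simp
    qed
    then have "\<not> ?L (\<lambda>n. u (n + k))"
      using avoidsD[OF k infpath_shift[OF u, of k]] by simp
    then show ?thesis using tail_closedD[OF tail_closed_winning_play[of w pr], of u k] by simp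
  qed
  have XD: "X \<subseteq> Domain E" by (auto simp: X_def)
  have not_best: "\<not> avoids E (- P) ?L t' v" if "v \<in> X" "positional E (- P) t'" for v t'
    using best[of v t'] that by (auto simp: X_def)
  have Xclosed: "y \<in> X" if v: "v \<in> X" "v \<notin> P" "(v, y) \<in> E" for v y
  proof (rule ccontr)
    assume "y \<notin> X"
    have yD: "y \<in> Domain E" by (rule arena_succ[OF E v(3)])
    then have ly: "?lost y" using \<open>y \<notin> X\<close> by (simp add: X_def)
    define t' where "t' = t0(v := y)"
    have "positional E (- P) t'"
      unfolding positional_def using tE v by (auto simp: t'_def)
    then obtain u where u: "infpath E u" "u 0 = v" "follows (- P) t' u" "?L u"
      using not_best[OF v(1)] unfolding avoids_def by blast
    have "u 1 = y" using u(2,3) v(2) by (auto simp: follows_def t'_def)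
    then have "?lost (u 1)" using ly by simp
    with u(1) have "\<not> ?L u"
    proof (rule lost_path)
      fix n assume n: "?lost (u n)" "u n \<notin> P"
      have "u n \<noteq> v" using n(1) v(1) by (auto simp: X_def)
      then show "u (Suc n) = t0 (u n)" using u(3) n(2) by (simp add: follows_def t'_def)
    qed
    with u(4) show False by simp
  qed
  have Xsucc: "\<exists>y \<in> X. (v, y) \<in> E" if v: "v \<in> X" for v
  proof (cases "v \<in> P")
    case False
    obtain y where "(v, y) \<in> E" using v XD by blast
    then show ?thesis using Xclosed[OF v False] by blast
  next
    case True
    show ?thesis
    proof (rule ccontr)
      assume no: "\<not> (\<exists>y \<in> X. (v, y) \<in> E)"
      obtain u where u: "infpath E u" "u 0 = v" "follows (- P) t0 u" "?L u"
        using not_best[OF v t0] unfolding avoids_def by blast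
      have "(v, u 1) \<in> E" using infpathD[OF u(1), of 0] u(2) by simp
      then have "?lost (u 1)" using no arena_succ[OF E] unfolding X_def by blast
      with u(1) have "\<not> ?L u" by (rule lost_path) (use u(3) in \<open>simp add: follows_def\<close>)
      with u(4) show False by simp
    qed
  qed
  have Xa: "Domain (Restr E X) = X" "arena (Restr E X)" by (rule subarena[OF finE Xsucc], assumption)+
  have ub: "unbeaten (Restr E X) P w pr"
    unfolding unbeaten_def
  proof (intro allI impI notI)
    fix t v assume tv: "positional (Restr E X) (- P) t \<and> v \<in> Domain (Restr E X)"
      and av: "avoids (Restr E X) (- P) ?L t v"
    have v: "v \<in> X" using tv Xa(1) by blast
    have tX: "(x, t x) \<in> Restr E X" if "x \<in> X" "x \<notin> P" for x
      using tv that Xa(1) unfolding positional_def by blast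
    define t' where "t' x = (if x \<in> X then t x else t0 x)" for x
    have "positional E (- P) t'"
      unfolding positional_def using tX tE by (auto simp: t'_def)
    then obtain u where u: "infpath E u" "u 0 = v" "follows (- P) t' u" "?L u"
      using not_best[OF v] unfolding avoids_def by blast
    have uX: "u n \<in> X" for n
    proof (rule ccontr)
      assume "u n \<notin> X"
      moreover have "u n \<in> Domain E" by (rule infpath_Domain[OF u(1)])
      ultimately have "?lost (u n)" by (simp add: X_def)
      with u(1) have "\<not> ?L u"
      proof (rule lost_path)
        fix m assume m: "?lost (u m)" "u m \<notin> P"
        then show "u (Suc m) = t0 (u m)" using u(3) by (simp add: follows_def t'_def X_def)
      qed
      with u(4) show False by simp
    qed
    have "follows (- P) t u" using u(3) uX by (simp add: follows_def t'_def)
    moreover have "infpath (Restr E X) u" using u(1) uX by (simp add: infpath_Restr)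
    ultimately show False using avoidsD[OF av, of u] u(2,4) by simp
  qed
  show ?thesis by (rule that[OF t0 X_def _ Xa ub]) (use not_best Xclosed in blast)+
qed

text \<open>The odd case of Zielonka's argument. If \<open>X\<close> were empty, the opponent would
  refute everything inside \<open>Y\<close> and would return from \<open>A\<close> to the odd
  minimum. The two strategies live on disjoint sets and form one positional strategy: its plays
  either end up in \<open>Y\<close> and are lost there, or see priority \<open>p\<close> infinitely
  often.\<close>

lemma unbeaten_region_odd:
  assumes E: "arena E" and win: "unbeaten E P w pr" and ne: "Domain E \<noteq> {}"
    and p: "p = Min (pr ` Domain E)" "odd p"
  obtains X where "X \<subseteq> Domain E" "X \<noteq> {}" "p \<notin> pr ` X" "Domain (Restr E X) = X"
    "arena (Restr E X)" "unbeaten (Restr E X) P w pr"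
    "\<And>v y. v \<in> X \<Longrightarrow> v \<notin> P \<Longrightarrow> (v, y) \<in> E \<Longrightarrow> y \<in> X"
proof -
  let ?L = "winning_play w pr"
  have finE: "finite E" using E by (simp add: arena_def)
  define T where "T = {v \<in> Domain E. pr v = p}"
  have TD: "T \<subseteq> Domain E" by (auto simp: T_def)
  obtain A r where A: "T \<subseteq> A" "A \<subseteq> Domain E" and "\<And>v. v \<in> A \<Longrightarrow> r v \<le> card (A - T)"
    and own: "\<And>v. v \<in> A - T \<Longrightarrow> v \<in> - P \<Longrightarrow> \<exists>y \<in> A. (v, y) \<in> E \<and> r y < r v"
    and opp: "\<And>v y. v \<in> A - T \<Longrightarrow> v \<notin> - P \<Longrightarrow> (v, y) \<in> E \<Longrightarrow> y \<in> A \<and> r y < r v"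
    and out: "\<And>v y. v \<in> Domain E - A \<Longrightarrow> v \<in> - P \<Longrightarrow> (v, y) \<in> E \<Longrightarrow> y \<notin> A"
    and out': "\<And>v. v \<in> Domain E - A \<Longrightarrow> v \<notin> - P \<Longrightarrow> \<exists>y. (v, y) \<in> E \<and> y \<notin> A"
    by (rule attractor[OF E TD, of "- P"]) blast
  define Y where "Y = Domain E - A"
  have Ysucc: "\<exists>y \<in> Y. (v, y) \<in> E" if vY: "v \<in> Y" for v
  proof (cases "v \<in> P")
    case True
    then obtain y where "(v, y) \<in> E" "y \<notin> A" using out'[of v] vY by (auto simp: Y_def)
    then show ?thesis using arena_succ[OF E] by (auto simp: Y_def)
  next
    case False
    obtain y where "(v, y) \<in> E" using vY by (auto simp: Y_def)
    then show ?thesis using out[of v y] False vY arena_succ[OF E] by (auto simp: Y_def)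
  qed
  have Y: "Domain (Restr E Y) = Y" "arena (Restr E Y)" by (rule subarena[OF finE Ysucc], assumption)+
  have Yclosed: "y \<in> Y" if "v \<in> Y" "v \<notin> P" "(v, y) \<in> E" for v y
    using out[of v y] that arena_succ[OF E] by (auto simp: Y_def)
  obtain tY X where tY: "positional (Restr E Y) (- P) tY"
    and X_def: "X = {v \<in> Y. \<not> avoids (Restr E Y) (- P) ?L tY v}"
    and "\<And>v t'. v \<in> X \<Longrightarrow> positional (Restr E Y) (- P) t' \<Longrightarrow> \<not> avoids (Restr E Y) (- P) ?L t' v"
    and X: "Domain (Restr (Restr E Y) X) = X" "arena (Restr (Restr E Y) X)" "unbeaten (Restr (Restr E Y) X) P w pr"
      "\<And>v y. v \<in> X \<Longrightarrow> v \<notin> P \<Longrightarrow> (v, y) \<in> Restr E Y \<Longrightarrow> y \<in> X"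
    by (rule unbeaten_region[OF Y(2), of P w pr, unfolded Y(1)]) blast
  let ?lost = "avoids (Restr E Y) (- P) ?L tY"
  have tYY: "(v, tY v) \<in> Restr E Y" if "v \<in> Y" "v \<notin> P" for v
    using tY that Y(1) unfolding positional_def by blast
  have "X \<noteq> {}"
  proof
    assume "X = {}"
    then have lost: "?lost v" if "v \<in> Y" for v using that by (auto simp: X_def)
    obtain nx where nx: "\<And>v. v \<in> A - T \<Longrightarrow> v \<notin> P \<Longrightarrow> nx v \<in> A \<and> (v, nx v) \<in> E \<and> r (nx v) < r v"
      using own by (metis ComplI)
    define t where "t v = (if v \<in> Y then tY v else if v \<in> A - T then nx v else SOME y. (v, y) \<in> E)" for v
    have some: "(v, SOME y. (v, y) \<in> E) \<in> E" if "v \<in> Domain E" for v using that by (auto intro: someI)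
    have "positional E (- P) t"
      unfolding positional_def t_def using tYY nx some by auto
    moreover obtain v0 where "v0 \<in> Domain E" using ne by blast
    ultimately have "\<not> avoids E (- P) ?L t v0" using win unfolding unbeaten_def by blast
    then obtain u where u: "infpath E u" "follows (- P) t u" "?L u" unfolding avoids_def by blast
    have uD: "u n \<in> Domain E" for n by (rule infpath_Domain[OF u(1)])
    have uP: "u (Suc n) = t (u n)" if "u n \<notin> P" for n using u(2) that by (simp add: follows_def)
    show False
    proof (cases "\<exists>k. \<forall>n \<ge> k. u n \<in> Y")
      case True
      then obtain k where k: "\<And>n. k \<le> n \<Longrightarrow> u n \<in> Y" by blast
      define u' where "u' = (\<lambda>n. u (n + k))"
      have "infpath (Restr E Y) u'" unfolding infpath_Restr u'_def using infpath_shift[OF u(1)] k by simp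
      moreover have "?lost (u' 0)" using lost k by (simp add: u'_def)
      moreover have "follows (- P) tY u'"
        unfolding follows_def
      proof (intro allI impI)
        fix n assume "u' n \<in> - P"
        then show "u' (Suc n) = tY (u' n)" using uP[of "n + k"] k[of "n + k"] by (simp add: u'_def t_def)
      qed
      ultimately have "\<not> ?L u'" using avoidsD[of "Restr E Y" "- P" ?L tY "u' 0" u'] by blast
      then show False
        using u(3) tail_closedD[OF tail_closed_winning_play[of w pr], of u k] by (simp add: u'_def)
    next
      case False
      have reach: "\<exists>m \<ge> n. u m \<in> T" if "u n \<in> A" for n
        using that
      proof (induction "r (u n)" arbitrary: n rule: less_induct)
        case less
        show ?case
        proof (cases "u n \<in> T")
          case False
          then have n: "u n \<in> A - T" using less.prems by simp
          have "u (Suc n) \<in> A \<and> r (u (Suc n)) < r (u n)"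
          proof (cases "u n \<in> P")
            case True
            then show ?thesis using opp[OF n] infpathD[OF u(1), of n] by blast
          next
            case False
            then have "u (Suc n) = nx (u n)" using uP[OF False] n by (simp add: t_def Y_def)
            then show ?thesis using nx[OF n False] by simp
          qed
          then obtain m where "Suc n \<le> m" "u m \<in> T" using less.hyps by blast
          then show ?thesis by (intro exI[of _ m]) simp
        qed blast
      qed
      have "\<exists>m \<ge> n. u m \<in> T" for n
      proof -
        obtain k where k: "n \<le> k" "u k \<notin> Y" using False by blast
        then have "u k \<in> A" using uD[of k] by (simp add: Y_def)
        then obtain m where "k \<le> m" "u m \<in> T" using reach by blast
        then show ?thesis using k(1) by (intro exI[of _ m]) simp
      qed
      then have "\<exists>\<^sub>\<infinity>n. u n \<in> T" by (simp add: INFM_nat_le)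
      then have "\<exists>\<^sub>\<infinity>n. pr (u n) = p" by (rule INFM_mono) (simp add: T_def)
      moreover have "p \<le> pr (u n)" for n
        unfolding p using uD[of n] arena_finite[OF E] by (intro Min_le) auto
      ultimately have "parity (even p) pr u" by (intro parity_min_often)
      then show False using u(3) parity_disjoint[of pr u] p(2) by simp
    qed
  qed
  have XY: "X \<subseteq> Y" by (auto simp: X_def)
  then have eq: "Restr (Restr E Y) X = Restr E X" by auto
  have "p \<notin> pr ` X" using A(1) XY unfolding Y_def T_def by blast
  moreover have "X \<subseteq> Domain E" using XY by (auto simp: Y_def)
  moreover have "y \<in> X" if "v \<in> X" "v \<notin> P" "(v, y) \<in> E" for v y
    using X(4)[of v y] Yclosed[of v y] that XY by blast
  ultimately show ?thesis using that[of X] \<open>X \<noteq> {}\<close> X(1-3) unfolding eq by blast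
qed

text \<open>In the even case \<open>X\<close> misses the priority \<open>p\<close>, in the odd case
  \<open>T\<close> does. One priority fewer on \<open>k\<close> vertices frees
  \<open>3 * k * W\<close>, and every vertex outside the subarenas frees at least
  \<open>3 * W\<close>; these gains pay for the attractor, the exit from \<open>X\<close> and the
  recovery of the energy.\<close>

theorem cap_unbeaten_bound:
  assumes "arena E" "unbeaten E P w pr" and W: "1 \<le> W"
    and "\<And>v. v \<in> Domain E \<Longrightarrow> \<bar>w v\<bar> \<le> W"
  shows "cap_unbeaten E P w pr (3 * int (card (pr ` Domain E) * card (Domain E)) * W)"
  using assms(1,2,4)
proof (induction "card (Domain E)" arbitrary: E rule: less_induct)
  case less
  note E = \<open>arena E\<close> and win = \<open>unbeaten E P w pr\<close>
  define bd where "bd X = 3 * int (card (pr ` X) * card X) * W" for X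
  have bd0: "0 \<le> bd X" for X using W by (simp add: bd_def)
  have IH: "cap_unbeaten (Restr E X) P w pr (bd X)"
    if "X \<subset> Domain E" "Domain (Restr E X) = X" "arena (Restr E X)" "unbeaten (Restr E X) P w pr" for X
  proof -
    have "card (Domain (Restr E X)) < card (Domain E)"
      unfolding that(2) by (rule psubset_card_mono[OF arena_finite[OF E] that(1)])
    moreover have "\<bar>w v\<bar> \<le> W" if "v \<in> Domain (Restr E X)" for v using less.prems(3) that by blast
    ultimately have "cap_unbeaten (Restr E X) P w pr (bd (Domain (Restr E X)))"
      unfolding bd_def using less.hyps that(3,4) by blast
    then show ?thesis unfolding that(2) .
  qed
  have scale: "bd X + bd Y + int k * W \<le> bd (Domain E)"
    if "3 * (card (pr ` X) * card X) + 3 * (card (pr ` Y) * card Y) + k \<le> 3 * (card (pr ` Domain E) * card (Domain E))"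
    for X Y k
  proof -
    have "int (3 * (card (pr ` X) * card X) + 3 * (card (pr ` Y) * card Y) + k) * W \<le>
        int (3 * (card (pr ` Domain E) * card (Domain E))) * W"
      using that W by (intro mult_right_mono) (simp_all only: of_nat_le_iff)
    then show ?thesis by (simp add: bd_def algebra_simps)
  qed
  have fin: "finite (Domain E)" by (rule arena_finite[OF E])
  show ?case
    unfolding cap_unbeaten_def bd_def[symmetric]
  proof (intro allI impI)
    fix t v assume tv: "positional (cap_edges E (bd (Domain E)) w) (- lift_player P) t \<and> v \<in> Domain E"
    interpret capped_game E P w pr "bd (Domain E)" W t
      by unfold_locales (use E bd0 W less.prems(3) tv in auto)
    let ?n = "card (Domain E)" and ?d = "card (pr ` Domain E)"
    define p where "p = Min (pr ` Domain E)"
    have "p \<in> pr ` Domain E" unfolding p_def using tv fin by (intro Min_in) auto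
    then obtain vp where vp: "vp \<in> Domain E" "pr vp = p" by blast
    then have ne: "Domain E \<noteq> {}" by blast
    show "\<not> avoids (cap_edges E (bd (Domain E)) w) (- lift_player P) (parity True (cap_prio pr)) t (v, bd (Domain E))"
    proof (cases "even p")
      case True
      define T where "T = {v \<in> Domain E. pr v = p}"
      have TD: "T \<subseteq> Domain E" by (auto simp: T_def)
      obtain A r where A: "T \<subseteq> A" "A \<subseteq> Domain E" "\<And>v. v \<in> A \<Longrightarrow> r v \<le> card (A - T)"
        and own: "\<And>v. v \<in> A - T \<Longrightarrow> v \<in> P \<Longrightarrow> \<exists>y \<in> A. (v, y) \<in> E \<and> r y < r v"
        and opp: "\<And>v y. v \<in> A - T \<Longrightarrow> v \<notin> P \<Longrightarrow> (v, y) \<in> E \<Longrightarrow> y \<in> A \<and> r y < r v"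
        and out: "\<And>v y. v \<in> Domain E - A \<Longrightarrow> v \<in> P \<Longrightarrow> (v, y) \<in> E \<Longrightarrow> y \<notin> A"
        and out': "\<And>v. v \<in> Domain E - A \<Longrightarrow> v \<notin> P \<Longrightarrow> \<exists>y. (v, y) \<in> E \<and> y \<notin> A"
        by (rule attractor[OF E TD, of P]) blast
      define X where "X = Domain E - A"
      have XD: "X \<subseteq> Domain E" by (auto simp: X_def)
      have 1: "y \<in> X" if "v \<in> X" "v \<in> P" "(v, y) \<in> E" for v y
        using out[of v y] that arena_succ[OF E] by (auto simp: X_def)
      have 2: "\<exists>y \<in> X. (v, y) \<in> E" if "v \<in> X" "v \<notin> P" for v
        using out'[of v] that arena_succ[OF E] by (auto simp: X_def)
      have X: "Domain (Restr E X) = X" "arena (Restr E X)" "unbeaten (Restr E X) P w pr"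
        by (rule unbeaten_trap[OF E win XD]; use 1 2 in blast)+
      have vpT: "vp \<in> T" using vp by (simp add: T_def)
      then have psub: "X \<subset> Domain E" using A(1) vp by (auto simp: X_def)
      have cap: "cap_unbeaten (Restr E X) P w pr (bd X)" by (rule IH[OF psub X])
      have finA: "finite A" using A(2) fin by (rule finite_subset)
      define a x where "a = card A" and "x = card X"
      have nax: "?n = a + x"
        using A(2) finA fin by (simp add: a_def x_def X_def card_Diff_subset card_mono)
      have "card (A - T) < card A"
        using finA vpT A(1) by (intro psubset_card_mono) auto
      then have cAT: "Suc (card (A - T)) \<le> a" by (simp add: a_def)
      have "p \<notin> pr ` X" using A(1) by (auto simp: X_def T_def)
      then have d: "Suc (card (pr ` X)) \<le> ?d"
        using priorities_below[OF fin XD vp(1), of pr] vp(2) by simp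
      have "(card (pr ` X) + 1) * x \<le> ?d * x" using d by (intro mult_right_mono) auto
      then have "card (pr ` X) * x + x \<le> ?d * x" by simp
      moreover have "a \<le> ?d * a" using d by simp
      moreover have "?d * ?n = ?d * a + ?d * x" unfolding nax by (simp add: distrib_left)
      \<comment> \<open>The factor 3 arises here: the costs are at most \<open>2 * a + x + 1\<close>
        with \<open>1 \<le> a\<close>, and passing to \<open>X\<close> frees at least
        \<open>3 * a + 3 * x\<close>.\<close>
      ultimately have "3 * (card (pr ` X) * x) + (1 + card (A - T) + Suc ?n) \<le> 3 * (?d * ?n)"
        using cAT nax by linarith
      \<comment> \<open>\<open>bd {}\<close> is zero and fills the slot of the second
        subarena.\<close>
      then have "bd X + bd {} + int (1 + card (A - T) + Suc ?n) * W \<le> bd (Domain E)"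
        by (intro scale) (simp add: x_def)
      then have bound: "bd X + W + int (card (A - T)) * W + int (Suc ?n) * W \<le> bd (Domain E)"
        by (simp add: algebra_simps bd_def)
      show ?thesis
      proof (rule cap_unbeaten_even[OF win _ p_def True T_def A own opp X_def X(1,2) bd0 cap bound])
        show "v \<in> Domain E" using tv by blast
      qed
    next
      case False
      obtain T where T: "T \<subseteq> Domain E" "T \<noteq> {}" "p \<notin> pr ` T" "Domain (Restr E T) = T"
          "arena (Restr E T)" "unbeaten (Restr E T) P w pr"
        and Tclosed: "\<And>v y. v \<in> T \<Longrightarrow> v \<notin> P \<Longrightarrow> (v, y) \<in> E \<Longrightarrow> y \<in> T"
        by (rule unbeaten_region_odd[OF E win ne p_def False]) blast
      obtain A r where A: "T \<subseteq> A" "A \<subseteq> Domain E" "\<And>v. v \<in> A \<Longrightarrow> r v \<le> card (A - T)"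
        and own: "\<And>v. v \<in> A - T \<Longrightarrow> v \<in> P \<Longrightarrow> \<exists>y \<in> A. (v, y) \<in> E \<and> r y < r v"
        and opp: "\<And>v y. v \<in> A - T \<Longrightarrow> v \<notin> P \<Longrightarrow> (v, y) \<in> E \<Longrightarrow> y \<in> A \<and> r y < r v"
        and out: "\<And>v y. v \<in> Domain E - A \<Longrightarrow> v \<in> P \<Longrightarrow> (v, y) \<in> E \<Longrightarrow> y \<notin> A"
        and out': "\<And>v. v \<in> Domain E - A \<Longrightarrow> v \<notin> P \<Longrightarrow> \<exists>y. (v, y) \<in> E \<and> y \<notin> A"
        by (rule attractor[OF E T(1), of P]) blast
      define X where "X = Domain E - A"
      have XD: "X \<subseteq> Domain E" by (auto simp: X_def)
      have 1: "y \<in> X" if "v \<in> X" "v \<in> P" "(v, y) \<in> E" for v y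
        using out[of v y] that arena_succ[OF E] by (auto simp: X_def)
      have 2: "\<exists>y \<in> X. (v, y) \<in> E" if "v \<in> X" "v \<notin> P" for v
        using out'[of v] that arena_succ[OF E] by (auto simp: X_def)
      have X: "Domain (Restr E X) = X" "arena (Restr E X)" "unbeaten (Restr E X) P w pr"
        by (rule unbeaten_trap[OF E win XD]; use 1 2 in blast)+
      have psub: "X \<subset> Domain E" using A(1) T(1,2) by (auto simp: X_def)
      have psubT: "T \<subset> Domain E" using T(1,3) vp by auto
      have cap: "cap_unbeaten (Restr E X) P w pr (bd X)" by (rule IH[OF psub X])
      have capT: "cap_unbeaten (Restr E T) P w pr (bd T)" by (rule IH[OF psubT T(4-6)])
      have finA: "finite A" using A(2) fin by (rule finite_subset)
      have finT: "finite T" using T(1) fin by (rule finite_subset)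
      define b x y where "b = card (A - T)" and "x = card X" and "y = card T"
      have "?n = card A + x"
        using A(2) finA fin by (simp add: x_def X_def card_Diff_subset card_mono)
      moreover have "card A = b + y"
        using A(1) finA finT by (simp add: b_def y_def card_Diff_subset card_mono)
      ultimately have n: "?n = x + b + y" by simp
      have y1: "1 \<le> y" using T(2) finT by (simp add: y_def Suc_le_eq card_gt_0_iff)
      have d: "Suc (card (pr ` T)) \<le> ?d"
        using priorities_below[OF fin T(1) vp(1), of pr] vp(2) T(3) by simp
      have "(card (pr ` T) + 1) * y \<le> ?d * y" using d by (intro mult_right_mono) auto
      then have "card (pr ` T) * y + y \<le> ?d * y" by simp
      moreover have "card (pr ` X) * x \<le> ?d * x"
        using XD fin by (intro mult_right_mono card_mono) auto
      moreover have "b \<le> ?d * b" using d by simp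
      moreover have "?d * ?n = ?d * x + ?d * b + ?d * y" unfolding n by (simp add: distrib_left)
      \<comment> \<open>\<open>X\<close> may still carry all priorities. The \<open>b\<close>
        attractor steps are paid by the vertices of \<open>A - T\<close>, and the exit from
        \<open>X\<close> by the \<open>3 * y\<close> that the missing priority frees on the
        non-empty \<open>T\<close>.\<close>
      ultimately have "3 * (card (pr ` X) * x) + 3 * (card (pr ` T) * y) + (1 + b) \<le> 3 * (?d * ?n)"
        using y1 by linarith
      then have "bd X + bd T + int (1 + b) * W \<le> bd (Domain E)"
        by (intro scale) (simp add: x_def y_def)
      then have bound: "bd X + W + int (card (A - T)) * W + bd T \<le> bd (Domain E)"
        by (simp add: algebra_simps b_def)
      show ?thesis
      proof (rule cap_unbeaten_odd[OF _ T(1,4,5) _ A(2,3) own opp X_def X(1,2) bd0 cap bd0 capT bound])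
        show "v \<in> Domain E" using tv by blast
        show "y \<in> T" if "v \<in> T" "v \<notin> P" "(v, y) \<in> E" for v y using Tclosed that by blast
      qed
    qed
  qed
qed

section \<open>Plays of the capped game and parity acceptance\<close>

text \<open>Cutting off energy only lowers the recorded level, so
  \<open>e n \<le> D + esum w u n\<close> as long as the level has not sunk. A strategy that avoids
  odd parity keeps \<open>e n\<close> non-negative, so the actual energy never falls below
  \<open>- D\<close>.\<close>

lemma cap_play:
  assumes E: "arena E" and D: "0 \<le> D"
    and s: "positional (cap_edges E D w) (lift_player P) s"
      "avoids (cap_edges E D w) (lift_player P) (parity False (cap_prio pr)) s (u 0, D)"
    and e: "e 0 = D" "\<And>n. e (Suc n) = cap_step D w (u n) (e n)"
    and u0: "u 0 \<in> Domain E"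
    and step: "\<And>n. u n \<in> Domain E \<Longrightarrow> 0 \<le> e n \<Longrightarrow> e n \<le> D \<Longrightarrow>
      (u n, u (Suc n)) \<in> E \<and> (u n \<in> P \<longrightarrow> u (Suc n) = fst (s (u n, e n)))"
  shows "parity True pr u" "- D \<le> esum w u n"
proof -
  let ?K = "cap_edges E D w" and ?z = "\<lambda>n. (u n, e n)"
  let ?av = "avoids ?K (lift_player P) (parity False (cap_prio pr)) s"
  have move: "(?z n, ?z (Suc n)) \<in> conform ?K (lift_player P) s"
    if n: "u n \<in> Domain E" "0 \<le> e n" "e n \<le> D" for n
  proof -
    note st = step[OF n]
    have edge: "(?z n, ?z (Suc n)) \<in> ?K" using st n e by (simp add: cap_edges_iff)
    have "?z (Suc n) = s (?z n)" if "?z n \<in> lift_player P"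
    proof -
      have "(?z n, s (?z n)) \<in> ?K" using s(1) that edge unfolding positional_def by blast
      then have "snd (s (?z n)) = e (Suc n)"
        using n e by (cases "s (?z n)") (auto simp: cap_edges_iff)
      moreover have "fst (s (?z n)) = u (Suc n)" using st that by simp
      ultimately show ?thesis by (metis prod.collapse)
    qed
    with edge show ?thesis by (simp add: conform_def)
  qed
  have inv: "u n \<in> Domain E \<and> 0 \<le> e n \<and> e n \<le> D \<and> ?av (?z n) \<and> e n \<le> D + esum w u n" for n
  proof (induction n)
    case 0
    then show ?case using u0 e D s(2) by simp
  next
    case (Suc n)
    then have n: "u n \<in> Domain E" "0 \<le> e n" "e n \<le> D" "?av (?z n)" "e n \<le> D + esum w u n" by auto
    have av: "?av (?z (Suc n))"
      by (rule avoids_reachable[OF tail_closed_parity n(4) r_into_rtrancl[OF move[OF n(1-3)]]])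
    have uS: "u (Suc n) \<in> Domain E" using step[OF n(1-3)] arena_succ[OF E] by blast
    have "e (Suc n) \<noteq> - 1" using cap_sunk[OF s(1) uS] av by auto
    then have pos: "0 \<le> e (Suc n)" using e(2)[of n] cap_step_bounds(1)[of D w "u n" "e n"] by simp
    moreover have "e (Suc n) \<le> D + esum w u (Suc n)"
      using pos n(5) e(2)[of n] unfolding cap_step_def esum_Suc by linarith
    moreover have "e (Suc n) \<le> D" unfolding e(2) by (rule cap_step_bounds(2)[OF D])
    ultimately show ?case using av uS by blast
  qed
  show "- D \<le> esum w u n" using inv[of n] by linarith
  have "infpath (conform ?K (lift_player P) s) ?z"
    unfolding infpath_def using move inv by blast
  then have "\<not> parity False (cap_prio pr) ?z"
    using s(2) e(1) unfolding avoids_conform by (metis (no_types, lifting))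
  moreover have "cap_prio pr (?z n) = pr (u n)" for n using inv[of n] by (simp add: cap_prio_def)
  ultimately have "\<not> parity False pr u" by (simp add: parity_def)
  then show "parity True pr u"
    using parity_total[where u = u and pr = pr, OF arena_finite[OF E]] inv by blast
qed

text \<open>A period of non-negative weight keeps the energy bounded below, a negative one makes it
  fall linearly. This dichotomy fails for arbitrary plays and is what finite memory
  contributes.\<close>

lemma eventually_periodic_energy:
  assumes "0 < c" "\<And>n. m \<le> n \<Longrightarrow> x (n + c) = x n"
  shows "bounded_below w x \<or> lin_decreasing w x"
proof -
  define y where "y = (\<lambda>n. x (n + m))"
  have per: "y (n + c) = y n" for n
    using assms(2)[of "n + m"] by (simp add: y_def algebra_simps)
  have per_k: "y (n + k * c) = y n" for n k
  proof (induction k)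
    case (Suc k)
    then show ?case using per[of "n + k * c"] by (simp add: algebra_simps)
  qed simp
  define xs where "xs = map y [0..<c]"
  have xs: "xs \<noteq> []" using assms(1) by (simp add: xs_def)
  have "y = cycle_path xs"
  proof
    fix n
    have "y n = y (n mod c + (n div c) * c)" by simp
    also have "\<dots> = y (n mod c)" by (rule per_k)
    finally show "y n = cycle_path xs n" using assms(1) by (simp add: cycle_path_def xs_def)
  qed
  then have "bounded_below w y \<or> lin_decreasing w y"
    using bounded_below_cycle_path[OF xs, of w] lin_decreasing_cycle_path[OF xs, of w]
    by (cases "0 \<le> sum_list (map w xs)") auto
  moreover have "bounded_below w y = bounded_below w x"
    unfolding y_def by (rule tail_closedD[OF tail_closed_bounded_below])
  moreover have "lin_decreasing w y = lin_decreasing w x"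
    unfolding y_def by (rule tail_closedD[OF tail_closed_lin_decreasing])
  ultimately show ?thesis by blast
qed

text \<open>A path of the game graph shows every automaton state of the run twice, once for each
  player's move.\<close>

lemma parity_div2: "parity b f (\<lambda>n. x (n div 2)) \<longleftrightarrow> parity b f x"
proof -
  have inf: "(\<exists>\<^sub>\<infinity>n. Q (n div 2)) \<longleftrightarrow> (\<exists>\<^sub>\<infinity>n. Q n)" for Q :: "nat \<Rightarrow> bool"
    unfolding INFM_nat_le
  proof (intro iffI allI)
    fix m assume "\<forall>m. \<exists>n\<ge>m. Q (n div 2)"
    then obtain n where "2 * m \<le> n" "Q (n div 2)" by blast
    then show "\<exists>n\<ge>m. Q n" by (intro exI[of _ "n div 2"]) auto
  next
    fix m assume "\<forall>m. \<exists>n\<ge>m. Q n"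
    then obtain n where "m \<le> n" "Q n" by blast
    then show "\<exists>n\<ge>m. Q (n div 2)" by (intro exI[of _ "2 * n"]) auto
  qed
  have most: "(\<forall>\<^sub>\<infinity>n. Q (n div 2)) \<longleftrightarrow> (\<forall>\<^sub>\<infinity>n. Q n)" for Q :: "nat \<Rightarrow> bool"
    using inf[of "\<lambda>n. \<not> Q n"] unfolding frequently_def not_not by blast
  have "(\<exists>\<^sub>\<infinity>n. f (x (n div 2)) = p) \<longleftrightarrow> (\<exists>\<^sub>\<infinity>n. f (x n) = p)"
    "(\<forall>\<^sub>\<infinity>n. p \<le> f (x (n div 2))) \<longleftrightarrow> (\<forall>\<^sub>\<infinity>n. p \<le> f (x n))" for p
    by (rule inf[of "\<lambda>n. f (x n) = p"], rule most[of "\<lambda>n. p \<le> f (x n)"])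
  then show ?thesis unfolding parity_def by (intro ex_cong1 conj_cong refl)
qed

lemma accepts_iff_parity:
  assumes "finite Q" "\<And>n. run A u n \<in> Q"
  shows "accepts A u \<longleftrightarrow> parity True (prio A) (run A u)"
proof -
  let ?r = "run A u"
  define J where "J = {q. \<exists>\<^sub>\<infinity>n. ?r n = q}"
  have JQ: "J \<subseteq> Q"
  proof
    fix q assume "q \<in> J"
    then obtain n where "?r n = q" unfolding J_def by (auto dest: INFM_EX)
    then show "q \<in> Q" using assms(2)[of n] by simp
  qed
  then have finJ: "finite J" using assms(1) by (rule finite_subset)
  obtain q0 where "q0 \<in> Q" "True" "\<exists>\<^sub>\<infinity>n. ?r n = q0"
    by (rule finite_range_often[of Q ?r "\<lambda>_. True"]) (use assms in auto)
  then have "J \<noteq> {}" by (auto simp: J_def)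
  define p where "p = Min (prio A ` J)"
  have "p \<in> prio A ` J" unfolding p_def using finJ \<open>J \<noteq> {}\<close> by (intro Min_in) auto
  then obtain q where q: "q \<in> J" "prio A q = p" by blast
  have "\<exists>\<^sub>\<infinity>n. ?r n = q" using q(1) by (simp add: J_def)
  then have "\<exists>\<^sub>\<infinity>n. prio A (?r n) = p" by (rule INFM_mono) (simp add: q)
  moreover have "\<forall>\<^sub>\<infinity>n. p \<le> prio A (?r n)"
  proof -
    have "{n. ?r n \<notin> J} = (\<Union>q \<in> Q - J. {n. ?r n = q})" using assms(2) by auto
    moreover have "finite (\<Union>q \<in> Q - J. {n. ?r n = q})"
      using assms(1) by (auto simp: J_def INFM_iff_infinite)
    ultimately have "\<forall>\<^sub>\<infinity>n. ?r n \<in> J" by (simp add: MOST_iff_cofinite)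
    then show ?thesis by (rule MOST_mono) (use finJ in \<open>auto simp: p_def\<close>)
  qed
  ultimately have "parity (even p) (prio A) ?r" unfolding parity_def by blast
  then show ?thesis
    using parity_disjoint[of "prio A" ?r] unfolding accepts_def p_def J_def[symmetric]
    by (cases "even (Min (prio A ` J))") auto
qed

lemma common_denominator:
  fixes F :: "rat set"
  assumes "finite F"
  shows "\<exists>b :: nat. 0 < b \<and> (\<forall>x \<in> F. of_nat b * x \<in> \<int>)"
  using assms
proof (induction F)
  case empty
  then show ?case by (intro exI[of _ 1]) auto
next
  case (insert x F)
  then obtain b where b: "0 < b" "\<forall>x \<in> F. of_nat b * x \<in> \<int>" by blast
  obtain m n where mn: "quotient_of x = (m, n)" by fastforce
  have n: "0 < n" "x = of_int m / of_int n"
    using quotient_of_denom_pos[OF mn] quotient_of_div[OF mn] by auto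
  have "of_nat (b * nat n) * y \<in> \<int>" if "y \<in> insert x F" for y
  proof (cases "y = x")
    case True
    have "of_nat (b * nat n) * x = of_int (int b * m)" using n by (simp add: of_nat_nat)
    then show ?thesis using True by (metis Ints_of_int)
  next
    case False
    then have "of_nat b * y \<in> \<int>" using b(2) that by auto
    then have "of_int n * (of_nat b * y) \<in> \<int>" by (rule Ints_mult[OF Ints_of_int])
    then show ?thesis using n(1) by (simp add: of_nat_nat mult_ac)
  qed
  then show ?case using b(1) n(1) by (intro exI[of _ "b * nat n"]) auto
qed

section \<open>The game graph of a parity automaton\<close>

text \<open>The weight of an edge of the game graph depends on its target only, so weights are moved to the
  vertices.\<close>

fun vertex_weight :: "'p set \<Rightarrow> 'p set \<Rightarrow> ('p lit \<Rightarrow> rat) \<Rightarrow> ('q, 'p) vertex \<Rightarrow> rat" where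
  "vertex_weight Inp Out w (V1 q i) = set_weight w Inp i"
| "vertex_weight Inp Out w (V2 q x) = set_weight w Out x"

text \<open>Player O opens each round and hence owns the Player-1 states.\<close>

definition player_O :: "('q, 'p) vertex set" where
  "player_O = {V1 q j | q j. True}"

lemma mem_player_O [simp]: "V1 q j \<in> player_O" "V2 q x \<notin> player_O"
  by (auto simp: player_O_def)

locale ltl_game =
  fixes Inp Out :: "'p set" and \<phi> :: "'p ltl" and A :: "('q, 'p) automaton" and j\<^sub>0 :: "'p set"
  assumes fin: "finite Inp" "finite Out" and disj: "Inp \<inter> Out = {}"
    and aut: "parity_automaton (Inp \<union> Out) A"
    and lang: "automaton_language (Inp \<union> Out) A = ltl_language (Inp \<union> Out) \<phi>"
    and j0: "j\<^sub>0 \<in> Pow Inp"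
begin

abbreviation S :: "('q, 'p) vertex set" where "S \<equiv> game_states Inp Out A j\<^sub>0"
abbreviation G :: "(('q, 'p) vertex \<times> ('q, 'p) vertex) set" where "G \<equiv> game_edges Inp Out A j\<^sub>0"
abbreviation v\<^sub>0 :: "('q, 'p) vertex" where "v\<^sub>0 \<equiv> V1 (init A) j\<^sub>0"

lemma delta_states: "q \<in> states A \<Longrightarrow> \<sigma> \<subseteq> Inp \<union> Out \<Longrightarrow> delta A q \<sigma> \<in> states A"
  using aut by (auto simp: parity_automaton_def)

lemma v0_S: "v\<^sub>0 \<in> S"
  by (simp add: game_states_def)

lemma S_closed: "a \<in> S \<Longrightarrow> (a, b) \<in> all_edges Inp Out A \<Longrightarrow> b \<in> S \<and> (a, b) \<in> G"
  by (auto simp: game_states_def game_edges_def intro: rtrancl_into_rtrancl)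

lemma S_shape:
  assumes "v \<in> S"
  shows "(\<exists>q j. v = V1 q j \<and> q \<in> states A \<and> j \<in> Pow Inp) \<or> (\<exists>q x. v = V2 q x \<and> q \<in> states A \<and> x \<in> Pow Out)"
proof -
  have "(v\<^sub>0, v) \<in> (all_edges Inp Out A)\<^sup>*" using assms by (simp add: game_states_def)
  then show ?thesis
  proof (cases rule: rtranclE)
    case base
    then show ?thesis using aut j0 by (auto simp: parity_automaton_def)
  next
    case (step y)
    then show ?thesis by (auto simp: all_edges_def intro!: delta_states)
  qed
qed

lemma G_V1 [simp]: "(V1 q j, V2 q' x) \<in> G \<longleftrightarrow> V1 q j \<in> S \<and> q' = q \<and> x \<in> Pow Out"
proof
  assume "V1 q j \<in> S \<and> q' = q \<and> x \<in> Pow Out"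
  moreover then have "q \<in> states A \<and> j \<in> Pow Inp" using S_shape by blast
  ultimately show "(V1 q j, V2 q' x) \<in> G" using S_closed by (auto simp: all_edges_def)
qed (auto simp: game_edges_def all_edges_def)

lemma G_V2 [simp]: "(V2 q x, V1 q' i) \<in> G \<longleftrightarrow> V2 q x \<in> S \<and> i \<in> Pow Inp \<and> q' = delta A q (x \<union> i)"
proof
  assume "V2 q x \<in> S \<and> i \<in> Pow Inp \<and> q' = delta A q (x \<union> i)"
  moreover then have "q \<in> states A \<and> x \<in> Pow Out" using S_shape by blast
  ultimately show "(V2 q x, V1 q' i) \<in> G" using S_closed by (auto simp: all_edges_def)
qed (auto simp: game_edges_def all_edges_def)

lemma G_other [simp]: "(V1 q j, V1 q' i) \<notin> G" "(V2 q x, V2 q' y) \<notin> G"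
  by (auto simp: game_edges_def all_edges_def)

lemma G_S: "(a, b) \<in> G \<Longrightarrow> a \<in> S \<and> b \<in> S"
  by (simp add: game_edges_def)

lemma S_cases:
  assumes "v \<in> S"
  obtains q j where "v = V1 q j" "q \<in> states A" "j \<in> Pow Inp"
  | q x where "v = V2 q x" "q \<in> states A" "x \<in> Pow Out"
  using S_shape[OF assms] by blast

lemma finite_S: "finite S"
proof (rule finite_subset)
  show "S \<subseteq> (\<lambda>(q, j). V1 q j) ` (states A \<times> Pow Inp) \<union> (\<lambda>(q, x). V2 q x) ` (states A \<times> Pow Out)"
    using S_shape by blast
  show "finite ((\<lambda>(q, j). V1 q j) ` (states A \<times> Pow Inp) \<union> (\<lambda>(q, x). V2 q x) ` (states A \<times> Pow Out))"
    using fin aut by (simp add: parity_automaton_def)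
qed

lemma arena_G: "Domain G = S" "arena G"
proof -
  show D: "Domain G = S"
  proof
    show "Domain G \<subseteq> S" using G_S by blast
    show "S \<subseteq> Domain G"
    proof
      fix v assume v: "v \<in> S"
      then show "v \<in> Domain G"
      proof (cases rule: S_cases)
        case (1 q j)
        then have "(v, V2 q {}) \<in> G" using v by simp
        then show ?thesis by blast
      next
        case (2 q x)
        then have "(v, V1 (delta A q (x \<union> {})) {}) \<in> G" using v by (simp del: Un_empty_right)
        then show ?thesis by blast
      qed
    qed
  qed
  have "G \<subseteq> S \<times> S" using G_S by auto
  then have "finite G" using finite_S by (meson finite_SigmaI finite_subset)
  then show "arena G" unfolding arena_def D using G_S by blast
qed

lemma vertex_weight_edge:
  assumes "v \<in> S"
  obtains e where "e \<in> G" "edge_weight Inp Out w e = vertex_weight Inp Out w v"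
proof -
  have "(v\<^sub>0, v) \<in> (all_edges Inp Out A)\<^sup>*" using assms by (simp add: game_states_def)
  then show ?thesis
  proof (cases rule: rtranclE)
    case base
    \<comment> \<open>The initial state may have no incoming edge. An edge that reads the input
      \<open>j\<^sub>0\<close> may end in another state, but it carries the same weight.\<close>
    have "V2 (init A) {} \<in> S" using v0_S G_S[of v\<^sub>0 "V2 (init A) {}"] by simp
    then have "(V2 (init A) {}, V1 (delta A (init A) ({} \<union> j\<^sub>0)) j\<^sub>0) \<in> G" using j0 by (simp del: Un_empty_left)
    then show ?thesis by (rule that) (simp flip: base)
  next
    case (step y)
    then have "(y, v) \<in> G" using S_closed by (simp add: game_states_def)
    then show ?thesis by (rule that) (cases v; simp)
  qed
qed

section \<open>Plays as paths of the game graph\<close>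

definition hstate :: "'p round list \<Rightarrow> 'q \<times> 'p set" where
  "hstate h = foldl (\<lambda>(q, j) (x, i). (delta A q (x \<union> i), i)) (init A, j\<^sub>0) h"

definition play_path ::
  "('p round list \<Rightarrow> 'p set) \<Rightarrow> ('p round list \<Rightarrow> 'p set \<Rightarrow> 'p set) \<Rightarrow> nat \<Rightarrow> ('q, 'p) vertex" where
  "play_path sO sI n = (let h = play_prefix sO sI (n div 2) in
     if even n then V1 (fst (hstate h)) (snd (hstate h)) else V2 (fst (hstate h)) (sO h))"

lemma hstate_Nil [simp]: "hstate [] = (init A, j\<^sub>0)"
  by (simp add: hstate_def)

lemma hstate_snoc [simp]: "hstate (h @ [(x, i)]) = (delta A (fst (hstate h)) (x \<union> i), i)"
  by (simp add: hstate_def split: prod.split)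

lemma play_path_0 [simp]: "play_path sO sI 0 = v\<^sub>0"
  by (simp add: play_path_def)

lemma play_path_even: "play_path sO sI (2 * n) =
    V1 (fst (hstate (play_prefix sO sI n))) (snd (hstate (play_prefix sO sI n)))"
  by (simp add: play_path_def Let_def)

lemma play_path_odd: "play_path sO sI (Suc (2 * n)) =
    V2 (fst (hstate (play_prefix sO sI n))) (sO (play_prefix sO sI n))"
  by (simp add: play_path_def Let_def)

context
  fixes sO sI
  assumes sO: "sO \<in> strategies_O Inp Out" and sI: "sI \<in> strategies_I Inp Out"
begin

lemma play_prefix_histories: "play_prefix sO sI n \<in> histories Inp Out"
proof (induction n)
  case (Suc n)
  have "sO (play_prefix sO sI n) \<in> Pow Out"
    using sO Suc unfolding strategies_O_def by (rule funcset_mem)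
  moreover have "sI (play_prefix sO sI n) \<in> Pow Out \<rightarrow> Pow Inp"
    using sI Suc unfolding strategies_I_def by (rule funcset_mem)
  ultimately show ?case
    using Suc by (auto simp: histories_def Let_def)
qed (simp add: histories_def)

lemma move_O: "sO (play_prefix sO sI n) \<in> Pow Out"
  using sO play_prefix_histories unfolding strategies_O_def by (rule funcset_mem)

lemma move_I: "sI (play_prefix sO sI n) (sO (play_prefix sO sI n)) \<in> Pow Inp"
proof -
  have "sI (play_prefix sO sI n) \<in> Pow Out \<rightarrow> Pow Inp"
    using sI play_prefix_histories unfolding strategies_I_def by (rule funcset_mem)
  then show ?thesis using move_O by (rule funcset_mem)
qed

lemma outcome_words: "outcome sO sI \<in> words (Inp \<union> Out)"
  using move_O move_I by (auto simp: words_def outcome_def Let_def)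

lemma hstate_run: "fst (hstate (play_prefix sO sI n)) = run A (outcome sO sI) n"
  by (induction n) (simp_all add: outcome_def Let_def)

lemma play_path_step: "(play_path sO sI n, play_path sO sI (Suc n)) \<in> G"
proof -
  have odd: "(play_path sO sI (Suc (2 * n)), play_path sO sI (2 * Suc n)) \<in> G"
    if "play_path sO sI (Suc (2 * n)) \<in> S" for n
    using that move_I[of n] unfolding play_path_even play_path_odd by (simp add: Let_def)
  have even: "(play_path sO sI (2 * n), play_path sO sI (Suc (2 * n))) \<in> G"
    if "play_path sO sI (2 * n) \<in> S" for n
    using that move_O[of n] unfolding play_path_even play_path_odd by simp
  have S: "play_path sO sI (2 * n) \<in> S" for n
  proof (induction n)
    case (Suc n)
    then show ?case using even[of n] odd[of n] G_S by blast
  qed (simp add: v0_S)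
  show ?thesis
  proof (cases "even n")
    case True
    then obtain m where "n = 2 * m" by blast
    then show ?thesis using even S by simp
  next
    case False
    then obtain m where "n = Suc (2 * m)" by (metis oddE Suc_eq_plus1)
    then show ?thesis using odd[of m] even[OF S, of m] G_S by auto
  qed
qed

lemma play_path_infpath: "infpath G (play_path sO sI)"
  using play_path_step by (simp add: infpath_def)

lemma sat_iff_parity: "outcome sO sI \<Turnstile> \<phi> \<longleftrightarrow> parity True (vertex_prio A) (play_path sO sI)"
proof -
  let ?u = "outcome sO sI"
  have "?u \<Turnstile> \<phi> \<longleftrightarrow> accepts A ?u"
    using lang outcome_words unfolding automaton_language_def ltl_language_def by blast
  also have "\<dots> \<longleftrightarrow> parity True (prio A) (run A ?u)"
  proof (rule accepts_iff_parity)
    show "finite (states A)" using aut by (simp add: parity_automaton_def)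
    show "run A ?u n \<in> states A" for n
    proof (induction n)
      case (Suc n)
      then show ?case using outcome_words by (auto simp: words_def intro!: delta_states)
    qed (use aut in \<open>simp add: parity_automaton_def\<close>)
  qed
  also have "\<dots> \<longleftrightarrow> parity True (prio A) (\<lambda>n. run A ?u (n div 2))"
    by (rule parity_div2[symmetric])
  also have "\<dots> \<longleftrightarrow> parity True (vertex_prio A) (play_path sO sI)"
  proof -
    have "vertex_prio A (play_path sO sI n) = prio A (run A ?u (n div 2))" for n
      by (simp add: play_path_def Let_def hstate_run)
    then show ?thesis by (simp add: parity_def)
  qed
  finally show ?thesis .
qed

lemma letter_weight_outcome:
  "letter_weight Inp Out w (outcome sO sI n) =
     vertex_weight Inp Out w (play_path sO sI (Suc (2 * n))) +
     vertex_weight Inp Out w (play_path sO sI (2 * Suc n))"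
proof -
  define x i where "x = sO (play_prefix sO sI n)" and "i = sI (play_prefix sO sI n) x"
  have "x \<subseteq> Out" "i \<subseteq> Inp" using move_O[of n] move_I[of n] by (auto simp: x_def i_def)
  then have "(x \<union> i) \<inter> Out = x" "(x \<union> i) \<inter> Inp = i" using disj by auto
  moreover have "outcome sO sI n = x \<union> i" by (simp add: outcome_def Let_def x_def i_def)
  moreover have "play_path sO sI (Suc (2 * n)) = V2 (fst (hstate (play_prefix sO sI n))) x"
    unfolding play_path_odd x_def ..
  moreover have "\<exists>q. play_path sO sI (2 * Suc n) = V1 q i"
    unfolding play_path_even by (simp add: Let_def x_def i_def)
  ultimately show ?thesis by (auto simp: letter_weight_def)
qed

text \<open>After \<open>n\<close> rounds the path has passed the initial state and two further
  vertices per round, hence the index \<open>Suc (2 * n)\<close>. The weight of the initial state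
  belongs to no letter of the outcome and remains as a constant offset.\<close>

lemma esum_play_path:
  assumes "\<And>v. v \<in> S \<Longrightarrow> of_int (wv v) = of_nat b * vertex_weight Inp Out w v"
  shows "of_int (esum wv (play_path sO sI) (Suc (2 * n))) =
    of_nat b * (vertex_weight Inp Out w v\<^sub>0 + EL Inp Out w (outcome sO sI) n)"
proof (induction n)
  case 0
  then show ?case using assms[OF v0_S] by (simp add: EL_def)
next
  case (Suc n)
  have S: "play_path sO sI m \<in> S" for m using G_S[OF play_path_step] by blast
  have "of_int (esum wv (play_path sO sI) (Suc (2 * Suc n))) =
      of_int (esum wv (play_path sO sI) (Suc (2 * n))) +
      (of_int (wv (play_path sO sI (Suc (2 * n)))) + of_int (wv (play_path sO sI (2 * Suc n))) :: rat)"
    by simp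
  also have "\<dots> = of_nat b * (vertex_weight Inp Out w v\<^sub>0 + EL Inp Out w (outcome sO sI) n) +
      of_nat b * letter_weight Inp Out w (outcome sO sI n)"
    unfolding Suc letter_weight_outcome assms[OF S] by (simp add: distrib_left)
  also have "\<dots> = of_nat b * (vertex_weight Inp Out w v\<^sub>0 + EL Inp Out w (outcome sO sI) (Suc n))"
    by (simp add: EL_def distrib_left)
  finally show ?case .
qed

end

end

context ltl_game
begin

text \<open>The intersection with \<open>Inp\<close> and the default \<open>{}\<close> make this a
  legal strategy for every \<open>t\<close>.\<close>

definition strat_I :: "(('q, 'p) vertex \<Rightarrow> ('q, 'p) vertex) \<Rightarrow> 'p round list \<Rightarrow> 'p set \<Rightarrow> 'p set" where
  "strat_I t h x = (case t (V2 (fst (hstate h)) x) of V1 q i \<Rightarrow> i \<inter> Inp | V2 q y \<Rightarrow> {})"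

lemma strat_I_strategies: "strat_I t \<in> strategies_I Inp Out"
  by (auto simp: strategies_I_def strat_I_def split: vertex.split)

lemma follows_strat_I:
  assumes sO: "sO \<in> strategies_O Inp Out" and t: "positional G (- player_O) t"
  shows "follows (- player_O) t (play_path sO (strat_I t))"
  unfolding follows_def
proof (intro allI impI)
  fix n assume n: "play_path sO (strat_I t) n \<in> - player_O"
  have "odd n"
  proof
    assume "even n"
    then obtain m where "n = 2 * m" by blast
    then show False using n by (simp add: play_path_even)
  qed
  then obtain m where m: "n = Suc (2 * m)" by (metis oddE Suc_eq_plus1)
  define h where "h = play_prefix sO (strat_I t) m"
  define q x where "q = fst (hstate h)" and "x = sO h"
  have un: "play_path sO (strat_I t) n = V2 q x" unfolding m play_path_odd by (simp add: q_def x_def h_def)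
  have "(play_path sO (strat_I t) n, play_path sO (strat_I t) (Suc n)) \<in> G"
    by (rule play_path_step[OF sO strat_I_strategies])
  then have "V2 q x \<in> Domain G" unfolding un by blast
  then have edge: "(V2 q x, t (V2 q x)) \<in> G" using t unfolding positional_def by simp
  then obtain i where i: "t (V2 q x) = V1 (delta A q (x \<union> i)) i" "i \<subseteq> Inp"
    by (cases "t (V2 q x)") auto
  have "strat_I t h x = i" using i by (auto simp: strat_I_def q_def[symmetric])
  then have "play_path sO (strat_I t) (2 * Suc m) = V1 (delta A q (x \<union> i)) i"
    unfolding play_path_even by (simp add: Let_def h_def[symmetric] x_def[symmetric] q_def[symmetric])
  then show "play_path sO (strat_I t) (Suc n) = t (play_path sO (strat_I t) n)"
    unfolding un i(1) using m by simp
qed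

text \<open>Against a positional opponent the memory class and the current game state determine the
  next round, and there are only finitely many such pairs.\<close>

lemma memory_play_periodic:
  assumes sO: "sO \<in> strategies_O Inp Out" and mem: "memory_size Inp Out sO k"
  obtains m c where "0 < c"
    "\<And>n. m \<le> n \<Longrightarrow> play_path sO (strat_I t) (n + c) = play_path sO (strat_I t) n"
proof -
  let ?H = "histories Inp Out" and ?u = "play_path sO (strat_I t)"
  obtain R where R: "right_congruence Inp Out R" "finite (?H // R)" and const: "\<forall>(h, h') \<in> R. sO h = sO h'"
    using mem unfolding memory_size_def by blast
  have eq: "equiv ?H R" using R(1) by (simp add: right_congruence_def)
  define h where "h n = play_prefix sO (strat_I t) n" for n
  have hH: "h n \<in> ?H" for n
    unfolding h_def by (rule play_prefix_histories[OF sO strat_I_strategies])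
  have hS: "h (Suc n) = h n @ [(sO (h n), strat_I t (h n) (sO (h n)))]" for n
    by (simp add: h_def Let_def)
  have rnd: "(sO (h n), strat_I t (h n) (sO (h n))) \<in> Pow Out \<times> Pow Inp" for n
    using move_O[OF sO strat_I_strategies] move_I[OF sO strat_I_strategies] by (simp add: h_def)
  define z where "z n = (R `` {h n}, ?u (2 * n))" for n
  have u_even: "?u (2 * n) = V1 (fst (hstate (h n))) (snd (hstate (h n)))" for n
    unfolding play_path_even h_def ..
  have u_odd: "?u (Suc (2 * n)) = V2 (fst (hstate (h n))) (sO (h n))" for n
    unfolding play_path_odd h_def ..
  have step: "z (Suc n) = z (Suc n') \<and> ?u (Suc (2 * n)) = ?u (Suc (2 * n'))" if zz: "z n = z n'" for n n'
  proof -
    have cls: "R `` {h n} = R `` {h n'}" and vtx: "?u (2 * n) = ?u (2 * n')"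
      using zz unfolding z_def by blast+
    have rel: "(h n, h n') \<in> R" using cls eq hH by (rule eq_equiv_class)
    have o: "sO (h n) = sO (h n')" using const rel by blast
    have q: "fst (hstate (h n)) = fst (hstate (h n'))" using vtx unfolding u_even by blast
    have i: "strat_I t (h n) (sO (h n)) = strat_I t (h n') (sO (h n'))" by (simp add: strat_I_def o q)
    have "(h (Suc n), h (Suc n')) \<in> R"
    proof -
      have "\<forall>r \<in> Pow Out \<times> Pow Inp. (h n @ [r], h n' @ [r]) \<in> R"
        using R(1) rel unfolding right_congruence_def by blast
      then have "(h n @ [(sO (h n), strat_I t (h n) (sO (h n)))], h n' @ [(sO (h n), strat_I t (h n) (sO (h n)))]) \<in> R"
        using rnd[of n] by (rule bspec)
      then show ?thesis unfolding hS i unfolding o .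
    qed
    then have "R `` {h (Suc n)} = R `` {h (Suc n')}" by (rule equiv_class_eq[OF eq])
    moreover have "?u (2 * Suc n) = ?u (2 * Suc n')"
      unfolding u_even hS hstate_snoc fst_conv snd_conv i unfolding o q ..
    moreover have "?u (Suc (2 * n)) = ?u (Suc (2 * n'))" unfolding u_odd o q ..
    ultimately show ?thesis by (simp add: z_def)
  qed
  have uS: "?u n \<in> S" for n using G_S[OF play_path_step[OF sO strat_I_strategies]] by blast
  have "z n \<in> (?H // R) \<times> S" for n using hH uS by (auto simp: z_def intro: quotientI)
  then have "finite (range z)" using R(2) finite_S by (meson finite_SigmaI finite_subset image_subsetI)
  then have "\<not> inj z" using finite_imageD infinite_UNIV_nat by blast
  then obtain m m' where mm: "m < m'" "z m = z m'" by (metis injI linorder_neqE_nat)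
  define c where "c = m' - m"
  have zper: "z (j + m + c) = z (j + m)" for j
  proof (induction j)
    case 0
    then show ?case using mm by (simp add: c_def)
  next
    case (Suc j)
    then show ?case using step[of "j + m + c" "j + m"] by simp
  qed
  have zc: "z (i + c) = z i" if "m \<le> i" for i
  proof -
    have "i - m + m = i" using that by simp
    then show ?thesis using zper[of "i - m"] by presburger
  qed
  \<comment> \<open>Rounds repeat with period \<open>c\<close> from \<open>m\<close> on, and the
    path visits two vertices per round.\<close>
  have "?u (n + 2 * c) = ?u n" if n: "2 * m \<le> n" for n
  proof (cases "even n")
    case True
    then obtain i where i: "n = 2 * i" by blast
    then have "z (i + c) = z i" using n by (intro zc) simp
    then have "?u (2 * (i + c)) = ?u (2 * i)" unfolding z_def by blast
    then show ?thesis unfolding i by (simp only: distrib_left)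
  next
    case False
    then obtain i where i: "n = Suc (2 * i)" by (metis oddE Suc_eq_plus1)
    then have "z (i + c) = z i" using n by (intro zc) simp
    then have "?u (Suc (2 * (i + c))) = ?u (Suc (2 * i))" using step by blast
    then show ?thesis unfolding i by (simp only: distrib_left add_Suc)
  qed
  moreover have "0 < 2 * c" using mm by (simp add: c_def)
  ultimately show ?thesis by (intro that[of "2 * c" "2 * m"])
qed

end

text \<open>The energy arguments work with integers, while the shifted weights are rational;
  \<open>b\<close> clears the denominators of the edge weights.\<close>

locale weighted_game = ltl_game +
  fixes w\<^sub>P :: "'a lit \<Rightarrow> int" and \<nu> :: rat and w :: "'a lit \<Rightarrow> rat" and b :: nat
  assumes letter: "\<And>\<sigma>. \<sigma> \<subseteq> Inp \<union> Out \<Longrightarrow>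
      letter_weight Inp Out w \<sigma> = letter_weight Inp Out (\<lambda>l. rat_of_int (w\<^sub>P l)) \<sigma> - \<nu>"
    and b: "0 < b" and integral: "\<And>e. e \<in> G \<Longrightarrow> of_nat b * edge_weight Inp Out w e \<in> \<int>"
begin

abbreviation W\<^sub>P :: "'a lit \<Rightarrow> rat" where "W\<^sub>P \<equiv> \<lambda>l. rat_of_int (w\<^sub>P l)"

definition wv :: "('b, 'a) vertex \<Rightarrow> int" where
  "wv v = \<lfloor>of_nat b * vertex_weight Inp Out w v\<rfloor>"

lemma of_int_wv: "v \<in> S \<Longrightarrow> of_int (wv v) = of_nat b * vertex_weight Inp Out w v"
proof -
  assume "v \<in> S"
  then obtain e where "e \<in> G" "edge_weight Inp Out w e = vertex_weight Inp Out w v"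
    by (rule vertex_weight_edge)
  then have "of_nat b * vertex_weight Inp Out w v \<in> \<int>" using integral by metis
  then show ?thesis unfolding wv_def by (auto elim: Ints_cases)
qed

lemma EL_shift:
  assumes "sO \<in> strategies_O Inp Out" "sI \<in> strategies_I Inp Out"
  shows "EL Inp Out W\<^sub>P (outcome sO sI) n = EL Inp Out w (outcome sO sI) n + of_nat n * \<nu>"
proof -
  have "outcome sO sI k \<subseteq> Inp \<union> Out" for k using outcome_words[OF assms] by (auto simp: words_def)
  then have "letter_weight Inp Out w (outcome sO sI k) = letter_weight Inp Out W\<^sub>P (outcome sO sI k) - \<nu>" for k
    by (rule letter)
  then show ?thesis by (simp add: EL_def sum_subtractf)
qed

abbreviation beaten :: "(('b, 'a) vertex \<Rightarrow> ('b, 'a) vertex) \<Rightarrow> bool" where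
  "beaten t \<equiv> avoids G (- player_O) (winning_play wv (vertex_prio A)) t v\<^sub>0"

lemma not_beatenI:
  assumes sO: "sO \<in> strategies_O Inp Out" and t: "positional G (- player_O) t"
    and "bounded_below wv (play_path sO (strat_I t))" "outcome sO (strat_I t) \<Turnstile> \<phi>"
  shows "\<not> beaten t"
proof
  assume "beaten t"
  then have "\<not> winning_play wv (vertex_prio A) (play_path sO (strat_I t))"
    by (rule avoidsD[OF _ play_path_infpath[OF sO strat_I_strategies] play_path_0 follows_strat_I[OF sO t]])
  then show False using assms(3,4) sat_iff_parity[OF sO strat_I_strategies] by simp
qed

lemma E_realizable_not_beaten:
  assumes "E_realizable Inp Out \<phi> w" and t: "positional G (- player_O) t"
  shows "\<not> beaten t"
proof -
  obtain sO and c\<^sub>0 :: nat where sO: "sO \<in> strategies_O Inp Out" and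
    win: "\<And>sI. sI \<in> strategies_I Inp Out \<Longrightarrow> outcome sO sI \<Turnstile> \<phi> \<and> (\<forall>n. 0 \<le> of_nat c\<^sub>0 + EL Inp Out w (outcome sO sI) n)"
    using assms(1) unfolding E_realizable_def by blast
  let ?u = "play_path sO (strat_I t)"
  note win = win[OF strat_I_strategies[of t]]
  define W where "W = Max (wv ` S)"
  define c where "c = \<lfloor>of_nat b * (vertex_weight Inp Out w v\<^sub>0 - of_nat c\<^sub>0)\<rfloor>"
  have uS: "?u n \<in> S" for n using G_S[OF play_path_step[OF sO strat_I_strategies]] by blast
  have W: "wv (?u n) \<le> W" for n unfolding W_def using uS finite_S by (intro Max_ge) auto
  have odd: "c \<le> esum wv ?u (Suc (2 * n))" for n
  proof -
    have "of_nat b * (vertex_weight Inp Out w v\<^sub>0 - of_nat c\<^sub>0) \<le>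
        of_nat b * (vertex_weight Inp Out w v\<^sub>0 + EL Inp Out w (outcome sO (strat_I t)) n)"
      using win by (intro mult_left_mono) (auto simp: algebra_simps)
    also have "\<dots> = of_int (esum wv ?u (Suc (2 * n)))"
      by (rule esum_play_path[OF sO strat_I_strategies of_int_wv, symmetric])
    finally show ?thesis unfolding c_def by linarith
  qed
  \<comment> \<open>An even prefix is an odd one without its last vertex, whose weight is at most
    \<open>W\<close>. The minimum is taken because \<open>W\<close> may be negative.\<close>
  have "min c (c - W) \<le> esum wv ?u n" for n
  proof (cases "even n")
    case True
    then obtain m where m: "n = 2 * m" by blast
    then show ?thesis using odd[of m] W[of n] by simp
  next
    case False
    then obtain m where "n = Suc (2 * m)" by (metis oddE Suc_eq_plus1)
    then show ?thesis using odd[of m] by simp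
  qed
  then have "bounded_below wv ?u" by (auto simp: bounded_below_def)
  then show ?thesis using not_beatenI[OF sO t] win by blast
qed

text \<open>The play against \<open>t\<close> is ultimately periodic, so its energy is bounded below
  or falls linearly. A linear fall of the shifted energy would push the mean payoff strictly below
  \<open>\<nu>\<close>.\<close>

lemma MP_realizable_not_beaten:
  assumes "MP_realizable_fm Inp Out \<phi> W\<^sub>P \<nu>" and t: "positional G (- player_O) t"
  shows "\<not> beaten t"
proof -
  obtain sO k where sO: "sO \<in> strategies_O Inp Out" and mem: "memory_size Inp Out sO k"
    and val: "\<And>sI. sI \<in> strategies_I Inp Out \<Longrightarrow> ereal (real_of_rat \<nu>) \<le> Val Inp Out \<phi> W\<^sub>P (outcome sO sI)"
    using assms(1) unfolding MP_realizable_fm_def MP_winning_def by blast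
  let ?u = "play_path sO (strat_I t)" and ?o = "outcome sO (strat_I t)"
  note val = val[OF strat_I_strategies[of t]]
  have sat: "?o \<Turnstile> \<phi>" using val by (auto simp: Val_def split: if_splits)
  have MP: "ereal (real_of_rat \<nu>) \<le> MP Inp Out W\<^sub>P ?o" using val sat by (simp add: Val_def)
  obtain m c where "0 < c" "\<And>n. m \<le> n \<Longrightarrow> ?u (n + c) = ?u n"
    using memory_play_periodic[OF sO mem, of t] by blast
  then have "bounded_below wv ?u \<or> lin_decreasing wv ?u" by (rule eventually_periodic_energy)
  moreover have "\<not> lin_decreasing wv ?u"
  proof
    assume "lin_decreasing wv ?u"
    then obtain K c where K: "0 < K" and c: "\<And>n. c \<le> - (K * esum wv ?u n) - int n"
      by (auto simp: lin_decreasing_def bounded_below_def esum_lin)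
    \<comment> \<open>\<open>C\<close> and \<open>\<epsilon>\<close> result from solving the linear
      bound at index \<open>Suc (2 * n)\<close> for the energy after \<open>n\<close> rounds: the
      scaling by \<open>b\<close> enters the denominator, and the 2 in \<open>\<epsilon>\<close>
      counts the vertices of a round.\<close>
    define C where "C = - real_of_int c / real_of_int (K * int b) - real_of_rat (vertex_weight Inp Out w v\<^sub>0)"
    define \<epsilon> where "\<epsilon> = 2 / real_of_int (K * int b)"
    have Kb: "0 < real_of_int (K * int b)" using K b by simp
    have upper: "real_of_rat (EL Inp Out W\<^sub>P ?o n) / real n \<le> real_of_rat \<nu> - \<epsilon> + C / real n" if "0 < n" for n
    proof -
      let ?E = "real_of_rat (EL Inp Out w ?o n)"
      have "real_of_int (esum wv ?u (Suc (2 * n))) = real_of_rat (of_int (esum wv ?u (Suc (2 * n))))"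
        by (rule of_rat_of_int_eq[symmetric])
      also have "rat_of_int (esum wv ?u (Suc (2 * n))) =
          of_nat b * (vertex_weight Inp Out w v\<^sub>0 + EL Inp Out w ?o n)"
        by (rule esum_play_path[OF sO strat_I_strategies of_int_wv])
      also have "real_of_rat \<dots> = real b * (real_of_rat (vertex_weight Inp Out w v\<^sub>0) + ?E)"
        by (simp add: of_rat_mult of_rat_add)
      finally have e: "real_of_int (esum wv ?u (Suc (2 * n))) = real b * (real_of_rat (vertex_weight Inp Out w v\<^sub>0) + ?E)" .
      have "K * esum wv ?u (Suc (2 * n)) \<le> - c - 2 * int n" using c[of "Suc (2 * n)"] by simp
      then have "real_of_int (K * esum wv ?u (Suc (2 * n))) \<le> real_of_int (- c - 2 * int n)"
        by (simp only: of_int_le_iff)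
      then have "real_of_int (K * int b) * (real_of_rat (vertex_weight Inp Out w v\<^sub>0) + ?E) \<le> - real_of_int c - 2 * real n"
        unfolding of_int_mult e by (simp add: mult.assoc)
      then have "real_of_rat (vertex_weight Inp Out w v\<^sub>0) + ?E \<le> (- real_of_int c - 2 * real n) / real_of_int (K * int b)"
        using Kb by (simp add: pos_le_divide_eq mult.commute)
      also have "\<dots> = - real_of_int c / real_of_int (K * int b) - \<epsilon> * real n"
        by (simp add: \<epsilon>_def diff_divide_distrib)
      finally have "?E \<le> C - \<epsilon> * real n" by (simp add: C_def)
      moreover have "real_of_rat (EL Inp Out W\<^sub>P ?o n) = ?E + real n * real_of_rat \<nu>"
        unfolding EL_shift[OF sO strat_I_strategies] by (simp add: of_rat_add of_rat_mult)
      ultimately have "real_of_rat (EL Inp Out W\<^sub>P ?o n) / real n \<le> (C - \<epsilon> * real n + real n * real_of_rat \<nu>) / real n"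
        by (intro divide_right_mono) auto
      also have "\<dots> = real_of_rat \<nu> - \<epsilon> + C / real n" using that by (simp add: field_simps)
      finally show ?thesis .
    qed
    have lim: "(\<lambda>n. ereal (real_of_rat \<nu> - \<epsilon> + C / real n)) \<longlonglongrightarrow> ereal (real_of_rat \<nu> - \<epsilon>)"
    proof -
      have "(\<lambda>n. real_of_rat \<nu> - \<epsilon> + C / real n) \<longlonglongrightarrow> real_of_rat \<nu> - \<epsilon> + 0"
        by (intro tendsto_add tendsto_const lim_const_over_n)
      then show ?thesis by simp
    qed
    have "MP Inp Out W\<^sub>P ?o \<le> liminf (\<lambda>n. ereal (real_of_rat \<nu> - \<epsilon> + C / real n))"
      unfolding MP_def
      by (intro Liminf_mono eventually_sequentiallyI[of 1]) (use upper in auto)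
    also have "\<dots> = ereal (real_of_rat \<nu> - \<epsilon>)" by (rule lim_imp_Liminf[OF sequentially_bot lim])
    finally have "ereal (real_of_rat \<nu>) \<le> ereal (real_of_rat \<nu> - \<epsilon>)" using MP by (rule order_trans[rotated])
    moreover have "0 < \<epsilon>" using Kb by (simp add: \<epsilon>_def)
    ultimately show False by simp
  qed
  ultimately have "bounded_below wv ?u" by blast
  then show ?thesis using not_beatenI[OF sO t] sat by blast
qed

end

section \<open>Finite-memory strategies\<close>

text \<open>For strategies driven by a memory value \<open>f h\<close>: having reached the same
  value is a right congruence, and its classes correspond to the values that occur.\<close>

lemma kernel_memory_size:
  assumes fin: "finite (f ` histories Inp Out)"
    and cong: "\<And>h h' r. f h = f h' \<Longrightarrow> f (h @ [r]) = f (h' @ [r])"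
    and const: "\<And>h h'. f h = f h' \<Longrightarrow> sO h = sO h'"
  obtains k where "memory_size Inp Out sO k" "k \<le> card (f ` histories Inp Out)"
proof -
  let ?H = "histories Inp Out"
  define R where "R = {(h, h'). h \<in> ?H \<and> h' \<in> ?H \<and> f h = f h'}"
  have snoc: "h @ [r] \<in> ?H" if "h \<in> ?H" "r \<in> Pow Out \<times> Pow Inp" for h r
    using that by (auto simp: histories_def)
  have "equiv ?H R"
    by (rule equivI) (auto simp: R_def refl_on_def sym_def trans_def)
  moreover have "(h @ [r], h' @ [r]) \<in> R" if "(h, h') \<in> R" "r \<in> Pow Out \<times> Pow Inp" for h h' r
    using that snoc[OF _ that(2)] cong[of h h' r] unfolding R_def by blast
  ultimately have "right_congruence Inp Out R"
    unfolding right_congruence_def by blast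
  moreover have quot: "?H // R = (\<lambda>m. {h \<in> ?H. f h = m}) ` (f ` ?H)"
  proof -
    have "R `` {h} = {h' \<in> ?H. f h' = f h}" if "h \<in> ?H" for h using that by (auto simp: R_def)
    then show ?thesis by (auto simp: quotient_def image_iff)
  qed
  then have "finite (?H // R)" using finite_imageI[OF fin] by simp
  moreover have "\<forall>(h, h') \<in> R. sO h = sO h'" unfolding R_def using const by blast
  ultimately have "memory_size Inp Out sO (card (?H // R))" unfolding memory_size_def by blast
  moreover have "card (?H // R) \<le> card (f ` ?H)" unfolding quot using fin by (rule card_image_le)
  ultimately show ?thesis by (rule that)
qed

context weighted_game
begin

text \<open>Only the initial state is known not to be refuted, so the capped game is set up on the
  region \<open>X\<close> around it, which the opponent cannot leave. The memory is a game state
  with one of the \<open>M + 2\<close> levels from \<open>- 1\<close> to \<open>M\<close>.\<close>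

lemma finite_memory_strategy:
  fixes W :: int
  defines "D \<equiv> 3 * int (num_priorities Inp Out A j\<^sub>0 * card S) * W"
  assumes W: "1 \<le> W" "\<And>v. v \<in> S \<Longrightarrow> \<bar>wv v\<bar> \<le> W"
    and win: "\<And>t. positional G (- player_O) t \<Longrightarrow> \<not> beaten t"
  obtains sO k where "sO \<in> strategies_O Inp Out" "memory_size Inp Out sO k"
    "int k \<le> int (card S) * (D + 2)"
    "\<And>sI. sI \<in> strategies_I Inp Out \<Longrightarrow> outcome sO sI \<Turnstile> \<phi>"
    "\<And>sI n. sI \<in> strategies_I Inp Out \<Longrightarrow> - D \<le> esum wv (play_path sO sI) n"
proof -
  let ?pr = "vertex_prio A"
  obtain t X where t: "positional G (- player_O) t"
    and X_def: "X = {v \<in> S. \<not> avoids G (- player_O) (winning_play wv ?pr) t v}"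
    and "\<And>v t'. v \<in> X \<Longrightarrow> positional G (- player_O) t' \<Longrightarrow> \<not> avoids G (- player_O) (winning_play wv ?pr) t' v"
    and X: "Domain (Restr G X) = X" "arena (Restr G X)" "unbeaten (Restr G X) player_O wv ?pr"
    and closed: "\<And>v y. v \<in> X \<Longrightarrow> v \<notin> player_O \<Longrightarrow> (v, y) \<in> G \<Longrightarrow> y \<in> X"
    by (rule unbeaten_region[OF arena_G(2), of player_O wv ?pr, unfolded arena_G(1)]) blast
  have v0X: "v\<^sub>0 \<in> X" unfolding X_def using v0_S win[OF t] by blast
  have XS: "X \<subseteq> S" by (auto simp: X_def)
  define M where "M = 3 * int (card (?pr ` X) * card X) * W"
  have M0: "0 \<le> M" using W(1) by (simp add: M_def)
  have MD: "M \<le> D"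
  proof -
    have "card (?pr ` X) * card X \<le> num_priorities Inp Out A j\<^sub>0 * card S"
      unfolding num_priorities_def using XS finite_S by (intro mult_mono card_mono image_mono) auto
    then have "int (card (?pr ` X) * card X) \<le> int (num_priorities Inp Out A j\<^sub>0 * card S)"
      by (simp only: of_nat_le_iff)
    then show ?thesis unfolding M_def D_def using W(1) by (intro mult_right_mono) auto
  qed
  have "cap_unbeaten (Restr G X) player_O wv ?pr M"
    unfolding M_def using cap_unbeaten_bound[OF X(2,3) W(1)] W(2) XS unfolding X(1) by blast
  then obtain s where s: "positional (cap_edges (Restr G X) M wv) (lift_player player_O) s"
    and s_win: "\<And>v. v \<in> X \<Longrightarrow>
      avoids (cap_edges (Restr G X) M wv) (lift_player player_O) (parity False (cap_prio ?pr)) s (v, M)"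
    using cap_unbeaten_strategy[OF X(2) M0] unfolding X(1) by metis
  \<comment> \<open>A round takes two capped steps: the weight of a vertex is charged when it is
    left, first that of the Player-1 state and then that of the Player-2 state.\<close>
  define upd where "upd = (\<lambda>(q, j, e) (x, i).
      (delta A q (x \<union> i), i, cap_step M wv (V2 q x) (cap_step M wv (V1 q j) e)))"
  define mem where "mem h = foldl upd (init A, j\<^sub>0, M) h" for h
  define me where "me h = snd (snd (mem h))" for h
  \<comment> \<open>The default \<open>{}\<close> and the intersection with \<open>Out\<close> keep
    the move legal where \<open>s\<close> gives no usable answer.\<close>
  define sO where "sO h = (case fst (s (V1 (fst (mem h)) (fst (snd (mem h))), me h)) of
      V1 q i \<Rightarrow> {} | V2 q x \<Rightarrow> x \<inter> Out)" for h
  have mem_snoc: "mem (h @ [r]) = upd (mem h) r" for h r by (simp add: mem_def)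
  have mem_eq: "mem h = (fst (hstate h), snd (hstate h), me h)" for h
  proof (induction h rule: rev_induct)
    case Nil
    then show ?case by (simp add: mem_def me_def)
  next
    case (snoc r h)
    obtain x i where r: "r = (x, i)" by fastforce
    have "mem (h @ [r]) = upd (fst (hstate h), snd (hstate h), me h) r"
      unfolding mem_snoc using snoc by simp
    then show ?case unfolding me_def by (simp add: r upd_def)
  qed
  have me_Nil: "me [] = M" by (simp add: me_def mem_def)
  have me_snoc: "me (h @ [(x, i)]) = cap_step M wv (V2 (fst (hstate h)) x)
      (cap_step M wv (V1 (fst (hstate h)) (snd (hstate h))) (me h))" for h x i
    unfolding me_def[of "h @ [(x, i)]"] mem_snoc by (subst mem_eq) (simp add: upd_def)
  have sO: "sO \<in> strategies_O Inp Out"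
    by (auto simp: strategies_O_def sO_def split: vertex.split)
  have hist_S: "V1 (fst (hstate h)) (snd (hstate h)) \<in> S \<and> - 1 \<le> me h \<and> me h \<le> M"
    if "h \<in> histories Inp Out" for h
    using that
  proof (induction h rule: rev_induct)
    case Nil
    then show ?case using v0_S M0 by (simp add: me_Nil)
  next
    case (snoc r h)
    obtain x i where r: "r = (x, i)" by fastforce
    have xi: "x \<in> Pow Out" "i \<in> Pow Inp" and h: "h \<in> histories Inp Out"
      using snoc.prems by (auto simp: r histories_def)
    have "(V1 (fst (hstate h)) (snd (hstate h)), V2 (fst (hstate h)) x) \<in> G"
      using snoc.IH[OF h] xi by simp
    then have "V2 (fst (hstate h)) x \<in> S" using G_S by blast
    then have "(V2 (fst (hstate h)) x, V1 (delta A (fst (hstate h)) (x \<union> i)) i) \<in> G" using xi by simp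
    then have "V1 (delta A (fst (hstate h)) (x \<union> i)) i \<in> S" using G_S by blast
    then show ?case
      unfolding r hstate_snoc me_snoc by (simp add: cap_step_bounds(1) cap_step_bounds(2)[OF M0])
  qed
  let ?H = "histories Inp Out"
  have inj: "inj_on (\<lambda>(q, j, e). (V1 q j, e :: int)) (mem ` ?H)"
    by (auto simp: inj_on_def split: prod.splits)
  have sub: "(\<lambda>(q, j, e). (V1 q j, e)) ` mem ` ?H \<subseteq> S \<times> {- 1..M}"
  proof -
    have "(\<lambda>(q, j, e). (V1 q j, e)) (mem h) \<in> S \<times> {- 1..M}" if "h \<in> ?H" for h
      using hist_S[OF that] by (subst mem_eq) simp
    then show ?thesis by blast
  qed
  have finS: "finite (S \<times> {- 1..M})" using finite_S by simp
  have finmem: "finite (mem ` ?H)" using finite_imageD[OF finite_subset[OF sub finS] inj] .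
  have "card (mem ` ?H) \<le> card (S \<times> {- 1..M})"
    using card_mono[OF finS sub] card_image[OF inj] by simp
  then have "int (card (mem ` ?H)) \<le> int (card (S \<times> {- 1..M}))" by (simp only: of_nat_le_iff)
  then have card: "int (card (mem ` ?H)) \<le> int (card S) * (M + 2)"
    using M0 by (simp add: card_cartesian_product add.commute)
  obtain k where k: "memory_size Inp Out sO k" "k \<le> card (mem ` ?H)"
    by (rule kernel_memory_size[OF finmem, of sO]) (auto simp: mem_snoc sO_def me_def)
  have "int (card S) * (M + 2) \<le> int (card S) * (D + 2)" using MD by (intro mult_left_mono) auto
  then have k_le: "int k \<le> int (card S) * (D + 2)" using k(2) card by linarith
  have play: "parity True ?pr (play_path sO sI) \<and> - M \<le> esum wv (play_path sO sI) n"
    if sI: "sI \<in> strategies_I Inp Out" for sI n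
  proof -
    let ?u = "play_path sO sI"
    define e where "e = rec_nat M (\<lambda>n. cap_step M wv (?u n))"
    have e: "e 0 = M" "e (Suc n) = cap_step M wv (?u n) (e n)" for n by (simp_all add: e_def)
    have e_even: "e (2 * m) = me (play_prefix sO sI m)" for m
    proof (induction m)
      case 0
      then show ?case by (simp add: e me_Nil)
    next
      case (Suc m)
      have "e (2 * Suc m) = cap_step M wv (?u (Suc (2 * m))) (cap_step M wv (?u (2 * m)) (e (2 * m)))"
        by (simp add: e)
      then show ?case
        unfolding Suc play_path_odd play_path_even by (simp add: Let_def me_snoc)
    qed
    have step: "(?u n, ?u (Suc n)) \<in> Restr G X \<and> (?u n \<in> player_O \<longrightarrow> ?u (Suc n) = fst (s (?u n, e n)))"
      if n: "?u n \<in> Domain (Restr G X)" "0 \<le> e n" "e n \<le> M" for n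
    proof -
      have uX: "?u n \<in> X" using n(1) X(1) by simp
      have edge: "(?u n, ?u (Suc n)) \<in> G" by (rule play_path_step[OF sO sI])
      show ?thesis
      proof (cases "even n")
        case True
        then obtain m where m: "n = 2 * m" by blast
        define h where "h = play_prefix sO sI m"
        define q j where "q = fst (hstate h)" and "j = snd (hstate h)"
        have un: "?u n = V1 q j" unfolding m play_path_even by (simp add: q_def j_def h_def)
        have en: "e n = me h" unfolding m e_even h_def ..
        have "(V1 q j, e n) \<in> Domain (cap_edges (Restr G X) M wv)"
          using cap_edges_arena(1)[OF X(2) M0, of wv] n un by auto
        then have "((V1 q j, e n), s (V1 q j, e n)) \<in> cap_edges (Restr G X) M wv"
          using s unfolding positional_def by simp
        then have se: "(V1 q j, fst (s (V1 q j, e n))) \<in> Restr G X"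
          using n(2) by (cases "s (V1 q j, e n)") (simp add: cap_edges_iff)
        then obtain x where x: "fst (s (V1 q j, e n)) = V2 q x" "x \<subseteq> Out"
          by (cases "fst (s (V1 q j, e n))") auto
        have "sO h = x"
          unfolding sO_def mem_eq[of h] using x en by (auto simp: q_def j_def)
        then have "?u (Suc n) = V2 q x" unfolding m play_path_odd by (simp add: q_def h_def)
        then show ?thesis using se x(1) un by simp
      next
        case False
        then obtain m where m: "n = Suc (2 * m)" by (metis oddE Suc_eq_plus1)
        have "?u n \<notin> player_O" unfolding m play_path_odd by simp
        then show ?thesis using closed[OF uX _ edge] edge uX by blast
      qed
    qed
    have u0: "?u 0 \<in> Domain (Restr G X)" using v0X X(1) by simp
    have av: "avoids (cap_edges (Restr G X) M wv) (lift_player player_O) (parity False (cap_prio ?pr)) s (?u 0, M)"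
      using s_win[OF v0X] by simp
    show ?thesis
      using cap_play[OF X(2) M0 s av e u0 step] by blast
  qed
  show ?thesis
  proof (rule that[OF sO k(1) k_le])
    fix sI assume sI: "sI \<in> strategies_I Inp Out"
    show "outcome sO sI \<Turnstile> \<phi>" using play[OF sI] sat_iff_parity[OF sO sI] by blast
    show "- D \<le> esum wv (play_path sO sI) n" for n using play[OF sI, of n] MD by linarith
  qed
qed

lemma energy_to_EL:
  assumes "sO \<in> strategies_O Inp Out" "sI \<in> strategies_I Inp Out"
    and "\<And>n. - D \<le> esum wv (play_path sO sI) n"
  shows "- (of_int D / of_nat b + vertex_weight Inp Out w v\<^sub>0) \<le> EL Inp Out w (outcome sO sI) n"
proof -
  have "of_int (- D) \<le> (of_int (esum wv (play_path sO sI) (Suc (2 * n))) :: rat)"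
    using assms(3)[of "Suc (2 * n)"] by (simp only: of_int_le_iff)
  also have "\<dots> = of_nat b * (vertex_weight Inp Out w v\<^sub>0 + EL Inp Out w (outcome sO sI) n)"
    by (rule esum_play_path[OF assms(1,2) of_int_wv])
  finally show ?thesis using b by (simp add: field_simps)
qed

text \<open>A constant lower bound on the shifted energy, divided by the length of the prefix,
  vanishes in the limit.\<close>

lemma MP_ge:
  assumes "sO \<in> strategies_O Inp Out" "sI \<in> strategies_I Inp Out"
    and low: "\<And>n. - C \<le> EL Inp Out w (outcome sO sI) n"
  shows "ereal (real_of_rat \<nu>) \<le> MP Inp Out W\<^sub>P (outcome sO sI)"
proof -
  have lower: "real_of_rat \<nu> - real_of_rat C / real n \<le> real_of_rat (EL Inp Out W\<^sub>P (outcome sO sI) n) / real n"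
    if "0 < n" for n
  proof -
    have "real_of_rat (- C) \<le> real_of_rat (EL Inp Out w (outcome sO sI) n)"
      using low by (simp only: of_rat_less_eq)
    moreover have "real_of_rat (EL Inp Out W\<^sub>P (outcome sO sI) n) =
        real_of_rat (EL Inp Out w (outcome sO sI) n) + real n * real_of_rat \<nu>"
      unfolding EL_shift[OF assms(1,2)] by (simp add: of_rat_add of_rat_mult)
    ultimately have "(real n * real_of_rat \<nu> - real_of_rat C) / real n \<le> real_of_rat (EL Inp Out W\<^sub>P (outcome sO sI) n) / real n"
      by (intro divide_right_mono) (auto simp: of_rat_minus)
    moreover have "(real n * real_of_rat \<nu> - real_of_rat C) / real n = real_of_rat \<nu> - real_of_rat C / real n"
      using that by (simp add: field_simps)
    ultimately show ?thesis by simp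
  qed
  have "(\<lambda>n. real_of_rat \<nu> - real_of_rat C / real n) \<longlonglongrightarrow> real_of_rat \<nu> - 0"
    by (intro tendsto_diff tendsto_const lim_const_over_n)
  then have "(\<lambda>n. ereal (real_of_rat \<nu> - real_of_rat C / real n)) \<longlonglongrightarrow> ereal (real_of_rat \<nu>)" by simp
  then have "ereal (real_of_rat \<nu>) = liminf (\<lambda>n. ereal (real_of_rat \<nu> - real_of_rat C / real n))"
    by (rule lim_imp_Liminf[OF sequentially_bot, symmetric])
  also have "\<dots> \<le> MP Inp Out W\<^sub>P (outcome sO sI)"
    unfolding MP_def
    by (intro Liminf_mono eventually_sequentiallyI[of 1]) (use lower in auto)
  finally show ?thesis .
qed

lemma realizable_if_not_beaten:
  assumes win: "\<And>t. positional G (- player_O) t \<Longrightarrow> \<not> beaten t"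
  shows "E_realizable Inp Out \<phi> w"
    and "\<exists>sO k. MP_winning Inp Out \<phi> W\<^sub>P \<nu> sO \<and> memory_size Inp Out sO k \<and>
      of_nat k \<le> 4 * of_nat (card S) ^ 2 * of_nat (num_priorities Inp Out A j\<^sub>0) *
        max 1 (of_nat b * max_abs_weight Inp Out A j\<^sub>0 w)"
proof -
  \<comment> \<open>Every strategy has at least one memory class, so a bound proportional to the
    maximal weight would fail when all weights are zero; hence the maximum with 1.\<close>
  define B where "B = max 1 (of_nat b * max_abs_weight Inp Out A j\<^sub>0 w)"
  define W where "W = \<lfloor>B\<rfloor>"
  have finG: "finite G" using arena_G(2) by (simp add: arena_def)
  have W1: "1 \<le> W" by (simp add: W_def B_def le_floor_iff)
  have WB: "of_int W \<le> B" by (simp add: W_def)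
  have wW: "\<bar>wv v\<bar> \<le> W" if v: "v \<in> S" for v
  proof -
    obtain e where e: "e \<in> G" "edge_weight Inp Out w e = vertex_weight Inp Out w v"
      by (rule vertex_weight_edge[OF v])
    have "\<bar>edge_weight Inp Out w e\<bar> \<le> max_abs_weight Inp Out A j\<^sub>0 w"
      unfolding max_abs_weight_def using finG e(1) by (intro Max_ge) auto
    then have "of_nat b * \<bar>edge_weight Inp Out w e\<bar> \<le> of_nat b * max_abs_weight Inp Out A j\<^sub>0 w"
      by (intro mult_left_mono) auto
    then have "\<bar>of_int (wv v)\<bar> \<le> B" unfolding of_int_wv[OF v] B_def e(2) by (simp add: abs_mult)
    then show ?thesis unfolding W_def le_floor_iff by simp
  qed
  let ?d = "num_priorities Inp Out A j\<^sub>0" and ?n = "card S"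
  define D where "D = 3 * int (?d * ?n) * W"
  obtain sO k where sO: "sO \<in> strategies_O Inp Out" "memory_size Inp Out sO k"
      "int k \<le> int ?n * (D + 2)"
    and sat: "\<And>sI. sI \<in> strategies_I Inp Out \<Longrightarrow> outcome sO sI \<Turnstile> \<phi>"
    and low: "\<And>sI n. sI \<in> strategies_I Inp Out \<Longrightarrow> - D \<le> esum wv (play_path sO sI) n"
    by (rule finite_memory_strategy[OF W1 wW win, folded D_def]) blast+
  define C where "C = of_int D / of_nat b + vertex_weight Inp Out w v\<^sub>0"
  have EL: "- C \<le> EL Inp Out w (outcome sO sI) n" if "sI \<in> strategies_I Inp Out" for sI n
    unfolding C_def by (rule energy_to_EL[OF sO(1) that low[OF that]])
  obtain c\<^sub>0 :: nat where "C \<le> of_nat c\<^sub>0" using real_arch_simple[of C] by blast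
  then have "0 \<le> of_nat c\<^sub>0 + EL Inp Out w (outcome sO sI) n" if "sI \<in> strategies_I Inp Out" for sI n
    using EL[OF that, of n] by linarith
  then show "E_realizable Inp Out \<phi> w"
    unfolding E_realizable_def using sO(1) sat by blast
  have "MP_winning Inp Out \<phi> W\<^sub>P \<nu> sO"
    unfolding MP_winning_def Val_def using sO(1) sat MP_ge[OF sO(1) _ EL] by simp
  moreover have "of_nat k \<le> 4 * of_nat ?n ^ 2 * of_nat ?d * B"
  proof -
    have "{v\<^sub>0, V2 (init A) {}} \<subseteq> S" using v0_S G_S[of v\<^sub>0 "V2 (init A) {}"] by simp
    then have "card {v\<^sub>0, V2 (init A) {}} \<le> ?n" by (rule card_mono[OF finite_S])
    then have n2: "2 \<le> ?n" by simp
    have d1: "1 \<le> ?d"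
      unfolding num_priorities_def using v0_S finite_S by (simp add: Suc_le_eq card_gt_0_iff) blast
    \<comment> \<open>With at least two states, the 2 from the levels \<open>- 1\<close> and 0 is at
      most \<open>n * d * W\<close>, which turns the factor 3 of the cap into 4.\<close>
    have "2 * 1 \<le> int (?n * ?d) * W"
    proof (rule mult_mono)
      have "2 * 1 \<le> ?n * ?d" using n2 d1 by (rule mult_le_mono)
      then show "2 \<le> int (?n * ?d)" by linarith
    qed (use W1 in auto)
    then have "int ?n * 2 \<le> int ?n * (int (?n * ?d) * W)" by (intro mult_left_mono) auto
    then have "int k \<le> 4 * int ?n ^ 2 * int ?d * W"
      using sO(3) by (simp add: D_def algebra_simps power2_eq_square)
    then have "(of_int (int k) :: rat) \<le> of_int (4 * int ?n ^ 2 * int ?d * W)" by (simp only: of_int_le_iff)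
    also have "\<dots> = 4 * of_nat ?n ^ 2 * of_nat ?d * of_int W" by simp
    also have "\<dots> \<le> 4 * of_nat ?n ^ 2 * of_nat ?d * B" using WB by (intro mult_left_mono) auto
    finally show ?thesis by simp
  qed
  ultimately show "\<exists>sO k. MP_winning Inp Out \<phi> W\<^sub>P \<nu> sO \<and> memory_size Inp Out sO k \<and>
      of_nat k \<le> 4 * of_nat ?n ^ 2 * of_nat ?d * max 1 (of_nat b * max_abs_weight Inp Out A j\<^sub>0 w)"
    using sO(2) unfolding B_def by blast
qed

end

theorem theorem8:
  fixes Inp Out :: "'p set"
    and \<phi> :: "'p ltl"
    and w\<^sub>P :: "'p lit \<Rightarrow> int"
    and \<nu> :: rat
    and w\<^sub>\<nu> :: "'p lit \<Rightarrow> rat"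
    and A :: "('q, 'p) automaton"
    and j\<^sub>0 :: "'p set"
  assumes "finite Inp" and "finite Out" and "Inp \<inter> Out = {}"
    and "atoms \<phi> \<subseteq> Inp \<union> Out"
    and "\<forall>\<sigma> \<in> Pow (Inp \<union> Out).
           letter_weight Inp Out w\<^sub>\<nu> \<sigma> = letter_weight Inp Out (\<lambda>l. rat_of_int (w\<^sub>P l)) \<sigma> - \<nu>"
    and "parity_automaton (Inp \<union> Out) A"
    and "automaton_language (Inp \<union> Out) A = ltl_language (Inp \<union> Out) \<phi>"
    and "j\<^sub>0 \<in> Pow Inp"
  shows "(MP_realizable_fm Inp Out \<phi> (\<lambda>l. rat_of_int (w\<^sub>P l)) \<nu> \<longleftrightarrow> E_realizable Inp Out \<phi> w\<^sub>\<nu>) \<and>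
         (MP_realizable_fm Inp Out \<phi> (\<lambda>l. rat_of_int (w\<^sub>P l)) \<nu> \<longrightarrow>
           (\<forall>b :: nat. b > 0 \<and>
              (\<forall>e \<in> game_edges Inp Out A j\<^sub>0. of_nat b * edge_weight Inp Out w\<^sub>\<nu> e \<in> \<int>) \<longrightarrow>
              (\<exists>sO k. MP_winning Inp Out \<phi> (\<lambda>l. rat_of_int (w\<^sub>P l)) \<nu> sO \<and>
                 memory_size Inp Out sO k \<and>
                 of_nat k \<le> 4 * of_nat (card (game_states Inp Out A j\<^sub>0)) ^ 2
                            * of_nat (num_priorities Inp Out A j\<^sub>0)
                            * max 1 (of_nat b * max_abs_weight Inp Out A j\<^sub>0 w\<^sub>\<nu>))))"
proof -
  interpret ltl_game Inp Out \<phi> A j\<^sub>0 by unfold_locales (use assms in auto)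
  have weighted: "weighted_game Inp Out \<phi> A j\<^sub>0 w\<^sub>P \<nu> w\<^sub>\<nu> b"
    if "0 < b" "\<forall>e \<in> G. of_nat b * edge_weight Inp Out w\<^sub>\<nu> e \<in> \<int>" for b
    by unfold_locales (use assms(5) that in auto)
  \<comment> \<open>The equivalence mentions no denominator, so some common one is fixed here; the
    memory bound is shown for every admissible \<open>b\<close> by interpreting the locale once
    more.\<close>
  have "finite (edge_weight Inp Out w\<^sub>\<nu> ` G)" using arena_G(2) by (simp add: arena_def)
  then obtain b where b: "0 < b" "\<forall>x \<in> edge_weight Inp Out w\<^sub>\<nu> ` G. of_nat b * x \<in> \<int>"
    using common_denominator by blast
  interpret W: weighted_game Inp Out \<phi> A j\<^sub>0 w\<^sub>P \<nu> w\<^sub>\<nu> b by (rule weighted) (use b in auto)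
  have "MP_realizable_fm Inp Out \<phi> (\<lambda>l. rat_of_int (w\<^sub>P l)) \<nu> \<longleftrightarrow> E_realizable Inp Out \<phi> w\<^sub>\<nu>"
  proof
    assume "MP_realizable_fm Inp Out \<phi> (\<lambda>l. rat_of_int (w\<^sub>P l)) \<nu>"
    then show "E_realizable Inp Out \<phi> w\<^sub>\<nu>"
      using W.realizable_if_not_beaten(1) W.MP_realizable_not_beaten by blast
  next
    assume "E_realizable Inp Out \<phi> w\<^sub>\<nu>"
    then show "MP_realizable_fm Inp Out \<phi> (\<lambda>l. rat_of_int (w\<^sub>P l)) \<nu>"
      using W.realizable_if_not_beaten(2) W.E_realizable_not_beaten unfolding MP_realizable_fm_def by blast
  qed
  moreover have "\<exists>sO k. MP_winning Inp Out \<phi> (\<lambda>l. rat_of_int (w\<^sub>P l)) \<nu> sO \<and> memory_size Inp Out sO k \<and>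
      of_nat k \<le> 4 * of_nat (card S) ^ 2 * of_nat (num_priorities Inp Out A j\<^sub>0) *
        max 1 (of_nat b * max_abs_weight Inp Out A j\<^sub>0 w\<^sub>\<nu>)"
    if "MP_realizable_fm Inp Out \<phi> (\<lambda>l. rat_of_int (w\<^sub>P l)) \<nu>"
      and "0 < b" "\<forall>e \<in> G. of_nat b * edge_weight Inp Out w\<^sub>\<nu> e \<in> \<int>" for b
  proof -
    interpret V: weighted_game Inp Out \<phi> A j\<^sub>0 w\<^sub>P \<nu> w\<^sub>\<nu> b by (rule weighted[OF that(2,3)])
    show ?thesis using V.realizable_if_not_beaten(2) V.MP_realizable_not_beaten[OF that(1)] by blast
  qed
  ultimately show ?thesis by blast
qed

end
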